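(* Let $P(\lambda)=\lambda^2M-\lambda(G-D)+K\in\mathcal P^n_{2,1}$, i.e., $M,D,K,G\in\mathbb R^{n,n}$ with $G^\top=-G$ and $M,D,K$ symmetric positive semidefinite. (i) $P(\lambda)$ is singular if and only if the four matrices $M,D,K,G$ have a nontrivial common kernel. In particular, the structured distance to singularity $d_{\mathrm{sing}}^{\mathcal P}(P(\lambda))$ is attained for a perturbation of the form $\Delta_M^u,\Delta_D^u,\Delta_K^u,\Delta_G^u$ (of $M,D,K,G$, respectively) for some $u\in\mathbb R^n$ with $\|u\|_2=1$ and satisfies $$d_{\mathrm{sing}}^{\mathcal P}(P(\lambda))=d_{\mathrm{ck}}^{\mathcal S}(G,M,D,K)=\min_{u\in\mathbb R^n,\|u\|_2=1}\Big(2\|Gu\|_2^2+\sum_{X\in\{M,D,K\}}\big(2\|(I-uu^\top)Xu\|_2^2+(u^\top Xu)^2\big)\Big)^{1/2}$$ (one summand for each of the three matrices $M,D,K$). In particular, $$\sqrt{\lambda_{\min}(M^2+D^2+K^2-G^2)}\leq d_{\mathrm{sing}}^{\mathcal P}(P(\lambda))\leq\sqrt{2\cdot\lambda_{\min}(M^2+D^2+K^2-G^2)}.$$ (ii) $P(\lambda)$ is in the closure of the set of polynomials in $\mathcal P^n_{2,1}$ that are regular and of index larger than one (and thus of index exactly two) if and only if $M$ and $D$ have a nontrivial common kernel. In particular, the structured distance to higher index $d_{\mathrm{hi}}^{\mathcal P}(P(\lambda))$ is attained for a perturbation of the form $\Delta_M^u,\Delta_D^u$ (of $M,D$, respectively)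 for some $u\in\mathbb R^n$ with $\|u\|_2=1$ and satisfies $$d_{\mathrm{hi}}^{\mathcal P}(P(\lambda))=d_{\mathrm{ck}}^{\mathcal S}(0,M,D)=\min_{u\in\mathbb R^n,\|u\|_2=1}\Big(\sum_{X\in\{M,D\}}\big(2\|(I-uu^\top)Xu\|_2^2+(u^\top Xu)^2\big)\Big)^{1/2}$$ (one summand for each of the two matrices $M,D$). In particular, $$\sqrt{\lambda_{\min}(M^2+D^2)}\leq d_{\mathrm{hi}}^{\mathcal P}(P(\lambda))\leq\sqrt{2\cdot\lambda_{\min}(M^2+D^2)}.$$ (iii) $P(\lambda)$ is in the closure of the set of polynomials in $\mathcal P^n_{2,1}$ that are unstable if and only if $M$ and $D$ have a nontrivial common kernel or $D$ and $K$ have a nontrivial common kernel. In particular, the structured distance to instability $d_{\mathrm{inst}}^{\mathcal P}(P(\lambda))$ is attained for a perturbation of the form $\Delta_M^u,\Delta_D^u,\Delta_K^u$ (of $M,D,K$, respectively) with $\Delta_M^u=0$ or $\Delta_K^u=0$, for some $u\in\mathbb R^n$ with $\|u\|_2=1$, and satisfies $$d_{\mathrm{inst}}^{\mathcal P}(P(\lambda))=\min\big\{d_{\mathrm{ck}}^{\mathcal S}(0,M,D),\ d_{\mathrm{ck}}^{\mathcal S}(0,D,K)\big\},$$ where $d_{\mathrm{ck}}^{\mathcal S}(0,X_0,X_1)=\min_{u\in\mathbb R^n,\|u\|_2=1}\big(\sum_{i=0}^1(2\|(I-uu^\top)X_iu\|_2^2+(u^\top X_iu)^2)\big)^{1/2}$.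 Moreover, $$\sqrt{\alpha}\leq d_{\mathrm{inst}}^{\mathcal P}(P(\lambda))\leq\sqrt{2\cdot\alpha},\qquad \alpha:=\min\{\lambda_{\min}(M^2+D^2),\lambda_{\min}(D^2+K^2)\}.$$
   Context: $\mathcal P^n_{2,1}$ is the set of matrix polynomials $\lambda^2M-\lambda(G-D)+K$ with $M,D,K,G\in\mathbb R^{n,n}$, $G^\top=-G$ and $M,D,K$ symmetric positive semidefinite. $\|\lambda^2Y_2+\lambda Y_1+Y_0\|_F:=\|[Y_0,Y_1,Y_2]\|_F$ (Frobenius norm). $\lambda_{\min}(X)$ is the smallest eigenvalue of a symmetric positive semidefinite matrix $X$. For $Y\in\mathbb R^{n,n}$ and $u\in\mathbb R^n$ with $\|u\|_2=1$, $\Delta_Y^u:=-uu^\top Y-Yuu^\top+uu^\top Yuu^\top$. Closures are with respect to coefficientwise convergence in $\mathcal P^n_{2,1}$. $P$ is singular if $\det P(\lambda)\equiv0$ and regular otherwise. The index and (in)stability of $P(\lambda)=\lambda^2Y_2+\lambda Y_1+Y_0$ are defined as those of its companion linearization $\lambda\begin{bmatrix}Y_2&0\\0&I\end{bmatrix}+\begin{bmatrix}Y_1&Y_0\\-I&0\end{bmatrix}$. The index of a pencil is the size of its largest Kronecker block associated with the eigenvalue $\infty$ in the Kronecker canonical form ($0$ if there is none). A pencil is stable if it is regular, all its finite eigenvalues lie in the closed left half plane, and all eigenvalues on the imaginary axis (including $\infty$) have largest associated Jordan block of size at most one; otherwise it is unstable. With $\Delta_P$ ranging over real $n\times n$ matrix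 polynomials of degree at most 2: $d_{\mathrm{sing}}^{\mathcal P}(P)$, $d_{\mathrm{hi}}^{\mathcal P}(P)$, $d_{\mathrm{inst}}^{\mathcal P}(P)$ are the infima of $\|\Delta_P(\lambda)\|_F$ over all $\Delta_P$ such that $P+\Delta_P\in\mathcal P^n_{2,1}$ is, respectively, singular, of index $\geq2$, unstable. For real $n\times n$ matrices $J=-J^\top$ and symmetric positive semidefinite $X_0,\dots,X_\ell$, $d_{\mathrm{ck}}^{\mathcal S}(J,X_0,\dots,X_\ell)$ is the infimum of $\|[\Delta_J,\Delta_{X_0},\dots,\Delta_{X_\ell}]\|_F$ over all real perturbations such that $J+\Delta_J$ is skew-symmetric, each $X_i+\Delta_{X_i}$ is symmetric positive semidefinite, and $\ker(J+\Delta_J)\cap\bigcap_{i=0}^\ell\ker(X_i+\Delta_{X_i})\neq\{0\}$.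
   Formalization: In (ii), (iii) "attained" means the perturbation's norm equals the distance and the perturbed polynomial lies in the closure of the set (literal attainment fails for P=0 in (ii)); in (iii) the perturbation of M or of K is replaced by 0 instead of the formula Δ^u vanishing. *)

theory Defs
  imports
    "Jordan_Normal_Form.Jordan_Normal_Form"
    "HOL-Analysis.Analysis"
begin

text \<open>
  Matrices of the theory are of type \<^typ>\<open>real^'n^'n\<close>. The list-based matrices of
  Jordan_Normal_Form (type \<^typ>\<open>complex mat\<close>) serve only to write down the
  block diagonal Kronecker canonical form.
\<close>

hide_const (open) Matrix.vec Matrix.mat Determinant.det Matrix.row Matrix.col
no_notation Matrix.vec_index (infixl \<open>$\<close> 100)
no_notation Matrix.scalar_prod (infix \<open>\<bullet>\<close> 70)

subsection \<open>Kronecker canonical form of a square pencil\<close>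

text \<open>
  A pencil \<open>\<lambda> E + A\<close> is given by the two matrices \<open>E\<close>, \<open>A\<close>. The four kinds of
  Kronecker blocks are
  \<open>RightBlock \<epsilon>\<close>: \<open>\<lambda> [I 0] - [0 I]\<close> of size \<open>\<epsilon> \<times> (\<epsilon>+1)\<close>;
  \<open>LeftBlock \<eta>\<close>: the transposed shape, of size \<open>(\<eta>+1) \<times> \<eta>\<close>;
  \<open>FinBlock \<rho> a\<close>: \<open>\<lambda> I - J\<close> with \<open>J\<close> the Jordan block of size \<open>\<rho>\<close> for \<open>a\<close>;
  \<open>InfBlock \<sigma>\<close>: \<open>\<lambda> N - I\<close> with \<open>N\<close> the nilpotent Jordan block of size \<open>\<sigma>\<close>.
  The singular blocks may have \<open>\<epsilon> = 0\<close> or \<open>\<eta> = 0\<close> (a zero column or a zero row).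
\<close>

datatype kblock = RightBlock nat | LeftBlock nat | FinBlock nat complex | InfBlock nat

fun proper_kblock :: "kblock \<Rightarrow> bool" where
  "proper_kblock (RightBlock \<epsilon>) = True"
| "proper_kblock (LeftBlock \<eta>) = True"
| "proper_kblock (FinBlock \<rho> a) = (\<rho> \<ge> 1)"
| "proper_kblock (InfBlock \<sigma>) = (\<sigma> \<ge> 1)"

fun kblock_lead :: "kblock \<Rightarrow> complex mat" where
  "kblock_lead (RightBlock \<epsilon>) = Matrix.mat \<epsilon> (\<epsilon> + 1) (\<lambda>(i, j). if j = i then 1 else 0)"
| "kblock_lead (LeftBlock \<eta>) = Matrix.mat (\<eta> + 1) \<eta> (\<lambda>(i, j). if i = j then 1 else 0)"
| "kblock_lead (FinBlock \<rho> a) = 1\<^sub>m \<rho>"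
| "kblock_lead (InfBlock \<sigma>) = jordan_block \<sigma> 0"

fun kblock_const :: "kblock \<Rightarrow> complex mat" where
  "kblock_const (RightBlock \<epsilon>) = Matrix.mat \<epsilon> (\<epsilon> + 1) (\<lambda>(i, j). if j = i + 1 then -1 else 0)"
| "kblock_const (LeftBlock \<eta>) = Matrix.mat (\<eta> + 1) \<eta> (\<lambda>(i, j). if i = j + 1 then -1 else 0)"
| "kblock_const (FinBlock \<rho> a) = - jordan_block \<rho> a"
| "kblock_const (InfBlock \<sigma>) = - (1\<^sub>m \<sigma>)"

definition enum_mat :: "(nat \<Rightarrow> 'm) \<Rightarrow> complex^'m^'m \<Rightarrow> complex mat" where
  "enum_mat f X = Matrix.mat CARD('m) CARD('m) (\<lambda>(i, j). X $ f i $ f j)"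

text \<open>
  Strict equivalence to the block diagonal pencil built from \<open>bl\<close>. The choice of the
  enumeration \<open>f\<close> of the index type is immaterial: permutations are absorbed in
  \<open>S\<close> and \<open>T\<close>.
\<close>

definition kronecker_form :: "complex^'m^'m \<Rightarrow> complex^'m^'m \<Rightarrow> kblock list \<Rightarrow> bool" where
  "kronecker_form E A bl \<longleftrightarrow>
     (\<forall>b\<in>set bl. proper_kblock b) \<and>
     (\<exists>S T f. invertible S \<and> invertible T \<and> bij_betw f {..<CARD('m)} (UNIV :: 'm set) \<and>
        enum_mat f (S ** E ** T) = diag_block_mat (map kblock_lead bl) \<and>
        enum_mat f (S ** A ** T) = diag_block_mat (map kblock_const bl))"

text \<open>
  The Kronecker canonical form exists for every pencil and is unique up to the order of the
  blocks, on which nothing below depends; hence the choice operator.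
\<close>

definition kcf :: "complex^'m^'m \<Rightarrow> complex^'m^'m \<Rightarrow> kblock list" where
  "kcf E A = (SOME bl. kronecker_form E A bl)"

definition pencil_index :: "complex^'m^'m \<Rightarrow> complex^'m^'m \<Rightarrow> nat" where
  "pencil_index E A = Max (insert 0 {\<sigma>. InfBlock \<sigma> \<in> set (kcf E A)})"

abbreviation cscale :: "complex \<Rightarrow> complex^'n^'m \<Rightarrow> complex^'n^'m" where
  "cscale z \<equiv> map_matrix ((*) z)"

definition pencil_det :: "complex^'m^'m \<Rightarrow> complex^'m^'m \<Rightarrow> complex \<Rightarrow> complex" where
  "pencil_det E A z = Determinants.det (cscale z E + A)"

definition pencil_regular :: "complex^'m^'m \<Rightarrow> complex^'m^'m \<Rightarrow> bool" where
  "pencil_regular E A \<longleftrightarrow> (\<exists>z. pencil_det E A z \<noteq> 0)"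

text \<open>The last conjunct is the condition at the eigenvalue \<open>\<infinity>\<close>.\<close>

definition pencil_stable :: "complex^'m^'m \<Rightarrow> complex^'m^'m \<Rightarrow> bool" where
  "pencil_stable E A \<longleftrightarrow>
     pencil_regular E A \<and>
     (\<forall>z. pencil_det E A z = 0 \<longrightarrow> Re z \<le> 0) \<and>
     (\<forall>\<rho> z. FinBlock \<rho> z \<in> set (kcf E A) \<and> Re z = 0 \<longrightarrow> \<rho> \<le> 1) \<and>
     (\<forall>\<sigma>. InfBlock \<sigma> \<in> set (kcf E A) \<longrightarrow> \<sigma> \<le> 1)"

subsection \<open>Quadratic matrix polynomials\<close>

text \<open>
  The triple \<open>(Y\<^sub>0, Y\<^sub>1, Y\<^sub>2)\<close> stands for \<open>\<lambda>\<^sup>2 Y\<^sub>2 + \<lambda> Y\<^sub>1 + Y\<^sub>0\<close>. The library norm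
  of such a triple is the Frobenius norm of \<open>[Y\<^sub>0, Y\<^sub>1, Y\<^sub>2]\<close> (see the two lemmas),
  and the library topology is that of coefficientwise convergence.
\<close>

type_synonym 'n qpoly = "(real^'n^'n) \<times> (real^'n^'n) \<times> (real^'n^'n)"

lemma norm_matrix_eq_frobenius:
  "norm (X :: real^'n^'m) = sqrt (\<Sum>i\<in>UNIV. \<Sum>j\<in>UNIV. (X $ i $ j)\<^sup>2)"
  by (simp add: norm_vec_def L2_set_def sum_nonneg)

lemma norm_qpoly_eq:
  "norm ((Y0, Y1, Y2) :: 'n::finite qpoly) = sqrt ((norm Y0)\<^sup>2 + (norm Y1)\<^sup>2 + (norm Y2)\<^sup>2)"
  by (simp add: norm_prod_def)

abbreviation cmatrix :: "real^'n^'m \<Rightarrow> complex^'n^'m" where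
  "cmatrix \<equiv> map_matrix complex_of_real"

fun qpoly_eval :: "'n::finite qpoly \<Rightarrow> complex \<Rightarrow> complex^'n^'n" where
  "qpoly_eval (Y0, Y1, Y2) z = cscale (z\<^sup>2) (cmatrix Y2) + cscale z (cmatrix Y1) + cmatrix Y0"

definition singular :: "'n::finite qpoly \<Rightarrow> bool" where
  "singular P \<longleftrightarrow> (\<forall>z. Determinants.det (qpoly_eval P z) = 0)"

definition block_matrix ::
  "'a^'n^'n \<Rightarrow> 'a^'n^'n \<Rightarrow> 'a^'n^'n \<Rightarrow> 'a^'n^'n \<Rightarrow> 'a^('n + 'n)^('n + 'n)" where
  "block_matrix A B C D = (\<chi> i j. case (i, j) of
       (Inl a, Inl b) \<Rightarrow> A $ a $ b
     | (Inl a, Inr b) \<Rightarrow> B $ a $ b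
     | (Inr a, Inl b) \<Rightarrow> C $ a $ b
     | (Inr a, Inr b) \<Rightarrow> D $ a $ b)"

fun companion_lead :: "'n::finite qpoly \<Rightarrow> complex^('n + 'n)^('n + 'n)" where
  "companion_lead (Y0, Y1, Y2) = cmatrix (block_matrix Y2 0 0 (mat 1))"

fun companion_const :: "'n::finite qpoly \<Rightarrow> complex^('n + 'n)^('n + 'n)" where
  "companion_const (Y0, Y1, Y2) = cmatrix (block_matrix Y1 Y0 (- mat 1) 0)"

definition qpoly_index :: "'n::finite qpoly \<Rightarrow> nat" where
  "qpoly_index P = pencil_index (companion_lead P) (companion_const P)"

definition unstable :: "'n::finite qpoly \<Rightarrow> bool" where
  "unstable P \<longleftrightarrow> \<not> pencil_stable (companion_lead P) (companion_const P)"

subsection \<open>The structured class and the structured distances\<close>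

definition skew :: "real^'n^'n \<Rightarrow> bool" where
  "skew X \<longleftrightarrow> transpose X = - X"

definition psd :: "real^'n^'n \<Rightarrow> bool" where
  "psd X \<longleftrightarrow> transpose X = X \<and> (\<forall>x. 0 \<le> x \<bullet> (X *v x))"

definition dh_poly ::
  "real^'n^'n \<Rightarrow> real^'n^'n \<Rightarrow> real^'n^'n \<Rightarrow> real^'n^'n \<Rightarrow> 'n::finite qpoly" where
  "dh_poly M D K G = (K, - (G - D), M)"

definition dh_class :: "'n::finite qpoly set" where
  "dh_class = {dh_poly M D K G | M D K G. skew G \<and> psd M \<and> psd D \<and> psd K}"

definition d_sing :: "'n::finite qpoly \<Rightarrow> real" where
  "d_sing P = Inf {norm \<Delta> | \<Delta>. P + \<Delta> \<in> dh_class \<and> singular (P + \<Delta>)}"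

definition d_hi :: "'n::finite qpoly \<Rightarrow> real" where
  "d_hi P = Inf {norm \<Delta> | \<Delta>. P + \<Delta> \<in> dh_class \<and> qpoly_index (P + \<Delta>) \<ge> 2}"

definition d_inst :: "'n::finite qpoly \<Rightarrow> real" where
  "d_inst P = Inf {norm \<Delta> | \<Delta>. P + \<Delta> \<in> dh_class \<and> unstable (P + \<Delta>)}"

definition common_kernel :: "(real^'n^'n) list \<Rightarrow> (real^'n) set" where
  "common_kernel Xs = {x. \<forall>X\<in>set Xs. X *v x = 0}"

definition d_ck :: "real^'n^'n \<Rightarrow> (real^'n^'n) list \<Rightarrow> real" where
  "d_ck J Xs = Inf {sqrt ((norm \<Delta>J)\<^sup>2 + (\<Sum>\<Delta>X\<leftarrow>\<Delta>Xs. (norm \<Delta>X)\<^sup>2)) | \<Delta>J \<Delta>Xs.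
     length \<Delta>Xs = length Xs \<and> skew (J + \<Delta>J) \<and>
     (\<forall>i<length Xs. psd (Xs ! i + \<Delta>Xs ! i)) \<and>
     common_kernel ((J + \<Delta>J) # map2 (+) Xs \<Delta>Xs) \<noteq> {0}}"

definition lambda_min :: "real^'n^'n \<Rightarrow> real" where
  "lambda_min X = Min {\<mu>. \<exists>v. v \<noteq> 0 \<and> X *v v = \<mu> *s v}"

definition outer_self :: "real^'n \<Rightarrow> real^'n^'n" where
  "outer_self u = (\<chi> i j. u $ i * u $ j)"

definition Delta :: "real^'n \<Rightarrow> real^'n^'n \<Rightarrow> real^'n^'n" where
  "Delta u Y = - (outer_self u ** Y) - Y ** outer_self u + outer_self u ** Y ** outer_self u"

definition psd_cost :: "(real^'n^'n) list \<Rightarrow> real^'n \<Rightarrow> real" where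
  "psd_cost Xs u = (\<Sum>X\<leftarrow>Xs. 2 * (norm ((mat 1 - outer_self u) *v (X *v u)))\<^sup>2 + (u \<bullet> (X *v u))\<^sup>2)"

definition is_sphere_min :: "(real^'n \<Rightarrow> real) \<Rightarrow> real \<Rightarrow> bool" where
  "is_sphere_min f m \<longleftrightarrow> (\<exists>u. norm u = 1 \<and> f u = m) \<and> (\<forall>u. norm u = 1 \<longrightarrow> m \<le> f u)"

end

theory Submission
  imports Defs "Jordan_Normal_Form.Jordan_Normal_Form_Existence"
begin

text \<open>
  The set of singular members of the class, and the closures of the members of index larger than
  one and of the unstable members, are described by common kernels of the symmetric coefficients
  and, for singularity, of \<open>G\<close> as well. This reduces all three distances to one problem about
  matrices with a prescribed kernel vector.

  Prescribing a kernel vector. Let \<open>u\<close> be a unit vector and \<open>Q = I - u u\<^sup>T\<close>. Then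
  \<open>X + \<Delta>\<^sup>u\<^sub>X = Q X Q\<close> annihilates \<open>u\<close> and is skew-symmetric or positive semidefinite with \<open>X\<close>.
  Moreover \<open>- \<Delta>\<^sup>u\<close> is the orthogonal projection onto the complement of \<open>{Q Y Q}\<close> in the Frobenius
  inner product (\<open>norm_Delta_le\<close>). If \<open>X + E\<close> and its transpose annihilate \<open>u\<close>, then
  \<open>\<Delta>\<^sup>u\<^sub>E = - \<Delta>\<^sup>u\<^sub>X\<close>, so \<open>\<parallel>\<Delta>\<^sup>u\<^sub>X\<parallel> \<le> \<parallel>E\<parallel>\<close>: no admissible perturbation is cheaper. Minimising over the
  compact sphere gives the formula for the common kernel distance (\<open>d_ck_sphere_min\<close>). For
  symmetric \<open>X\<close> the cost is \<open>2 \<parallel>X u\<parallel>\<^sup>2 - (u\<^sup>T X u)\<^sup>2\<close>, which lies between \<open>\<parallel>X u\<parallel>\<^sup>2 = u\<^sup>T X\<^sup>2 u\<close> and twice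
  that number; the Rayleigh principle turns this into the eigenvalue bounds.

  From spectral properties to kernels. If \<open>P(z) x = 0\<close> with \<open>x \<noteq> 0\<close> and \<open>Re z > 0\<close>, the real part of
  \<open>x\<^sup>* P(z) x / z = 0\<close> is a sum of three nonnegative terms, because \<open>x\<^sup>* G x\<close> is imaginary; hence
  \<open>x\<close> is in the kernel of \<open>M\<close>, \<open>D\<close>, \<open>K\<close> and then of \<open>G\<close>. The case \<open>z = 1\<close> settles singularity, and
  the other values of \<open>z\<close> show that a regular \<open>P\<close> has no eigenvalue in the open right half plane. Evaluating the same
  forms along Jordan chains of length two of the companion pencil, a chain at \<open>\<infinity>\<close> or at a nonzero
  imaginary eigenvalue forces a common kernel of \<open>M\<close> and \<open>D\<close>, and a chain at \<open>0\<close> forces one of \<open>D\<close>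
  and \<open>K\<close>. A chain of length three at \<open>\<infinity>\<close> would make \<open>P\<close> singular (\<open>regular_InfBlock\<close>,
  \<open>unstable_imp_kernel\<close>).

  From kernels to spectral properties. If \<open>M u = D u = 0\<close>, a chain of length two at \<open>\<infinity>\<close> starting in
  \<open>u\<close> needs a solution of \<open>M b = G u\<close>. Since \<open>G u\<close> is orthogonal to \<open>u\<close>, it exists after \<open>M\<close> is
  replaced by \<open>M + t Q\<close> with \<open>t > 0\<close>, and \<open>K + t I\<close> makes the polynomial regular; \<open>t \<rightarrow> 0\<close> shows that
  \<open>P\<close> lies in the closure. The argument at \<open>0\<close> for \<open>D u = K u = 0\<close> is the same with \<open>K\<close> in
  the place of \<open>M\<close>. Thus the perturbations that are optimal for the second and third distance lead
  into the closure of the respective set, not necessarily into the set.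

  The index and stability are read off from the Kronecker canonical form, so the chains have to be
  translated into blocks. Every regular pencil is shown to have such a form, by the Jordan form of
  \<open>(z\<^sub>0 E + A)\<^sup>-\<^sup>1 E\<close> (\<open>weierstrass_regular\<close>), and whichever form
  of a regular pencil is chosen, it has a block of size at least two at an eigenvalue exactly if there
  is a chain of length two
  (the four lemmas from \<open>InfBlock_imp_chain\<close> to \<open>finite_chain_imp_FinBlock\<close>). Uniqueness of the form
  is thereby bypassed.
\<close>

hide_const (open) Matrix.vec Matrix.mat Determinant.det Matrix.row Matrix.col
no_notation Matrix.vec_index (infixl \<open>$\<close> 100)
no_notation Matrix.scalar_prod (infix \<open>\<bullet>\<close> 70)

declare transpose_matrix_vector [simp del]

section \<open>Cheapest perturbations with a prescribed kernel vector\<close>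

lemma transpose_add: "transpose (X + Y) = transpose X + transpose (Y :: 'a::plus^'n^'m)"
  by (simp add: transpose_def vec_eq_iff)

lemma transpose_diff: "transpose (X - Y) = transpose X - transpose (Y :: 'a::minus^'n^'m)"
  by (simp add: transpose_def vec_eq_iff)

lemma transpose_minus: "transpose (- X) = - transpose (X :: 'a::uminus^'n^'m)"
  by (simp add: transpose_def vec_eq_iff)

lemma transpose_zero: "transpose (0 :: 'a::zero^'n^'m) = 0"
  by (simp add: transpose_def vec_eq_iff)

lemma uminus_matrix_vector_mult: "(- X) *v x = - (X *v (x :: 'a::ring_1^'n))"
  by (simp add: matrix_vector_mult_def vec_eq_iff sum_negf)

lemma inner_mult_transpose: "x \<bullet> (X *v y) = (transpose X *v x) \<bullet> (y :: real^'n)"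
  by (metis dot_lmul_matrix transpose_matrix_vector)

definition outer :: "real^'n \<Rightarrow> real^'n \<Rightarrow> real^'n^'n" where
  "outer a b = (\<chi> i j. a $ i * b $ j)"

lemma outer_self_eq: "outer_self u = outer u u"
  by (simp add: outer_self_def outer_def)

lemma inner_outer: "outer a b \<bullet> X = a \<bullet> (X *v b)"
  by (simp add: outer_def inner_vec_def matrix_vector_mult_def sum_distrib_left ac_simps)

lemma outer_mult_vec: "outer a b *v x = (b \<bullet> x) *\<^sub>R a"
  by (simp add: outer_def vec_eq_iff inner_vec_def matrix_vector_mult_def sum_distrib_left ac_simps)

lemma transpose_outer: "transpose (outer a b) = outer b a"
  by (simp add: outer_def transpose_def vec_eq_iff)

lemma outer_mult: "outer a b ** X = outer a (transpose X *v b)"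
  by (simp add: outer_def transpose_def matrix_vector_mult_def matrix_matrix_mult_def vec_eq_iff
      sum_distrib_left mult.assoc) (simp add: mult.commute)

lemma mult_outer: "X ** outer a b = outer (X *v a) b"
  by (simp add: outer_def matrix_vector_mult_def matrix_matrix_mult_def vec_eq_iff sum_distrib_right
      mult.assoc)

lemma outer_scaleR_left: "outer (c *\<^sub>R a) b = c *\<^sub>R outer a b"
  by (simp add: outer_def vec_eq_iff)

lemma outer_zero_left: "outer 0 b = 0"
  by (simp add: outer_def vec_eq_iff)

lemma outer_zero_right: "outer a 0 = 0"
  by (simp add: outer_def vec_eq_iff)

text \<open>
  The form used for computations: a combination of rank-one matrices whose inner products are
  explicit.
\<close>

lemma Delta_eq:
  "Delta u Y = - outer u (transpose Y *v u) - outer (Y *v u) u + (u \<bullet> (Y *v u)) *\<^sub>R outer u u"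
proof -
  have "outer u u ** Y ** outer u u = (u \<bullet> (Y *v u)) *\<^sub>R outer u u"
    by (simp add: mult_outer outer_mult_vec outer_scaleR_left matrix_vector_mul_assoc[symmetric])
  then show ?thesis
    by (simp add: Delta_def outer_self_eq outer_mult mult_outer)
qed

lemma outer_add: "outer (a + c) b = outer a b + outer c b" "outer a (b + c) = outer a b + outer a c"
  by (simp_all add: outer_def vec_eq_iff algebra_simps)

lemma Delta_add: "Delta u (X + Y) = Delta u X + Delta u Y"
  by (simp add: Delta_eq transpose_add matrix_vector_mult_add_rdistrib outer_add algebra_simps)

lemma Delta_diff: "Delta u (X - Y) = Delta u X - Delta u Y"
  using Delta_add[of u "X - Y" Y] by simp

lemma Delta_mult_vec:
  "Delta u Y *v x = - ((u \<bullet> (Y *v x)) *\<^sub>R u) - (u \<bullet> x) *\<^sub>R (Y *v u) + (u \<bullet> (Y *v u) * (u \<bullet> x)) *\<^sub>R u"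
  unfolding Delta_eq
  by (simp add: matrix_vector_mult_add_rdistrib matrix_vector_mult_diff_rdistrib
      scaleR_matrix_vector_assoc[symmetric] outer_mult_vec inner_mult_transpose[symmetric]
      uminus_matrix_vector_mult)

lemma Delta_kernel: "norm u = 1 \<Longrightarrow> (Y + Delta u Y) *v u = 0"
  by (simp add: matrix_vector_mult_add_rdistrib Delta_mult_vec dot_square_norm)

lemma transpose_Delta: "transpose (Delta u Y) = Delta u (transpose Y)"
proof -
  have "u \<bullet> (transpose Y *v u) = u \<bullet> (Y *v u)"
    using inner_mult_transpose[of u Y u] by (simp add: inner_commute)
  then show ?thesis
    by (simp add: Delta_eq transpose_add transpose_diff transpose_minus transpose_outer transpose_scalar)
qed

lemma Delta_zero: "Delta u 0 = 0"
  by (simp add: Delta_def vec_eq_iff matrix_matrix_mult_def)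

lemma Delta_uminus: "Delta u (- Y) = - Delta u Y"
  using Delta_diff[of u 0 Y] by (simp add: Delta_zero)

lemma Delta_eq_0:
  assumes "X *v u = 0" "transpose X *v u = 0"
  shows "Delta u X = 0"
  using assms by (simp add: Delta_eq outer_zero_left outer_zero_right)

text \<open>
  \<open>F = Y + \<Delta>\<^sup>u\<^sub>Y\<close> annihilates \<open>u\<close> from both sides, so it is orthogonal to every matrix of the form
  \<open>u a\<^sup>T\<close> or \<open>a u\<^sup>T\<close>, in particular to \<open>\<Delta>\<^sup>u\<^sub>Y\<close>; the claim is Pythagoras.
\<close>

lemma norm_Delta_le:
  assumes u: "norm u = 1"
  shows "norm (Delta u Y) \<le> norm Y"
proof -
  define F where "F = Y + Delta u Y"
  have F1: "F *v u = 0" and F2: "transpose F *v u = 0"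
    using u by (simp_all add: F_def Delta_kernel transpose_add transpose_Delta)
  have "Delta u Y \<bullet> F = 0"
    using F1 F2 unfolding Delta_eq
    by (simp add: inner_add_left inner_diff_left inner_outer inner_mult_transpose[of u])
  then have "Y \<bullet> Y = F \<bullet> F + Delta u Y \<bullet> Delta u Y"
    by (simp add: F_def inner_commute algebra_simps)
  then have "(norm (Delta u Y))\<^sup>2 \<le> (norm Y)\<^sup>2"
    by (simp add: power2_norm_eq_inner)
  then show ?thesis by simp
qed

lemma inner_outer_outer: "outer a b \<bullet> outer c d = (a \<bullet> c) * (b \<bullet> d)"
  by (simp add: inner_outer outer_mult_vec inner_commute[of d b])

lemma norm_Delta_sym:
  assumes u: "norm u = 1" and Y: "transpose Y = Y"
  shows "(norm (Delta u Y))\<^sup>2 = 2 * (norm (Y *v u))\<^sup>2 - (u \<bullet> (Y *v u))\<^sup>2"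
proof -
  have uu: "u \<bullet> u = 1" using u by (simp add: dot_square_norm)
  define w where "w = Y *v u"
  define s where "s = u \<bullet> w"
  have wu: "w \<bullet> u = s" by (simp add: s_def inner_commute)
  have "Delta u Y = - outer u w - outer w u + s *\<^sub>R outer u u"
    by (simp add: Delta_eq Y w_def s_def)
  then have "Delta u Y \<bullet> Delta u Y = 2 * (w \<bullet> w) - s\<^sup>2"
    by (simp add: inner_add_left inner_diff_left inner_add_right inner_diff_right inner_outer_outer
        uu wu s_def[symmetric] power2_eq_square)
  then show ?thesis by (simp add: power2_norm_eq_inner w_def s_def)
qed

lemma norm_Delta_skew:
  assumes u: "norm u = 1" and Y: "skew Y"
  shows "(norm (Delta u Y))\<^sup>2 = 2 * (norm (Y *v u))\<^sup>2"
proof -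
  have uu: "u \<bullet> u = 1" using u by (simp add: dot_square_norm)
  define w where "w = Y *v u"
  have T: "transpose Y *v u = - w" using Y by (simp add: skew_def uminus_matrix_vector_mult w_def)
  have z: "u \<bullet> w = 0"
    using inner_mult_transpose[of u Y u] T by (simp add: inner_commute w_def)
  have z': "w \<bullet> u = 0" using z by (simp add: inner_commute)
  have "outer u (- w) = - outer u w" by (simp add: outer_def vec_eq_iff)
  then have "Delta u Y = outer u w - outer w u"
    using z by (simp add: Delta_eq T w_def)
  then have "Delta u Y \<bullet> Delta u Y = 2 * (w \<bullet> w)"
    by (simp add: inner_diff_left inner_diff_right inner_outer_outer uu z z')
  then show ?thesis by (simp add: power2_norm_eq_inner w_def)
qed

lemma psd_cost_eq:
  assumes u: "norm u = 1"
  shows "psd_cost Xs u = (\<Sum>X\<leftarrow>Xs. 2 * (norm (X *v u))\<^sup>2 - (u \<bullet> (X *v u))\<^sup>2)"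
proof -
  have uu: "u \<bullet> u = 1" using u by (simp add: dot_square_norm)
  have "2 * (norm ((mat 1 - outer_self u) *v w))\<^sup>2 + (u \<bullet> w)\<^sup>2
      = 2 * (norm w)\<^sup>2 - (u \<bullet> w)\<^sup>2" for w
  proof -
    define s where "s = u \<bullet> w"
    have wu: "w \<bullet> u = s" by (simp add: s_def inner_commute)
    have "(mat 1 - outer_self u) *v w = w - s *\<^sub>R u"
      by (simp add: matrix_vector_mult_diff_rdistrib outer_self_eq outer_mult_vec s_def)
    then show ?thesis
      unfolding power2_norm_eq_inner
      by (simp add: inner_diff_left inner_diff_right uu wu s_def[symmetric] power2_eq_square)
  qed
  then show ?thesis by (simp only: psd_cost_def)
qed

lemma psd_sym: "psd X \<Longrightarrow> transpose X = X"
  by (simp add: psd_def)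

lemma psd_cost_Delta:
  assumes u: "norm u = 1" and "\<And>X. X \<in> set Xs \<Longrightarrow> transpose X = X"
  shows "psd_cost Xs u = (\<Sum>X\<leftarrow>Xs. (norm (Delta u X))\<^sup>2)"
  using assms by (simp add: psd_cost_eq norm_Delta_sym cong: map_cong)

text \<open>
  \<open>X + \<Delta>\<^sup>u\<^sub>X\<close> is the compression of \<open>X\<close> to the complement of \<open>u\<close>, so its form at \<open>x\<close> is that of \<open>X\<close>
  at the projection \<open>y\<close> of \<open>x\<close>.
\<close>

lemma psd_Delta:
  assumes "psd X" "norm u = 1"
  shows "psd (X + Delta u X)"
  unfolding psd_def
proof (intro conjI allI)
  have [simp]: "u \<bullet> u = 1" using assms by (simp add: dot_square_norm)
  have X: "transpose X = X" using assms by (simp add: psd_def)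
  then show "transpose (X + Delta u X) = X + Delta u X"
    by (simp add: transpose_add transpose_Delta)
  fix x
  define y where "y = x - (u \<bullet> x) *\<^sub>R u"
  have c: "x \<bullet> (X *v u) = u \<bullet> (X *v x)"
    using inner_mult_transpose[of u X x] X by (simp add: inner_commute)
  have "x \<bullet> ((X + Delta u X) *v x) = y \<bullet> (X *v y)"
    by (simp add: y_def matrix_vector_mult_add_rdistrib Delta_mult_vec matrix_vector_mult_diff_distrib
        matrix_vector_mult_scaleR inner_diff_left inner_diff_right inner_add_right c inner_commute[of x u])
      (simp add: algebra_simps)
  then show "0 \<le> x \<bullet> ((X + Delta u X) *v x)"
    using assms by (simp add: psd_def)
qed

lemma skew_Delta: "skew X \<Longrightarrow> skew (X + Delta u X)"
  by (simp add: skew_def transpose_add transpose_Delta Delta_uminus)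

lemma psd_add: "psd X \<Longrightarrow> psd Y \<Longrightarrow> psd (X + Y)"
  by (simp add: psd_def transpose_add matrix_vector_mult_add_rdistrib inner_add_right)

lemma psd_scaleR: "psd X \<Longrightarrow> c \<ge> 0 \<Longrightarrow> psd (c *\<^sub>R X)"
  by (simp add: psd_def transpose_scalar scaleR_matrix_vector_assoc[symmetric])

text \<open>
  Along \<open>x + t y\<close> with \<open>y = X x\<close> the form is \<open>2 t \<parallel>y\<parallel>\<^sup>2 + t\<^sup>2 b\<close>, which would be negative for small
  negative \<open>t\<close> unless \<open>y = 0\<close>.
\<close>

lemma psd_quad_eq_0:
  assumes X: "psd X" and 0: "x \<bullet> (X *v x) = 0"
  shows "X *v x = 0"
proof -
  define y where "y = X *v x"
  define b where "b = y \<bullet> (X *v y)"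
  define a where "a = y \<bullet> y"
  have b: "b \<ge> 0" using X by (simp add: b_def psd_def)
  have sy: "x \<bullet> (X *v y) = a"
    using inner_mult_transpose[of x X y] X by (simp add: a_def psd_def y_def)
  have xy: "x \<bullet> y = 0" using 0 by (simp add: y_def)
  (* close to the minimiser of 2 t a + t^2 b, with b + 1 in place of b to avoid division by zero *)
  define t where "t = - a / (b + 1)"
  have "0 \<le> (x + t *\<^sub>R y) \<bullet> (X *v (x + t *\<^sub>R y))"
    using X by (simp add: psd_def)
  also have "\<dots> = 2 * t * a + t\<^sup>2 * b"
    by (simp add: matrix_vector_right_distrib matrix_vector_mult_scaleR inner_add_left inner_add_right xy sy
        y_def[symmetric] a_def[symmetric] b_def[symmetric] power2_eq_square algebra_simps)
  also have "\<dots> = - (t\<^sup>2 * (b + 2))"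
  proof -
    have a: "a = - t * (b + 1)" using b by (simp add: t_def)
    show ?thesis unfolding a by (simp add: power2_eq_square algebra_simps)
  qed
  finally have "t\<^sup>2 * (b + 2) \<le> 0" by simp
  then have "t = 0" using b by (simp add: mult_le_0_iff)
  then have "a = 0" using b by (simp add: t_def)
  then show ?thesis by (simp add: a_def y_def)
qed

section \<open>Distances as minima over the unit sphere\<close>

lemma continuous_on_mult_vec [continuous_intros]:
  "continuous_on S f \<Longrightarrow> continuous_on S (\<lambda>x. X *v (f x :: real^'n))"
  using continuous_on_compose2[of UNIV "(*v) X" S f] by (simp add: linear_continuous_on)

lemma continuous_on_psd_cost: "continuous_on (sphere 0 1) (psd_cost Xs)"
proof -
  have "continuous_on (sphere 0 1) (\<lambda>u. (\<Sum>X\<leftarrow>Xs. 2 * (norm (X *v u))\<^sup>2 - (u \<bullet> (X *v u))\<^sup>2))"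
    by (induction Xs) (auto intro!: continuous_intros)
  then show ?thesis
    by (rule continuous_on_eq) (simp add: psd_cost_eq)
qed

lemma sphere_min_exists:
  fixes f :: "real^'n \<Rightarrow> real"
  assumes "continuous_on (sphere 0 1) f"
  shows "\<exists>m. is_sphere_min f m"
proof -
  have "axis undefined 1 \<in> sphere (0 :: real^'n) 1" by simp
  then have "sphere (0 :: real^'n) 1 \<noteq> {}" by blast
  from continuous_attains_inf[OF compact_sphere this assms]
  obtain u where "norm u = 1" "\<And>y. norm y = 1 \<Longrightarrow> f u \<le> f y" by (auto simp: dist_norm)
  then show ?thesis unfolding is_sphere_min_def by blast
qed

text \<open>
  All distances are infima of this kind. The upper hypothesis allows an error \<open>e\<close> because for the
  index and for stability the optimal perturbation only reaches the closure of the target set.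
\<close>

lemma is_sphere_min_Inf:
  assumes cont: "continuous_on (sphere 0 1) f"
    and lower: "\<And>s. s \<in> S \<Longrightarrow> \<exists>u. norm u = 1 \<and> f u \<le> s"
    and upper: "\<And>u e. norm u = 1 \<Longrightarrow> e > 0 \<Longrightarrow> \<exists>s\<in>S. s < f u + e"
  shows "is_sphere_min f (Inf S)"
proof -
  obtain m where m: "is_sphere_min f m" using sphere_min_exists[OF cont] by blast
  then obtain u0 where u0: "norm u0 = 1" "f u0 = m" by (auto simp: is_sphere_min_def)
  have lb: "m \<le> s" if "s \<in> S" for s
    using lower[OF that] m by (force simp: is_sphere_min_def)
  have ne: "S \<noteq> {}" using upper[OF u0(1), of 1] by auto
  have "Inf S \<le> m"
  proof (rule field_le_epsilon)
    fix e :: real assume "e > 0"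
    from upper[OF u0(1) this] u0 obtain s where s: "s \<in> S" "s < m + e" by auto
    have "Inf S \<le> s" using s(1) lb by (intro cInf_lower) (auto simp: bdd_below_def)
    with s show "Inf S \<le> m + e" by simp
  qed
  moreover have "m \<le> Inf S" using ne lb by (intro cInf_greatest) auto
  ultimately show ?thesis using m by simp
qed

lemma is_sphere_min_unique: "is_sphere_min f a \<Longrightarrow> is_sphere_min f b \<Longrightarrow> a = b"
  unfolding is_sphere_min_def by (metis order_antisym)

lemma is_sphere_min_min:
  assumes "is_sphere_min f a" "is_sphere_min g b"
  shows "is_sphere_min (\<lambda>u. min (f u) (g u)) (min a b)"
proof -
  obtain u v where u: "norm u = 1" "f u = a" and v: "norm v = 1" "g v = b"
    and le: "\<And>x. norm x = 1 \<Longrightarrow> a \<le> f x" "\<And>x. norm x = 1 \<Longrightarrow> b \<le> g x"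
    using assms unfolding is_sphere_min_def by blast
  have "min (f u) (g u) = min a b \<or> min (f v) (g v) = min a b"
    using u(2) v(2) le(1)[OF v(1)] le(2)[OF u(1)] by linarith
  then show ?thesis
    unfolding is_sphere_min_def using u(1) v(1) min.mono[OF le] by blast
qed

lemma zero_in_common_kernel: "0 \<in> common_kernel Xs"
  by (simp add: common_kernel_def)

lemma common_kernel_iff: "common_kernel Xs \<noteq> {0} \<longleftrightarrow> (\<exists>x. x \<noteq> 0 \<and> (\<forall>X\<in>set Xs. X *v x = 0))"
  using zero_in_common_kernel[of Xs] by (auto simp: common_kernel_def)

lemma common_kernel_unit:
  "common_kernel Xs \<noteq> {0} \<longleftrightarrow> (\<exists>u. norm u = 1 \<and> (\<forall>X\<in>set Xs. X *v u = 0))"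
proof
  assume "common_kernel Xs \<noteq> {0}"
  then obtain x where "x \<noteq> 0" "\<forall>X\<in>set Xs. X *v x = 0" by (auto simp: common_kernel_iff)
  then have "norm (inverse (norm x) *\<^sub>R x) = 1 \<and> (\<forall>X\<in>set Xs. X *v (inverse (norm x) *\<^sub>R x) = 0)"
    by (simp add: matrix_vector_mult_scaleR)
  then show "\<exists>u. norm u = 1 \<and> (\<forall>X\<in>set Xs. X *v u = 0)" by blast
next
  assume "\<exists>u. norm u = 1 \<and> (\<forall>X\<in>set Xs. X *v u = 0)"
  then obtain u where u: "norm u = 1" "\<forall>X\<in>set Xs. X *v u = 0" by blast
  then have "u \<noteq> 0" by auto
  with u show "common_kernel Xs \<noteq> {0}" unfolding common_kernel_iff by blast
qed

text \<open>
  Optimality of \<open>\<Delta>\<^sup>u\<close>: it depends on \<open>X\<close> only through \<open>X u\<close> and \<open>X\<^sup>T u\<close>, and \<open>E\<close> has to cancel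
  both.
\<close>

lemma Delta_norm_le_distance:
  assumes u: "norm u = 1" and Z: "(X + E) *v u = 0" "transpose (X + E) *v u = 0"
  shows "norm (Delta u X) \<le> norm E"
proof -
  have "Delta u X + Delta u E = 0"
    by (rule Delta_eq_0[OF Z, unfolded Delta_add])
  then have "Delta u X = - Delta u E" by (simp add: eq_neg_iff_add_eq_0)
  then show ?thesis using norm_Delta_le[OF u, of E] by simp
qed

lemma norm_Delta_skew_le:
  assumes "norm u = 1" "skew X" "skew (X + E)" "(X + E) *v u = 0"
  shows "2 * (norm (X *v u))\<^sup>2 \<le> (norm E)\<^sup>2"
proof -
  have "transpose (X + E) *v u = - ((X + E) *v u)"
    using assms(3) by (simp only: skew_def uminus_matrix_vector_mult)
  then have "norm (Delta u X) \<le> norm E"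
    using assms by (intro Delta_norm_le_distance) simp_all
  then have "(norm (Delta u X))\<^sup>2 \<le> (norm E)\<^sup>2" by (intro power_mono) simp_all
  then show ?thesis by (simp only: norm_Delta_skew[OF assms(1,2)])
qed

lemma norm_Delta_psd_le:
  assumes "norm u = 1" "psd (X + E)" "(X + E) *v u = 0"
  shows "(norm (Delta u X))\<^sup>2 \<le> (norm E)\<^sup>2"
  using assms Delta_norm_le_distance[of u X E] by (simp add: psd_def)

lemma sum_list_map_mono:
  fixes f :: "'a \<Rightarrow> real"
  assumes "length xs = length ys" "\<And>i. i < length xs \<Longrightarrow> f (xs ! i) \<le> g (ys ! i)"
  shows "(\<Sum>x\<leftarrow>xs. f x) \<le> (\<Sum>y\<leftarrow>ys. g y)"
  using assms by (intro sum_list_mono2) auto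

lemma d_ck_sphere_min:
  assumes J: "skew J" and Xs: "\<And>X. X \<in> set Xs \<Longrightarrow> psd X"
  shows "is_sphere_min (\<lambda>u. sqrt (2 * (norm (J *v u))\<^sup>2 + psd_cost Xs u)) (d_ck J Xs)"
  unfolding d_ck_def
proof (rule is_sphere_min_Inf)
  show "continuous_on (sphere 0 1) (\<lambda>u. sqrt (2 * (norm (J *v u))\<^sup>2 + psd_cost Xs u))"
    by (intro continuous_intros continuous_on_psd_cost)
next
  fix s
  assume "s \<in> {sqrt ((norm \<Delta>J)\<^sup>2 + (\<Sum>\<Delta>X\<leftarrow>\<Delta>Xs. (norm \<Delta>X)\<^sup>2)) | \<Delta>J \<Delta>Xs.
     length \<Delta>Xs = length Xs \<and> skew (J + \<Delta>J) \<and>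
     (\<forall>i<length Xs. psd (Xs ! i + \<Delta>Xs ! i)) \<and>
     common_kernel ((J + \<Delta>J) # map2 (+) Xs \<Delta>Xs) \<noteq> {0}}"
  then obtain EJ EXs where s: "s = sqrt ((norm EJ)\<^sup>2 + (\<Sum>X\<leftarrow>EXs. (norm X)\<^sup>2))"
    and len: "length EXs = length Xs" and sk: "skew (J + EJ)"
    and ps: "\<And>i. i < length Xs \<Longrightarrow> psd (Xs ! i + EXs ! i)"
    and ck: "common_kernel ((J + EJ) # map2 (+) Xs EXs) \<noteq> {0}"
    by blast
  from ck obtain u where u: "norm u = 1" and kJ: "(J + EJ) *v u = 0"
    and kX: "\<forall>X\<in>set (map2 (+) Xs EXs). X *v u = 0"
    unfolding common_kernel_unit by auto
  have kX': "(Xs ! i + EXs ! i) *v u = 0" if "i < length Xs" for i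
  proof -
    have "map2 (+) Xs EXs ! i \<in> set (map2 (+) Xs EXs)" using that len by (intro nth_mem) simp
    with kX have "(map2 (+) Xs EXs ! i) *v u = 0" by blast
    with that len show ?thesis by simp
  qed
  have "psd_cost Xs u = (\<Sum>X\<leftarrow>Xs. (norm (Delta u X))\<^sup>2)"
    using Xs u by (intro psd_cost_Delta) (auto simp: psd_sym)
  also have "\<dots> \<le> (\<Sum>X\<leftarrow>EXs. (norm X)\<^sup>2)"
    by (rule sum_list_map_mono) (use len norm_Delta_psd_le[OF u ps kX'] in auto)
  finally have "sqrt (2 * (norm (J *v u))\<^sup>2 + psd_cost Xs u) \<le> s"
    using norm_Delta_skew_le[OF u J sk kJ] unfolding s by simp
  with u show "\<exists>u. norm u = 1 \<and> sqrt (2 * (norm (J *v u))\<^sup>2 + psd_cost Xs u) \<le> s" by blast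
next
  fix u :: "real^'a" and e :: real
  assume u: "norm u = 1" and e: "e > 0"
  let ?s = "sqrt ((norm (Delta u J))\<^sup>2 + (\<Sum>X\<leftarrow>map (Delta u) Xs. (norm X)\<^sup>2))"
  have ck: "common_kernel ((J + Delta u J) # map2 (+) Xs (map (Delta u) Xs)) \<noteq> {0}"
    unfolding common_kernel_unit using u Delta_kernel[OF u]
    by (intro exI[of _ u]) (auto simp: in_set_zip)
  have "?s < sqrt (2 * (norm (J *v u))\<^sup>2 + psd_cost Xs u) + e"
    using e u J Xs by (simp add: psd_cost_Delta psd_sym norm_Delta_skew o_def)
  then show "\<exists>s\<in>{sqrt ((norm \<Delta>J)\<^sup>2 + (\<Sum>\<Delta>X\<leftarrow>\<Delta>Xs. (norm \<Delta>X)\<^sup>2)) | \<Delta>J \<Delta>Xs.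
     length \<Delta>Xs = length Xs \<and> skew (J + \<Delta>J) \<and>
     (\<forall>i<length Xs. psd (Xs ! i + \<Delta>Xs ! i)) \<and>
     common_kernel ((J + \<Delta>J) # map2 (+) Xs \<Delta>Xs) \<noteq> {0}}.
       s < sqrt (2 * (norm (J *v u))\<^sup>2 + psd_cost Xs u) + e"
    using ck J Xs u
    by (intro bexI[of _ ?s]) (auto intro!: exI[of _ "Delta u J"] exI[of _ "map (Delta u) Xs"] skew_Delta psd_Delta)
qed

section \<open>The smallest eigenvalue of a symmetric matrix\<close>

text \<open>
  Needed because the smallest eigenvalue is defined by \<open>Min\<close>, which is meaningful on finite sets
  only. Eigenvectors of distinct eigenvalues are orthogonal, hence independent.
\<close>

lemma finite_eigenvalues_sym:
  fixes S :: "real^'n^'n"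
  assumes S: "transpose S = S"
  shows "finite {\<mu>. \<exists>v. v \<noteq> 0 \<and> S *v v = \<mu> *s v}" (is "finite ?E")
proof -
  define v where "v \<mu> = (SOME v. v \<noteq> 0 \<and> S *v v = \<mu> *s v)" for \<mu>
  have v: "v \<mu> \<noteq> 0" "S *v v \<mu> = \<mu> *\<^sub>R v \<mu>" if "\<mu> \<in> ?E" for \<mu>
    using someI_ex[of "\<lambda>v. v \<noteq> 0 \<and> S *v v = \<mu> *s v"] that
    by (auto simp: v_def scalar_mult_eq_scaleR)
  have orth: "v \<mu> \<bullet> v \<nu> = 0" if "\<mu> \<in> ?E" "\<nu> \<in> ?E" "\<mu> \<noteq> \<nu>" for \<mu> \<nu>
  proof -
    have "\<nu> * (v \<mu> \<bullet> v \<nu>) = \<mu> * (v \<mu> \<bullet> v \<nu>)"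
      using inner_mult_transpose[of "v \<mu>" S "v \<nu>"] v[OF that(1)] v[OF that(2)] S by simp
    with that show ?thesis by simp
  qed
  have inj: "inj_on v ?E"
  proof (rule inj_onI, rule ccontr)
    fix \<mu> \<nu> assume *: "\<mu> \<in> ?E" "\<nu> \<in> ?E" "v \<mu> = v \<nu>" "\<mu> \<noteq> \<nu>"
    then have "v \<mu> \<bullet> v \<mu> = 0" using orth[of \<mu> \<nu>] by simp
    then show False using v(1)[OF *(1)] by simp
  qed
  have "pairwise orthogonal (v ` ?E)"
    unfolding pairwise_image by (auto simp: pairwise_def orthogonal_def intro!: orth)
  moreover have "0 \<notin> v ` ?E" using v(1) by (metis (no_types, lifting) imageE)
  ultimately have "finite (v ` ?E)"
    using pairwise_orthogonal_independent independent_imp_finite by blast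
  then show ?thesis using inj finite_imageD by blast
qed

text \<open>
  Rayleigh principle. If \<open>m\<close> is the minimum of the form on the sphere, attained at \<open>u\<close>, then
  \<open>S - m I\<close> is positive semidefinite with vanishing form at \<open>u\<close>, so \<open>u\<close> is an eigenvector for \<open>m\<close>.
\<close>

lemma lambda_min_sphere_min:
  fixes S :: "real^'n^'n"
  assumes S: "transpose S = S"
  shows "is_sphere_min (\<lambda>u. u \<bullet> (S *v u)) (lambda_min S)"
proof -
  have "continuous_on (sphere 0 1) (\<lambda>u. u \<bullet> (S *v u))" by (intro continuous_intros)
  then obtain m where m: "is_sphere_min (\<lambda>u. u \<bullet> (S *v u)) m" using sphere_min_exists by blast
  then obtain u where u: "norm u = 1" "u \<bullet> (S *v u) = m" by (auto simp: is_sphere_min_def)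
  have le: "m * (x \<bullet> x) \<le> x \<bullet> (S *v x)" for x
  proof (cases "x = 0")
    case False
    have "m \<le> (inverse (norm x) *\<^sub>R x) \<bullet> (S *v (inverse (norm x) *\<^sub>R x))"
      using m False unfolding is_sphere_min_def by (metis (no_types, lifting) norm_sgn sgn_div_norm)
    also have "\<dots> = (x \<bullet> (S *v x)) / (norm x)\<^sup>2"
      by (simp add: matrix_vector_mult_scaleR power2_eq_square field_simps)
    finally show ?thesis using False by (simp add: field_simps dot_square_norm)
  qed simp
  define X where "X = S - m *\<^sub>R mat 1"
  have Xv: "X *v x = S *v x - m *\<^sub>R x" for x
    by (simp add: X_def matrix_vector_mult_diff_rdistrib scaleR_matrix_vector_assoc[symmetric])
  have "psd X"
    using le S unfolding psd_def Xv by (simp add: X_def transpose_diff transpose_scalar inner_diff_right)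
  moreover have "u \<bullet> (X *v u) = 0" using u by (simp add: Xv inner_diff_right dot_square_norm)
  ultimately have "S *v u = m *\<^sub>R u" using psd_quad_eq_0 Xv by fastforce
  then have "m \<in> {\<mu>. \<exists>v. v \<noteq> 0 \<and> S *v v = \<mu> *s v}"
    using u by (auto simp: scalar_mult_eq_scaleR intro!: exI[of _ u])
  moreover have "m \<le> \<mu>" if "\<mu> \<in> {\<mu>. \<exists>v. v \<noteq> 0 \<and> S *v v = \<mu> *s v}" for \<mu>
  proof -
    from that obtain v where v: "v \<noteq> 0" "S *v v = \<mu> *\<^sub>R v" by (auto simp: scalar_mult_eq_scaleR)
    then show ?thesis using le[of v] by (simp add: mult_le_cancel_right)
  qed
  ultimately have "lambda_min S = m"
    unfolding lambda_min_def using finite_eigenvalues_sym[OF S] by (intro Min_eqI) auto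
  with m show ?thesis by simp
qed

lemma sphere_min_sandwich:
  assumes f: "is_sphere_min (\<lambda>u. sqrt (f u)) d" and g: "is_sphere_min g l"
    and "\<And>u. norm u = 1 \<Longrightarrow> g u \<le> f u" "\<And>u. norm u = 1 \<Longrightarrow> f u \<le> 2 * g u"
  shows "sqrt l \<le> d" "d \<le> sqrt (2 * l)"
proof -
  obtain u where u: "norm u = 1" "sqrt (f u) = d" using f by (auto simp: is_sphere_min_def)
  have "l \<le> f u" using g u assms(3)[OF u(1)] by (force simp: is_sphere_min_def)
  then show "sqrt l \<le> d" using u by auto
  obtain v where v: "norm v = 1" "g v = l" using g by (auto simp: is_sphere_min_def)
  have "d \<le> sqrt (f v)" using f v by (simp add: is_sphere_min_def)
  also have "\<dots> \<le> sqrt (2 * l)" using assms(4)[OF v(1)] v by simp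
  finally show "d \<le> sqrt (2 * l)" .
qed

lemma inner_square_sym: "transpose (X :: real^'n^'n) = X \<Longrightarrow> u \<bullet> ((X ** X) *v u) = (norm (X *v u))\<^sup>2"
  using inner_mult_transpose[of u X "X *v u"] by (simp add: matrix_vector_mul_assoc[symmetric] dot_square_norm)

lemma inner_square_skew: "skew G \<Longrightarrow> u \<bullet> ((G ** G) *v u) = - (norm (G *v u))\<^sup>2"
  using inner_mult_transpose[of u G "G *v u"]
  by (simp add: matrix_vector_mul_assoc[symmetric] dot_square_norm skew_def uminus_matrix_vector_mult)

lemma transpose_square_sym: "transpose X = X \<Longrightarrow> transpose (X ** X) = X ** X" for X :: "real^'n^'n"
  by (simp add: matrix_transpose_mul)

lemma transpose_square_skew: "skew X \<Longrightarrow> transpose (X ** X) = X ** X" 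
  by (simp add: matrix_transpose_mul skew_def) (simp add: matrix_matrix_mult_def)

lemma unit_inner_square_le: "norm u = 1 \<Longrightarrow> (u \<bullet> w)\<^sup>2 \<le> (norm w)\<^sup>2"
  using Cauchy_Schwarz_ineq2[of u w] by (metis abs_le_square_iff abs_norm_cancel mult_1)

lemma psd_cost_bounds:
  assumes u: "norm u = 1"
  shows "(\<Sum>X\<leftarrow>Xs. (norm (X *v u))\<^sup>2) \<le> psd_cost Xs u"
    and "psd_cost Xs u \<le> 2 * (\<Sum>X\<leftarrow>Xs. (norm (X *v u))\<^sup>2)"
proof -
  show "(\<Sum>X\<leftarrow>Xs. (norm (X *v u))\<^sup>2) \<le> psd_cost Xs u"
    unfolding psd_cost_eq[OF u] using unit_inner_square_le[OF u] by (intro sum_list_mono) (simp add: algebra_simps)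
  show "psd_cost Xs u \<le> 2 * (\<Sum>X\<leftarrow>Xs. (norm (X *v u))\<^sup>2)"
    unfolding psd_cost_eq[OF u] sum_list_const_mult[symmetric] by (intro sum_list_mono) simp
qed

section \<open>Vector relations in block diagonal pencils\<close>

fun kblock_rows :: "kblock \<Rightarrow> nat" where
  "kblock_rows (RightBlock \<epsilon>) = \<epsilon>"
| "kblock_rows (LeftBlock \<eta>) = \<eta> + 1"
| "kblock_rows (FinBlock \<rho> a) = \<rho>"
| "kblock_rows (InfBlock \<sigma>) = \<sigma>"

fun kblock_cols :: "kblock \<Rightarrow> nat" where
  "kblock_cols (RightBlock \<epsilon>) = \<epsilon> + 1"
| "kblock_cols (LeftBlock \<eta>) = \<eta>"
| "kblock_cols (FinBlock \<rho> a) = \<rho>"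
| "kblock_cols (InfBlock \<sigma>) = \<sigma>"

lemma kblock_carrier [simp]:
  "kblock_lead b \<in> carrier_mat (kblock_rows b) (kblock_cols b)"
  "kblock_const b \<in> carrier_mat (kblock_rows b) (kblock_cols b)"
  by (cases b; simp)+

definition lead_mat :: "kblock list \<Rightarrow> complex mat" where
  "lead_mat bl = diag_block_mat (map kblock_lead bl)"

definition const_mat :: "kblock list \<Rightarrow> complex mat" where
  "const_mat bl = diag_block_mat (map kblock_const bl)"

lemma diag_block_carrier:
  assumes "\<And>b. b \<in> set bl \<Longrightarrow> F b \<in> carrier_mat (f b) (g b)"
  shows "diag_block_mat (map F bl) \<in> carrier_mat (\<Sum>b\<leftarrow>bl. f b) (\<Sum>b\<leftarrow>bl. g b)"
  using assms by (induction bl) (auto simp: Let_def)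

lemma lead_mat_carrier [simp]:
  "lead_mat bl \<in> carrier_mat (\<Sum>b\<leftarrow>bl. kblock_rows b) (\<Sum>b\<leftarrow>bl. kblock_cols b)"
  unfolding lead_mat_def by (rule diag_block_carrier) simp

lemma const_mat_carrier [simp]:
  "const_mat bl \<in> carrier_mat (\<Sum>b\<leftarrow>bl. kblock_rows b) (\<Sum>b\<leftarrow>bl. kblock_cols b)"
  unfolding const_mat_def by (rule diag_block_carrier) simp

text \<open>
  A linear relation between two vectors and their images under a pencil. The equations that define
  Jordan chains of length two, at a finite eigenvalue and at infinity, are of this type:
  \<open>(z, 1, 0, 0)\<close> and \<open>(1, 0, z, 1)\<close> encode \<open>(z L + C) x = 0\<close> and \<open>L x + (z L + C) y = 0\<close>, while
  \<open>(1, 0, 0, 0)\<close> and \<open>(0, 1, 1, 0)\<close> encode \<open>L x = 0\<close> and \<open>C x + L y = 0\<close>.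
\<close>

definition pform :: "complex mat \<Rightarrow> complex mat \<Rightarrow> complex \<times> complex \<times> complex \<times> complex
    \<Rightarrow> complex Matrix.vec \<Rightarrow> complex Matrix.vec \<Rightarrow> complex Matrix.vec" where
  "pform L C e x y = (case e of (p, q, r, s) \<Rightarrow>
     p \<cdot>\<^sub>v (L *\<^sub>v x) + q \<cdot>\<^sub>v (C *\<^sub>v x) + (r \<cdot>\<^sub>v (L *\<^sub>v y) + s \<cdot>\<^sub>v (C *\<^sub>v y)))"

lemma four_block_diag_mult_vec:
  assumes "A \<in> carrier_mat r1 c1" "D \<in> carrier_mat r2 c2" "a \<in> carrier_vec c1" "d \<in> carrier_vec c2"
  shows "four_block_mat A (0\<^sub>m r1 c2) (0\<^sub>m r2 c1) D *\<^sub>v (a @\<^sub>v d) = (A *\<^sub>v a) @\<^sub>v (D *\<^sub>v d)"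
  using assms by (subst four_block_mat_mult_vec[of _ r1 c1 _ c2 _ r2]) auto

lemma smult_append_vec: "c \<cdot>\<^sub>v (a @\<^sub>v d) = (c \<cdot>\<^sub>v a) @\<^sub>v (c \<cdot>\<^sub>v d)"
  by (intro eq_vecI) auto

lemma pform_four_block:
  assumes "L1 \<in> carrier_mat r1 c1" "L2 \<in> carrier_mat r2 c2" "C1 \<in> carrier_mat r1 c1" "C2 \<in> carrier_mat r2 c2"
    and "x1 \<in> carrier_vec c1" "x2 \<in> carrier_vec c2" "y1 \<in> carrier_vec c1" "y2 \<in> carrier_vec c2"
  shows "pform (four_block_mat L1 (0\<^sub>m r1 c2) (0\<^sub>m r2 c1) L2) (four_block_mat C1 (0\<^sub>m r1 c2) (0\<^sub>m r2 c1) C2)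
      e (x1 @\<^sub>v x2) (y1 @\<^sub>v y2) = pform L1 C1 e x1 y1 @\<^sub>v pform L2 C2 e x2 y2"
proof -
  obtain p q r s where e: "e = (p, q, r, s)" by (cases e)
  show ?thesis
    using assms unfolding pform_def e
    by (simp add: four_block_diag_mult_vec smult_append_vec append_vec_add[of _ r1 _ _ r2])
qed

lemma pform_carrier:
  assumes "L \<in> carrier_mat r c" "C \<in> carrier_mat r c" "x \<in> carrier_vec c" "y \<in> carrier_vec c"
  shows "pform L C e x y \<in> carrier_vec r"
proof -
  obtain p q r' s where e: "e = (p, q, r', s)" by (cases e)
  show ?thesis using assms unfolding pform_def e by auto
qed

lemma pform_zero:
  assumes "L \<in> carrier_mat r c" "C \<in> carrier_mat r c"
  shows "pform L C e (0\<^sub>v c) (0\<^sub>v c) = 0\<^sub>v r"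
proof -
  obtain p q r' s where e: "e = (p, q, r', s)" by (cases e)
  show ?thesis using assms unfolding pform_def e by (intro eq_vecI) auto
qed

lemma lead_mat_Cons:
  "lead_mat (b # bl) = four_block_mat (kblock_lead b) (0\<^sub>m (kblock_rows b) (\<Sum>b\<leftarrow>bl. kblock_cols b))
     (0\<^sub>m (\<Sum>b\<leftarrow>bl. kblock_rows b) (kblock_cols b)) (lead_mat bl)"
  using carrier_matD[OF lead_mat_carrier[of bl]] carrier_matD[OF kblock_carrier(1)[of b]]
  by (simp add: lead_mat_def Let_def)

lemma const_mat_Cons:
  "const_mat (b # bl) = four_block_mat (kblock_const b) (0\<^sub>m (kblock_rows b) (\<Sum>b\<leftarrow>bl. kblock_cols b))
     (0\<^sub>m (\<Sum>b\<leftarrow>bl. kblock_rows b) (kblock_cols b)) (const_mat bl)"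
  using carrier_matD[OF const_mat_carrier[of bl]] carrier_matD[OF kblock_carrier(2)[of b]]
  by (simp add: const_mat_def Let_def)

lemma pform_Cons:
  assumes "x1 \<in> carrier_vec (kblock_cols b)" "y1 \<in> carrier_vec (kblock_cols b)"
    "x2 \<in> carrier_vec (\<Sum>b\<leftarrow>bl. kblock_cols b)" "y2 \<in> carrier_vec (\<Sum>b\<leftarrow>bl. kblock_cols b)"
  shows "pform (lead_mat (b # bl)) (const_mat (b # bl)) e (x1 @\<^sub>v x2) (y1 @\<^sub>v y2) =
    pform (kblock_lead b) (kblock_const b) e x1 y1 @\<^sub>v pform (lead_mat bl) (const_mat bl) e x2 y2"
  unfolding lead_mat_Cons const_mat_Cons using assms by (intro pform_four_block) auto

lemma zero_append_vec: "0\<^sub>v n @\<^sub>v 0\<^sub>v m = 0\<^sub>v (n + m)"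
  by (intro eq_vecI) auto

lemma append_vec_eq_zero:
  assumes "x \<in> carrier_vec n"
  shows "x @\<^sub>v y = 0\<^sub>v (n + m) \<longleftrightarrow> x = 0\<^sub>v n \<and> y = 0\<^sub>v m"
  unfolding zero_append_vec[symmetric] using assms by (intro append_vec_eq) auto

text \<open>
  Padding with zeros. One embedding works for all coefficient tuples at once, so that the two
  equations of a chain, and all links of a longer chain, are carried over simultaneously.
\<close>

lemma block_embedding:
  assumes "b \<in> set bl"
  shows "\<exists>\<iota>. (\<forall>x\<in>carrier_vec (kblock_cols b).
       \<iota> x \<in> carrier_vec (\<Sum>b\<leftarrow>bl. kblock_cols b) \<and>
       (\<iota> x = 0\<^sub>v (\<Sum>b\<leftarrow>bl. kblock_cols b) \<longrightarrow> x = 0\<^sub>v (kblock_cols b)) \<and>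
       (\<forall>y\<in>carrier_vec (kblock_cols b). \<forall>e.
          pform (kblock_lead b) (kblock_const b) e x y = 0\<^sub>v (kblock_rows b) \<longrightarrow>
          pform (lead_mat bl) (const_mat bl) e (\<iota> x) (\<iota> y) = 0\<^sub>v (\<Sum>b\<leftarrow>bl. kblock_rows b)))"
  using assms
proof (induction bl)
  case (Cons c bl)
  let ?C = "\<Sum>b\<leftarrow>bl. kblock_cols b"
  show ?case
  proof (cases "b = c")
    case True
    have z: "pform (lead_mat bl) (const_mat bl) e (0\<^sub>v ?C) (0\<^sub>v ?C) = 0\<^sub>v (\<Sum>b\<leftarrow>bl. kblock_rows b)" for e
      by (rule pform_zero) auto
    show ?thesis
      by (rule exI[of _ "\<lambda>x. x @\<^sub>v 0\<^sub>v ?C"])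
        (auto simp: True pform_Cons z zero_append_vec append_vec_eq_zero)
  next
    case False
    with Cons obtain \<iota> where \<iota>: "\<forall>x\<in>carrier_vec (kblock_cols b).
       \<iota> x \<in> carrier_vec ?C \<and>
       (\<iota> x = 0\<^sub>v ?C \<longrightarrow> x = 0\<^sub>v (kblock_cols b)) \<and>
       (\<forall>y\<in>carrier_vec (kblock_cols b). \<forall>e.
          pform (kblock_lead b) (kblock_const b) e x y = 0\<^sub>v (kblock_rows b) \<longrightarrow>
          pform (lead_mat bl) (const_mat bl) e (\<iota> x) (\<iota> y) = 0\<^sub>v (\<Sum>b\<leftarrow>bl. kblock_rows b))"
      by auto
    have z: "pform (kblock_lead c) (kblock_const c) e (0\<^sub>v (kblock_cols c)) (0\<^sub>v (kblock_cols c)) = 0\<^sub>v (kblock_rows c)" for e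
      by (rule pform_zero) auto
    show ?thesis
      by (rule exI[of _ "\<lambda>x. 0\<^sub>v (kblock_cols c) @\<^sub>v \<iota> x"])
        (use \<iota> in \<open>auto simp: pform_Cons z zero_append_vec append_vec_eq_zero\<close>)
  qed
qed simp

text \<open>
  The converse direction: a chain in the block diagonal pencil splits into chains in the blocks. If
  no block admits a chain with nonzero first vector, neither does the whole pencil.
\<close>

lemma pform_diag_injective:
  assumes "\<And>b x y. b \<in> set bl \<Longrightarrow> x \<in> carrier_vec (kblock_cols b) \<Longrightarrow> y \<in> carrier_vec (kblock_cols b) \<Longrightarrow>
      pform (kblock_lead b) (kblock_const b) e x y = 0\<^sub>v (kblock_rows b) \<Longrightarrow>
      pform (kblock_lead b) (kblock_const b) e' x y = 0\<^sub>v (kblock_rows b) \<Longrightarrow> x = 0\<^sub>v (kblock_cols b)"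
    and "x \<in> carrier_vec (\<Sum>b\<leftarrow>bl. kblock_cols b)" "y \<in> carrier_vec (\<Sum>b\<leftarrow>bl. kblock_cols b)"
    and "pform (lead_mat bl) (const_mat bl) e x y = 0\<^sub>v (\<Sum>b\<leftarrow>bl. kblock_rows b)"
    and "pform (lead_mat bl) (const_mat bl) e' x y = 0\<^sub>v (\<Sum>b\<leftarrow>bl. kblock_rows b)"
  shows "x = 0\<^sub>v (\<Sum>b\<leftarrow>bl. kblock_cols b)"
  using assms
proof (induction bl arbitrary: x y)
  case (Cons b bl)
  let ?n = "kblock_cols b" and ?m = "\<Sum>b\<leftarrow>bl. kblock_cols b"
  define x1 x2 y1 y2 where d: "x1 = vec_first x ?n" "x2 = vec_last x ?m" "y1 = vec_first y ?n" "y2 = vec_last y ?m"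
  have x: "x = x1 @\<^sub>v x2" and y: "y = y1 @\<^sub>v y2"
    using Cons.prems by (simp_all add: d)
  have c: "x1 \<in> carrier_vec ?n" "x2 \<in> carrier_vec ?m" "y1 \<in> carrier_vec ?n" "y2 \<in> carrier_vec ?m"
    by (simp_all add: d)
  have cc: "pform (kblock_lead b) (kblock_const b) e x1 y1 \<in> carrier_vec (kblock_rows b)" for e
    using c by (intro pform_carrier) auto
  have 1: "pform (kblock_lead b) (kblock_const b) e x1 y1 = 0\<^sub>v (kblock_rows b)"
    "pform (lead_mat bl) (const_mat bl) e x2 y2 = 0\<^sub>v (\<Sum>b\<leftarrow>bl. kblock_rows b)"
    and 2: "pform (kblock_lead b) (kblock_const b) e' x1 y1 = 0\<^sub>v (kblock_rows b)"
    "pform (lead_mat bl) (const_mat bl) e' x2 y2 = 0\<^sub>v (\<Sum>b\<leftarrow>bl. kblock_rows b)"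
    using Cons.prems(4,5) c by (auto simp: x y pform_Cons append_vec_eq_zero[OF cc])
  have "x1 = 0\<^sub>v ?n" using Cons.prems(1)[of b x1 y1] 1 2 c by auto
  moreover have "x2 = 0\<^sub>v ?m"
    by (rule Cons.IH[OF Cons.prems(1) c(2,4) 1(2) 2(2)]) auto
  ultimately show ?case by (simp add: x zero_append_vec)
next
  case Nil
  show ?case using Nil.prems(2) by (intro eq_vecI) simp_all
qed

section \<open>Chains in single Kronecker blocks\<close>

lemma jordan_block_mult_vec:
  assumes v: "v \<in> carrier_vec n" and i: "i < n"
  shows "vec_index (jordan_block n a *\<^sub>v v) i =
    a * vec_index v i + (if Suc i < n then vec_index v (Suc i) else (0 :: complex))"
proof -
  have "vec_index (jordan_block n a *\<^sub>v v) i = (\<Sum>j<n. (if i = j then a else if Suc i = j then 1 else 0) * vec_index v j)"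
    using v i by (auto simp: mult_mat_vec_def scalar_prod_def atLeast0LessThan intro!: sum.cong)
  also have "\<dots> = (\<Sum>j<n. (if i = j then a * vec_index v j else 0) + (if Suc i = j then vec_index v j else 0))"
    by (rule sum.cong) auto
  also have "\<dots> = a * vec_index v i + (if Suc i < n then vec_index v (Suc i) else 0)"
    using i by (simp add: sum.distrib)
  finally show ?thesis .
qed

text \<open>
  Back substitution: a triangular bidiagonal system with nonzero diagonal has only the zero
  solution.
\<close>

lemma backward_recursion_zero:
  fixes f :: "nat \<Rightarrow> complex"
  assumes "\<And>i. i < n \<Longrightarrow> c * f i = (if Suc i < n then d * f (Suc i) else 0)" "c \<noteq> 0" "i < n"
  shows "f i = 0"
  using assms(3)
proof (induction "n - i" arbitrary: i)
  case (Suc k)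
  show ?case
  proof (cases "Suc i < n")
    case True
    then have "f (Suc i) = 0" using Suc by simp
    with assms(1)[OF Suc.prems] assms(2) True show ?thesis by simp
  next
    case False
    with assms(1)[OF Suc.prems] assms(2) show ?thesis by simp
  qed
qed simp

lemma pform_index:
  assumes "L \<in> carrier_mat r c" "C \<in> carrier_mat r c" "x \<in> carrier_vec c" "y \<in> carrier_vec c" "i < r"
  shows "vec_index (pform L C (p, q, t, s) x y) i =
    p * vec_index (L *\<^sub>v x) i + q * vec_index (C *\<^sub>v x) i + (t * vec_index (L *\<^sub>v y) i + s * vec_index (C *\<^sub>v y) i)"
  using assms unfolding pform_def by simp

lemma pform_FinBlock_index:
  assumes "x \<in> carrier_vec n" "y \<in> carrier_vec n" "i < n"
  shows "vec_index (pform (kblock_lead (FinBlock n a)) (kblock_const (FinBlock n a)) (p, q, t, s) x y) i =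
    p * vec_index x i - q * (a * vec_index x i + (if Suc i < n then vec_index x (Suc i) else 0)) +
    (t * vec_index y i - s * (a * vec_index y i + (if Suc i < n then vec_index y (Suc i) else 0)))"
  using assms by (subst pform_index[of _ n n]) (auto simp: jordan_block_mult_vec simp del: index_mult_mat_vec,
      auto simp: algebra_simps)

lemma pform_InfBlock_index:
  assumes "x \<in> carrier_vec n" "y \<in> carrier_vec n" "i < n"
  shows "vec_index (pform (kblock_lead (InfBlock n)) (kblock_const (InfBlock n)) (p, q, t, s) x y) i =
    p * (if Suc i < n then vec_index x (Suc i) else 0) - q * vec_index x i +
    (t * (if Suc i < n then vec_index y (Suc i) else 0) - s * vec_index y i)"
  using assms by (subst pform_index[of _ n n]) (auto simp: jordan_block_mult_vec simp del: index_mult_mat_vec)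

text \<open>
  The vector \<open>(1, z, z\<^sup>2, \<dots>)\<close> is in the kernel of a right singular block at \<open>z\<close>, for every \<open>z\<close>.
\<close>

lemma pform_RightBlock_kernel:
  "pform (kblock_lead (RightBlock \<epsilon>)) (kblock_const (RightBlock \<epsilon>)) (z, 1, 0, 0)
     (Matrix.vec (\<epsilon> + 1) (\<lambda>i. z ^ i)) (0\<^sub>v (\<epsilon> + 1)) = 0\<^sub>v \<epsilon>"
proof (rule eq_vecI)
  fix i assume "i < dim_vec (0\<^sub>v \<epsilon> :: complex Matrix.vec)"
  then have i: "i < \<epsilon>" by simp
  let ?x = "Matrix.vec (\<epsilon> + 1) (\<lambda>i. z ^ i)"
  have 1: "vec_index (kblock_lead (RightBlock \<epsilon>) *\<^sub>v ?x) i = z ^ i"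
    using i by (simp add: mult_mat_vec_def scalar_prod_def atLeast0LessThan mult_delta_left del: sum.lessThan_Suc)
  have 2: "vec_index (kblock_const (RightBlock \<epsilon>) *\<^sub>v ?x) i = - (z ^ (i + 1))"
    using i by (simp add: mult_mat_vec_def scalar_prod_def atLeast0LessThan mult_delta_left del: sum.lessThan_Suc)
  show "vec_index (pform (kblock_lead (RightBlock \<epsilon>)) (kblock_const (RightBlock \<epsilon>)) (z, 1, 0, 0) ?x (0\<^sub>v (\<epsilon> + 1))) i
      = vec_index (0\<^sub>v \<epsilon>) i"
    using pform_index[of "kblock_lead (RightBlock \<epsilon>)" \<epsilon> "\<epsilon> + 1" "kblock_const (RightBlock \<epsilon>)" ?x "0\<^sub>v (\<epsilon> + 1)" i z 1 0 0,
        unfolded 1 2] i by simp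
qed (simp add: pform_def)

lemma FinBlock_no_chain:
  assumes "x \<in> carrier_vec n" "y \<in> carrier_vec n"
    and 1: "pform (kblock_lead (FinBlock n a)) (kblock_const (FinBlock n a)) (z, 1, 0, 0) x y = 0\<^sub>v n"
    and 2: "pform (kblock_lead (FinBlock n a)) (kblock_const (FinBlock n a)) (1, 0, z, 1) x y = 0\<^sub>v n"
    and n: "a = z \<Longrightarrow> n \<le> 1"
  shows "x = 0\<^sub>v n"
proof (cases "a = z")
  case True
  show ?thesis
  proof (rule eq_vecI)
    fix i assume "i < dim_vec (0\<^sub>v n :: complex Matrix.vec)"
    then have i: "i < n" by simp
    then show "vec_index x i = vec_index (0\<^sub>v n) i"
      using arg_cong[OF 2, of "\<lambda>v. vec_index v i"] pform_FinBlock_index[OF assms(1,2) i, of a 1 0 z 1] n[OF True] True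
      by simp
  qed (use assms in simp)
next
  case False
  show ?thesis
  proof (rule eq_vecI)
    fix i assume "i < dim_vec (0\<^sub>v n :: complex Matrix.vec)"
    then have i: "i < n" by simp
    have "vec_index x i = 0"
    proof (rule backward_recursion_zero[of n "z - a" _ 1, OF _ _ i])
      fix i assume i: "i < n"
      show "(z - a) * vec_index x i = (if Suc i < n then 1 * vec_index x (Suc i) else 0)"
        using arg_cong[OF 1, of "\<lambda>v. vec_index v i"] pform_FinBlock_index[OF assms(1,2) i, of a z 1 0 0] i
        by (auto simp: algebra_simps split: if_splits)
    qed (use False in simp)
    then show "vec_index x i = vec_index (0\<^sub>v n) i" using i by simp
  qed (use assms in simp)
qed

lemma InfBlock_no_finite_kernel:
  assumes "x \<in> carrier_vec n" "y \<in> carrier_vec n"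
    and 1: "pform (kblock_lead (InfBlock n)) (kblock_const (InfBlock n)) (z, 1, 0, 0) x y = 0\<^sub>v n"
  shows "x = 0\<^sub>v n"
proof (rule eq_vecI)
  fix i assume "i < dim_vec (0\<^sub>v n :: complex Matrix.vec)"
  then have i: "i < n" by simp
  have "vec_index x i = 0"
  proof (rule backward_recursion_zero[of n 1 _ z, OF _ _ i])
    fix i assume i: "i < n"
    show "1 * vec_index x i = (if Suc i < n then z * vec_index x (Suc i) else 0)"
      using arg_cong[OF 1, of "\<lambda>v. vec_index v i"] pform_InfBlock_index[OF assms(1,2) i, of z 1 0 0] i
      by (simp add: algebra_simps split: if_splits)
  qed simp
  then show "vec_index x i = vec_index (0\<^sub>v n) i" using i by simp
qed (use assms in simp)

lemma FinBlock_no_infinite_kernel: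
  assumes "x \<in> carrier_vec n" "y \<in> carrier_vec n"
    and 1: "pform (kblock_lead (FinBlock n a)) (kblock_const (FinBlock n a)) (1, 0, 0, 0) x y = 0\<^sub>v n"
  shows "x = 0\<^sub>v n"
proof (rule eq_vecI)
  fix i assume "i < dim_vec (0\<^sub>v n :: complex Matrix.vec)"
  then have i: "i < n" by simp
  then show "vec_index x i = vec_index (0\<^sub>v n) i"
    using arg_cong[OF 1, of "\<lambda>v. vec_index v i"] pform_FinBlock_index[OF assms(1,2) i, of a 1 0 0 0] by simp
qed (use assms in simp)

lemma InfBlock_no_chain:
  assumes "x \<in> carrier_vec n" "y \<in> carrier_vec n"
    and 2: "pform (kblock_lead (InfBlock n)) (kblock_const (InfBlock n)) (0, 1, 1, 0) x y = 0\<^sub>v n"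
    and n: "n \<le> 1"
  shows "x = 0\<^sub>v n"
proof (rule eq_vecI)
  fix i assume "i < dim_vec (0\<^sub>v n :: complex Matrix.vec)"
  then have i: "i < n" by simp
  then show "vec_index x i = vec_index (0\<^sub>v n) i"
    using arg_cong[OF 2, of "\<lambda>v. vec_index v i"] pform_InfBlock_index[OF assms(1,2) i, of 0 1 1 0] n by simp
qed (use assms in simp)

lemma FinBlock_chain:
  assumes "k < n"
  shows "pform (kblock_lead (FinBlock n a)) (kblock_const (FinBlock n a)) (a, 1, 0, 0) (unit_vec n 0) (unit_vec n k) = 0\<^sub>v n"
    and "Suc k < n \<Longrightarrow> pform (kblock_lead (FinBlock n a)) (kblock_const (FinBlock n a)) (1, 0, a, 1)
      (unit_vec n k) (unit_vec n (Suc k)) = 0\<^sub>v n"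
proof -
  show "pform (kblock_lead (FinBlock n a)) (kblock_const (FinBlock n a)) (a, 1, 0, 0) (unit_vec n 0) (unit_vec n k) = 0\<^sub>v n"
  proof (rule eq_vecI)
    fix i assume "i < dim_vec (0\<^sub>v n :: complex Matrix.vec)"
    then have i: "i < n" by simp
    show "vec_index (pform (kblock_lead (FinBlock n a)) (kblock_const (FinBlock n a)) (a, 1, 0, 0) (unit_vec n 0) (unit_vec n k)) i = vec_index (0\<^sub>v n) i"
      using i by (subst pform_FinBlock_index) auto
  qed (simp add: pform_def)
  assume k: "Suc k < n"
  show "pform (kblock_lead (FinBlock n a)) (kblock_const (FinBlock n a)) (1, 0, a, 1)
      (unit_vec n k) (unit_vec n (Suc k)) = 0\<^sub>v n"
  proof (rule eq_vecI)
    fix i assume "i < dim_vec (0\<^sub>v n :: complex Matrix.vec)"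
    then have i: "i < n" by simp
    show "vec_index (pform (kblock_lead (FinBlock n a)) (kblock_const (FinBlock n a)) (1, 0, a, 1)
      (unit_vec n k) (unit_vec n (Suc k))) i = vec_index (0\<^sub>v n) i"
      using i k by (subst pform_FinBlock_index) (auto simp: unit_vec_def)
  qed (simp add: pform_def)
qed

lemma InfBlock_chain:
  assumes "k < n"
  shows "pform (kblock_lead (InfBlock n)) (kblock_const (InfBlock n)) (1, 0, 0, 0) (unit_vec n 0) (unit_vec n k) = 0\<^sub>v n"
    and "Suc k < n \<Longrightarrow> pform (kblock_lead (InfBlock n)) (kblock_const (InfBlock n)) (0, 1, 1, 0)
      (unit_vec n k) (unit_vec n (Suc k)) = 0\<^sub>v n"
proof -
  show "pform (kblock_lead (InfBlock n)) (kblock_const (InfBlock n)) (1, 0, 0, 0) (unit_vec n 0) (unit_vec n k) = 0\<^sub>v n"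
  proof (rule eq_vecI)
    fix i assume "i < dim_vec (0\<^sub>v n :: complex Matrix.vec)"
    then have i: "i < n" by simp
    show "vec_index (pform (kblock_lead (InfBlock n)) (kblock_const (InfBlock n)) (1, 0, 0, 0) (unit_vec n 0) (unit_vec n k)) i = vec_index (0\<^sub>v n) i"
      using i by (subst pform_InfBlock_index) (auto simp: unit_vec_def)
  qed (simp add: pform_def)
  assume k: "Suc k < n"
  show "pform (kblock_lead (InfBlock n)) (kblock_const (InfBlock n)) (0, 1, 1, 0)
      (unit_vec n k) (unit_vec n (Suc k)) = 0\<^sub>v n"
  proof (rule eq_vecI)
    fix i assume "i < dim_vec (0\<^sub>v n :: complex Matrix.vec)"
    then have i: "i < n" by simp
    show "vec_index (pform (kblock_lead (InfBlock n)) (kblock_const (InfBlock n)) (0, 1, 1, 0)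
      (unit_vec n k) (unit_vec n (Suc k))) i = vec_index (0\<^sub>v n) i"
      using i k by (subst pform_InfBlock_index) (auto simp: unit_vec_def)
  qed (simp add: pform_def)
qed

section \<open>Existence of the canonical form of a regular pencil\<close>

text \<open>
  Strict equivalence to a block diagonal pencil of Kronecker blocks, for matrices of explicit size.
  Right inverses \<open>S'\<close> and \<open>T'\<close> suffice since the matrices are square.
\<close>

definition weierstrass :: "nat \<Rightarrow> complex mat \<Rightarrow> complex mat \<Rightarrow> bool" where
  "weierstrass n L C \<longleftrightarrow> (\<exists>bl S S' T T'. (\<forall>b\<in>set bl. proper_kblock b) \<and>
     {S, S', T, T'} \<subseteq> carrier_mat n n \<and> S * S' = 1\<^sub>m n \<and> T * T' = 1\<^sub>m n \<and>
     S * L * T = lead_mat bl \<and> S * C * T = const_mat bl)"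

lemma weierstrassI:
  assumes "\<forall>b\<in>set bl. proper_kblock b" "S * L * T = lead_mat bl" "S * C * T = const_mat bl"
    "S \<in> carrier_mat n n" "S' \<in> carrier_mat n n" "T \<in> carrier_mat n n" "T' \<in> carrier_mat n n"
    "S * S' = 1\<^sub>m n" "T * T' = 1\<^sub>m n"
  shows "weierstrass n L C"
  using assms unfolding weierstrass_def by blast

lemma mult_triple_assoc:
  fixes S :: "complex mat"
  assumes "S \<in> carrier_mat n n" "S0 \<in> carrier_mat n n" "L \<in> carrier_mat n n" "T0 \<in> carrier_mat n n" "T \<in> carrier_mat n n"
  shows "S * (S0 * L * T0) * T = (S * S0) * L * (T0 * T)"
  using assms by (simp add: assoc_mult_mat[of _ n n _ n _ n])

lemma weierstrass_equiv:
  assumes w: "weierstrass n (S0 * L * T0) (S0 * C * T0)"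
    and c: "S0 \<in> carrier_mat n n" "S0' \<in> carrier_mat n n" "T0 \<in> carrier_mat n n" "T0' \<in> carrier_mat n n"
      "L \<in> carrier_mat n n" "C \<in> carrier_mat n n" and inv: "S0 * S0' = 1\<^sub>m n" "T0 * T0' = 1\<^sub>m n"
  shows "weierstrass n L C"
proof -
  from w obtain bl S S' T T' where bl: "\<forall>b\<in>set bl. proper_kblock b"
    and d: "S \<in> carrier_mat n n" "S' \<in> carrier_mat n n" "T \<in> carrier_mat n n" "T' \<in> carrier_mat n n" and inv2: "S * S' = 1\<^sub>m n" "T * T' = 1\<^sub>m n"
    and eq: "S * (S0 * L * T0) * T = lead_mat bl" "S * (S0 * C * T0) * T = const_mat bl"
    unfolding weierstrass_def by auto
  have "S * S0 * (S0' * S') = S * (S0 * S0') * S'" "T0 * T * (T' * T0') = T0 * (T * T') * T0'"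
    using c d by (simp_all add: assoc_mult_mat[of _ n n _ n _ n])
  then have "S * S0 * (S0' * S') = 1\<^sub>m n" "T0 * T * (T' * T0') = 1\<^sub>m n"
    using inv inv2 c d by simp_all
  moreover have "(S * S0) * L * (T0 * T) = lead_mat bl" "(S * S0) * C * (T0 * T) = const_mat bl"
    using eq mult_triple_assoc[of S n S0 _ T0 T] c d by auto
  moreover have "{S * S0, S0' * S', T0 * T, T' * T0'} \<subseteq> carrier_mat n n"
    using c d by auto
  ultimately show ?thesis unfolding weierstrass_def using bl by metis
qed

lemma four_block_diag_mult:
  fixes A1 :: "complex mat"
  assumes "A1 \<in> carrier_mat n n" "A2 \<in> carrier_mat n n" "D1 \<in> carrier_mat m m" "D2 \<in> carrier_mat m m"
  shows "four_block_mat A1 (0\<^sub>m n m) (0\<^sub>m m n) D1 * four_block_mat A2 (0\<^sub>m n m) (0\<^sub>m m n) D2 =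
    four_block_mat (A1 * A2) (0\<^sub>m n m) (0\<^sub>m m n) (D1 * D2)"
  using assms by (subst mult_four_block_mat[of _ n n _ m _ m _ _ n _ m]) auto

lemma lead_mat_append:
  assumes "lead_mat as \<in> carrier_mat n n" "lead_mat bs \<in> carrier_mat m m"
  shows "lead_mat (as @ bs) = four_block_mat (lead_mat as) (0\<^sub>m n m) (0\<^sub>m m n) (lead_mat bs)"
  using assms unfolding lead_mat_def by (auto simp: diag_block_mat_append Let_def)

lemma const_mat_append:
  assumes "const_mat as \<in> carrier_mat n n" "const_mat bs \<in> carrier_mat m m"
  shows "const_mat (as @ bs) = four_block_mat (const_mat as) (0\<^sub>m n m) (0\<^sub>m m n) (const_mat bs)"
  using assms unfolding const_mat_def by (auto simp: diag_block_mat_append Let_def)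

lemma weierstrass_four_block:
  assumes "weierstrass n L1 C1" "weierstrass m L2 C2"
    and c: "L1 \<in> carrier_mat n n" "C1 \<in> carrier_mat n n" "L2 \<in> carrier_mat m m" "C2 \<in> carrier_mat m m"
  shows "weierstrass (n + m) (four_block_mat L1 (0\<^sub>m n m) (0\<^sub>m m n) L2) (four_block_mat C1 (0\<^sub>m n m) (0\<^sub>m m n) C2)"
proof -
  from assms(1) obtain bl S S' T T' where bl: "\<forall>b\<in>set bl. proper_kblock b"
    and d: "S \<in> carrier_mat n n" "S' \<in> carrier_mat n n" "T \<in> carrier_mat n n" "T' \<in> carrier_mat n n"
    and inv: "S * S' = 1\<^sub>m n" "T * T' = 1\<^sub>m n"
    and eq: "S * L1 * T = lead_mat bl" "S * C1 * T = const_mat bl"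
    unfolding weierstrass_def by auto
  from assms(2) obtain bl' U U' V V' where bl': "\<forall>b\<in>set bl'. proper_kblock b"
    and d': "U \<in> carrier_mat m m" "U' \<in> carrier_mat m m" "V \<in> carrier_mat m m" "V' \<in> carrier_mat m m"
    and inv': "U * U' = 1\<^sub>m m" "V * V' = 1\<^sub>m m"
    and eq': "U * L2 * V = lead_mat bl'" "U * C2 * V = const_mat bl'"
    unfolding weierstrass_def by auto
  let ?F = "\<lambda>A D. four_block_mat A (0\<^sub>m n m) (0\<^sub>m m n) D"
  have m: "S * L1 \<in> carrier_mat n n" "U * L2 \<in> carrier_mat m m" "S * C1 \<in> carrier_mat n n" "U * C2 \<in> carrier_mat m m"
    using d d' c by auto
  have "S * L1 * T \<in> carrier_mat n n" "U * L2 * V \<in> carrier_mat m m" "S * C1 * T \<in> carrier_mat n n" "U * C2 * V \<in> carrier_mat m m"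
    using d d' c by auto
  then have "?F S U * ?F L1 L2 * ?F T V = lead_mat (bl @ bl')" "?F S U * ?F C1 C2 * ?F T V = const_mat (bl @ bl')"
    using d d' c m by (simp_all add: four_block_diag_mult lead_mat_append const_mat_append eq eq')
  moreover have "?F S U * ?F S' U' = 1\<^sub>m (n + m)" "?F T V * ?F T' V' = 1\<^sub>m (n + m)"
    using d d' by (simp_all add: four_block_diag_mult inv inv')
  moreover have "{?F S U, ?F S' U', ?F T V, ?F T' V'} \<subseteq> carrier_mat (n + m) (n + m)"
    using d d' by auto
  moreover have "\<forall>b\<in>set (bl @ bl'). proper_kblock b" using bl bl' by auto
  ultimately show ?thesis unfolding weierstrass_def by metis
qed

lemma jordan_form_complex:
  fixes A :: "complex mat"
  assumes A: "A \<in> carrier_mat n n"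
  obtains n_as P Q where "0 \<notin> fst ` set n_as" "P \<in> carrier_mat n n" "Q \<in> carrier_mat n n"
    "P * Q = 1\<^sub>m n" "Q * P = 1\<^sub>m n" "Q * A * P = jordan_matrix n_as" "sum_list (map fst n_as) = n"
    "\<And>m a. (m, a) \<in> set n_as \<Longrightarrow> \<exists>v\<in>carrier_vec n. v \<noteq> 0\<^sub>v n \<and> A *\<^sub>v v = a \<cdot>\<^sub>v v"
proof -
  obtain as where "char_poly A = (\<Prod>a\<leftarrow>as. [:- a, 1:])" using char_poly_factorized[OF A] by blast
  from jordan_nf_exists[OF A this] obtain n_as where jnf: "jordan_nf A n_as" by blast
  then obtain Q P where w: "similar_mat_wit A (jordan_matrix n_as) P Q"
    unfolding jordan_nf_def similar_mat_def by blast
  note w' = similar_mat_witD2[OF A w]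
  note w'' = similar_mat_witD2(3)[OF w'(5) similar_mat_wit_sym[OF w]]
  have s: "sum_list (map fst n_as) = n" using w'(5) by (metis carrier_matD(1) jordan_matrix_dim(1))
  have "\<exists>v\<in>carrier_vec n. v \<noteq> 0\<^sub>v n \<and> A *\<^sub>v v = a \<cdot>\<^sub>v v" if "(m, a) \<in> set n_as" for m a
  proof -
    have "m \<noteq> 0" using that jnf unfolding jordan_nf_def by force
    have "poly (char_poly A) a = (\<Prod>(m, b)\<leftarrow>n_as. (a - b) ^ m)"
      unfolding jordan_nf_char_poly[OF jnf] by (simp add: poly_prod_list o_def case_prod_unfold)
    also have "\<dots> = 0"
      using that \<open>m \<noteq> 0\<close> by (force simp: prod_list_zero_iff)
    finally have "eigenvalue A a" using eigenvalue_root_char_poly[OF A] by simp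
    then show ?thesis using A unfolding eigenvalue_def eigenvector_def by auto
  qed
  moreover have "0 \<notin> fst ` set n_as" using jnf by (simp add: jordan_nf_def)
  ultimately show ?thesis using that[of n_as P Q] w' w'' s by metis
qed

lemma diag_block_one:
  "diag_block_mat (map (\<lambda>(n, a). 1\<^sub>m n) n_as) = (1\<^sub>m (sum_list (map fst n_as)) :: complex mat)"
proof (induction n_as)
  case (Cons x xs)
  then show ?case by (cases x) (simp add: Let_def)
qed (simp, intro eq_matI, auto)

lemma diag_block_uminus:
  "diag_block_mat (map (\<lambda>x. - F x) xs) = - (diag_block_mat (map F xs) :: complex mat)"
proof (induction xs)
  case (Cons x xs)
  show ?case unfolding list.map diag_block_mat.simps Let_def Cons.IH by (intro eq_matI) auto
qed (simp, intro eq_matI, auto)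

lemma weierstrass_finite:
  assumes B: "B \<in> carrier_mat n n"
  shows "weierstrass n (1\<^sub>m n) (- B)"
proof -
  obtain n_as P Q where w: "0 \<notin> fst ` set n_as" "P \<in> carrier_mat n n" "Q \<in> carrier_mat n n"
    "P * Q = 1\<^sub>m n" "Q * P = 1\<^sub>m n" "Q * B * P = jordan_matrix n_as" "sum_list (map fst n_as) = n"
    by (rule jordan_form_complex[OF B])
  let ?bl = "map (\<lambda>(n, a). FinBlock n a) n_as"
  have "\<forall>b\<in>set ?bl. proper_kblock b" using w(1) by force
  moreover have "lead_mat ?bl = 1\<^sub>m n"
    using diag_block_one[of n_as] w(7) by (simp add: lead_mat_def o_def case_prod_unfold)
  then have "Q * 1\<^sub>m n * P = lead_mat ?bl" using w by simp
  moreover have "const_mat ?bl = - jordan_matrix n_as"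
    unfolding const_mat_def jordan_matrix_def diag_block_uminus[symmetric] map_map o_def
    by (simp add: case_prod_unfold)
  then have "Q * (- B) * P = const_mat ?bl" using w(2,3) B unfolding w(6)[symmetric] by simp
  ultimately show ?thesis
    by (intro weierstrassI[where bl = ?bl and S = Q and T = P and S' = P and T' = Q]) (use w(2-5) in blast)+
qed

lemma weierstrass_nilpotent:
  assumes B: "B \<in> carrier_mat n n"
    and ev: "\<And>a v. v \<in> carrier_vec n \<Longrightarrow> v \<noteq> 0\<^sub>v n \<Longrightarrow> B *\<^sub>v v = a \<cdot>\<^sub>v v \<Longrightarrow> a = 0"
  shows "weierstrass n B (- 1\<^sub>m n)"
proof -
  obtain n_as P Q where w: "0 \<notin> fst ` set n_as" "P \<in> carrier_mat n n" "Q \<in> carrier_mat n n"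
    "P * Q = 1\<^sub>m n" "Q * P = 1\<^sub>m n" "Q * B * P = jordan_matrix n_as" "sum_list (map fst n_as) = n"
    "\<And>m a. (m, a) \<in> set n_as \<Longrightarrow> \<exists>v\<in>carrier_vec n. v \<noteq> 0\<^sub>v n \<and> B *\<^sub>v v = a \<cdot>\<^sub>v v"
    using jordan_form_complex[OF B] by metis
  let ?bl = "map (\<lambda>(n, a). InfBlock n) n_as"
  have "\<forall>b\<in>set ?bl. proper_kblock b" using w(1) by force
  moreover have "const_mat ?bl = - 1\<^sub>m n"
    using diag_block_one[of n_as] w(7) diag_block_uminus[of "\<lambda>(n, a). 1\<^sub>m n" n_as]
    by (simp add: const_mat_def o_def case_prod_unfold)
  then have "Q * (- 1\<^sub>m n) * P = const_mat ?bl" using w by simp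
  moreover have "lead_mat ?bl = jordan_matrix n_as"
    unfolding lead_mat_def jordan_matrix_def map_map o_def
    by (intro arg_cong[of _ _ diag_block_mat] map_cong) (use w(8) ev in \<open>auto, metis\<close>)
  then have "Q * B * P = lead_mat ?bl" using w by simp
  ultimately show ?thesis
    by (intro weierstrassI[where bl = ?bl and S = Q and T = P and S' = P and T' = Q]) (use w(2-5) in blast)+
qed

lemma smult_one_minus_four_block:
  assumes "A \<in> carrier_mat n n" "D \<in> carrier_mat m m"
  shows "1\<^sub>m (n + m) - z \<cdot>\<^sub>m four_block_mat A (0\<^sub>m n m) (0\<^sub>m m n) D =
    (four_block_mat (1\<^sub>m n - z \<cdot>\<^sub>m A) (0\<^sub>m n m) (0\<^sub>m m n) (1\<^sub>m m - z \<cdot>\<^sub>m D) :: complex mat)"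
  using assms by (intro eq_matI) auto

lemma obtain_mat_inverse:
  fixes A :: "complex mat"
  assumes A: "A \<in> carrier_mat n n" and "Determinant.det A \<noteq> 0"
  obtains B where "B \<in> carrier_mat n n" "B * A = 1\<^sub>m n" "A * B = 1\<^sub>m n"
  using det_non_zero_imp_unit[OF assms, of "()"] unfolding Units_def ring_mat_def by auto

lemma det_jordan_block: "Determinant.det (jordan_block n a) = (a :: complex) ^ n"
proof -
  have "Determinant.det (jordan_block n a) = prod_list (diag_mat (jordan_block n a))"
    by (rule det_upper_triangular[of _ n]) auto
  also have "diag_mat (jordan_block n a) = replicate n a"
    by (intro nth_equalityI) (auto simp: diag_mat_def)
  finally show ?thesis by simp
qed

lemma det_one_minus_nilpotent_block:
  "Determinant.det (1\<^sub>m n - z \<cdot>\<^sub>m jordan_block n 0) = (1 :: complex)"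
proof -
  have "Determinant.det (1\<^sub>m n - z \<cdot>\<^sub>m jordan_block n 0) = prod_list (diag_mat (1\<^sub>m n - z \<cdot>\<^sub>m jordan_block n (0::complex)))"
    by (rule det_upper_triangular[of _ n]) auto
  also have "diag_mat (1\<^sub>m n - z \<cdot>\<^sub>m jordan_block n (0::complex)) = replicate n 1"
    by (intro nth_equalityI) (auto simp: diag_mat_def)
  finally show ?thesis by simp
qed

lemma smult_mat_mult_vec:
  fixes A :: "complex mat"
  assumes "A \<in> carrier_mat m n" "w \<in> carrier_vec n"
  shows "(z \<cdot>\<^sub>m A) *\<^sub>v w = z \<cdot>\<^sub>v (A *\<^sub>v w)"
  using assms by (intro eq_vecI) auto

text \<open>
  For \<open>a \<noteq> 0\<close> the block \<open>J\<close> is invertible and multiplication by its inverse \<open>W\<close> gives the pencil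
  \<open>\<lambda> I - (z I - W)\<close>. For \<open>a = 0\<close> the matrix \<open>I - z J\<close> is invertible and multiplication by the negative
  of its inverse gives \<open>\<lambda> B - I\<close>, where \<open>B\<close> is nilpotent because it has no nonzero eigenvalue. In both
  cases a second Jordan form brings the result to Kronecker blocks.
\<close>

lemma weierstrass_jordan_block: "weierstrass n (jordan_block n a) (1\<^sub>m n - z \<cdot>\<^sub>m jordan_block n a)"
proof (cases "a = 0")
  case False
  let ?J = "jordan_block n a"
  obtain W where W: "W \<in> carrier_mat n n" "W * ?J = 1\<^sub>m n" "?J * W = 1\<^sub>m n"
    by (rule obtain_mat_inverse[of ?J n]) (use False in \<open>auto simp: det_jordan_block\<close>)
  have "W * (1\<^sub>m n - z \<cdot>\<^sub>m ?J) = W * 1\<^sub>m n - W * (z \<cdot>\<^sub>m ?J)"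
    using W by (intro mult_minus_distrib_mat) auto
  also have "\<dots> = W - z \<cdot>\<^sub>m 1\<^sub>m n"
    using W by (simp add: mult_smult_distrib[of _ n n _ n])
  also have "\<dots> = - (z \<cdot>\<^sub>m 1\<^sub>m n - W)"
    using W by (intro eq_matI) auto
  finally have "W * (1\<^sub>m n - z \<cdot>\<^sub>m ?J) * 1\<^sub>m n = - (z \<cdot>\<^sub>m 1\<^sub>m n - W)"
    using W by simp
  moreover have "W * ?J * 1\<^sub>m n = 1\<^sub>m n" using W by simp
  moreover have "weierstrass n (1\<^sub>m n) (- (z \<cdot>\<^sub>m 1\<^sub>m n - W))"
    by (rule weierstrass_finite) (use W in auto)
  ultimately have "weierstrass n (W * ?J * 1\<^sub>m n) (W * (1\<^sub>m n - z \<cdot>\<^sub>m ?J) * 1\<^sub>m n)" by (simp only:)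
  then show ?thesis
    by (rule weierstrass_equiv[where S0' = ?J and T0' = "1\<^sub>m n"])
      (use W in \<open>simp_all add: minus_carrier_mat\<close>)
next
  case True
  let ?J = "jordan_block n (0::complex)"
  let ?C = "1\<^sub>m n - z \<cdot>\<^sub>m ?J"
  have C: "?C \<in> carrier_mat n n" by (intro minus_carrier_mat smult_carrier_mat jordan_block_carrier)
  obtain W where W: "W \<in> carrier_mat n n" "W * ?C = 1\<^sub>m n" "?C * W = 1\<^sub>m n"
    by (rule obtain_mat_inverse[OF C]) (simp only: det_one_minus_nilpotent_block, simp)
  have "weierstrass n (- (W * ?J)) (- 1\<^sub>m n)"
  proof (rule weierstrass_nilpotent)
    fix b v assume v: "v \<in> carrier_vec n" "v \<noteq> 0\<^sub>v n" and ev: "- (W * ?J) *\<^sub>v v = b \<cdot>\<^sub>v v"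
    show "b = 0"
    proof (rule ccontr)
      assume b: "b \<noteq> 0"
      have Jv: "?J *\<^sub>v v \<in> carrier_vec n" using v by (intro mult_mat_vec_carrier[of _ n n]) auto
      have "?C *\<^sub>v (W *\<^sub>v (?J *\<^sub>v v)) = ?J *\<^sub>v v"
        using W v Jv C by (subst assoc_mult_mat_vec[symmetric, of _ n n _ n]) auto
      moreover have "W *\<^sub>v (?J *\<^sub>v v) = - (b \<cdot>\<^sub>v v)"
      proof -
        have "- (W * ?J) *\<^sub>v v = - (W *\<^sub>v (?J *\<^sub>v v))"
          using W v by (subst uminus_mult_mat_vec) (auto simp: assoc_mult_mat_vec[of _ n n _ n])
        then have "- (- (W *\<^sub>v (?J *\<^sub>v v))) = - (b \<cdot>\<^sub>v v)" using ev by simp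
        then show ?thesis by simp
      qed
      ultimately have eq: "?J *\<^sub>v v = ?C *\<^sub>v (- (b \<cdot>\<^sub>v v))" by simp
      also have "\<dots> = - (b \<cdot>\<^sub>v v) - z \<cdot>\<^sub>v (?J *\<^sub>v (- (b \<cdot>\<^sub>v v)))"
        using v by (subst minus_mult_distrib_mat_vec[of _ n n]) (auto simp: smult_mat_mult_vec[of _ n n])
      finally have eq: "?J *\<^sub>v v = - (b \<cdot>\<^sub>v v) - z \<cdot>\<^sub>v (?J *\<^sub>v (- (b \<cdot>\<^sub>v v)))" .
      (* an eigenvector for b solves J v = - b (I - z J) v, which is bidiagonal with diagonal b *)
      have "v = 0\<^sub>v n"
      proof (rule eq_vecI)
        fix i assume "i < dim_vec (0\<^sub>v n :: complex Matrix.vec)"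
        then have i: "i < n" by simp
        have "vec_index v i = 0"
        proof (rule backward_recursion_zero[of n b _ "b * z - 1", OF _ b i])
          fix i assume i: "i < n"
          have bv: "- (b \<cdot>\<^sub>v v) \<in> carrier_vec n" using v by auto
          have "vec_index (?J *\<^sub>v v) i = - (b * vec_index v i) - z * vec_index (?J *\<^sub>v (- (b \<cdot>\<^sub>v v))) i"
            using arg_cong[OF eq, of "\<lambda>v. vec_index v i"] i v by (simp del: index_mult_mat_vec)
          then show "b * vec_index v i = (if Suc i < n then (b * z - 1) * vec_index v (Suc i) else 0)"
            using i v unfolding jordan_block_mult_vec[OF v(1) i] jordan_block_mult_vec[OF bv i]
            by (auto simp: algebra_simps)
        qed
        then show "vec_index v i = vec_index (0\<^sub>v n) i" using i by simp
      qed (use v in simp)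
      with v show False by simp
    qed
  qed (use W in auto)
  moreover have "- W * ?J * 1\<^sub>m n = - (W * ?J)" "- W * ?C * 1\<^sub>m n = - 1\<^sub>m n"
    using W C by auto
  ultimately have "weierstrass n (- W * ?J * 1\<^sub>m n) (- W * ?C * 1\<^sub>m n)" by (simp only:)
  then show ?thesis unfolding True
    by (rule weierstrass_equiv[where S0' = "- ?C" and T0' = "1\<^sub>m n"]) (use W C in simp_all)
qed

lemma weierstrass_jordan_matrix:
  "weierstrass (sum_list (map fst n_as)) (jordan_matrix n_as) (1\<^sub>m (sum_list (map fst n_as)) - z \<cdot>\<^sub>m jordan_matrix n_as)"
proof (induction n_as)
  case Nil
  have "A = B" if "A \<in> carrier_mat 0 0" "B \<in> carrier_mat 0 0" for A B :: "complex mat"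
    using that by (intro eq_matI) auto
  then show ?case unfolding weierstrass_def jordan_matrix_def
    by (intro exI[of _ "[]"] exI[of _ "0\<^sub>m 0 0"]) (auto simp: lead_mat_def const_mat_def)
next
  case (Cons x n_as)
  obtain n a where x: "x = (n, a)" by (cases x)
  let ?m = "sum_list (map fst n_as)"
  have J: "jordan_matrix (x # n_as) = four_block_mat (jordan_block n a) (0\<^sub>m n ?m) (0\<^sub>m ?m n) (jordan_matrix n_as)"
    by (simp add: x jordan_matrix_Cons)
  have "weierstrass (n + ?m) (jordan_matrix (x # n_as)) (1\<^sub>m (n + ?m) - z \<cdot>\<^sub>m jordan_matrix (x # n_as))"
    unfolding J by (subst smult_one_minus_four_block)
      (auto intro!: weierstrass_four_block weierstrass_jordan_block Cons.IH)
  then show ?case by (simp add: x)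
qed

text \<open>
  With \<open>R = (z E + A)\<^sup>-\<^sup>1\<close> and \<open>E\<^sub>1 = R E\<close> one has \<open>R A = I - z E\<^sub>1\<close>, so both coefficients are functions
  of \<open>E\<^sub>1\<close> after multiplication by \<open>R\<close>, and the Jordan form of \<open>E\<^sub>1\<close> decouples the pencil.
\<close>

theorem weierstrass_regular:
  assumes E: "E \<in> carrier_mat n n" and A: "A \<in> carrier_mat n n" and R: "R \<in> carrier_mat n n"
    and inv: "R * (z \<cdot>\<^sub>m E + A) = 1\<^sub>m n"
  shows "weierstrass n E A"
proof -
  let ?Z = "z \<cdot>\<^sub>m E + A"
  have Z: "?Z \<in> carrier_mat n n" using E A by auto
  have inv': "?Z * R = 1\<^sub>m n" by (rule mat_mult_left_right_inverse[OF R Z inv])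
  define E1 where "E1 = R * E"
  have E1: "E1 \<in> carrier_mat n n" using R E by (auto simp: E1_def)
  have RA: "R * A = 1\<^sub>m n - z \<cdot>\<^sub>m E1"
  proof -
    have "R * ?Z = R * (z \<cdot>\<^sub>m E) + R * A"
      using R E A by (intro mult_add_distrib_mat) auto
    also have "R * (z \<cdot>\<^sub>m E) = z \<cdot>\<^sub>m E1"
      using R E by (simp add: mult_smult_distrib[of _ n n _ n] E1_def)
    finally have eq: "1\<^sub>m n = z \<cdot>\<^sub>m E1 + R * A" using inv by simp
    have sub: "X = 1\<^sub>m n - z \<cdot>\<^sub>m E1" if "1\<^sub>m n = z \<cdot>\<^sub>m E1 + X" "X \<in> carrier_mat n n" for X
      unfolding that(1) using that(2) E1 by (intro eq_matI) auto
    show ?thesis by (rule sub[OF eq]) (use R A in auto)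
  qed
  obtain n_as P Q where w: "P \<in> carrier_mat n n" "Q \<in> carrier_mat n n"
    "P * Q = 1\<^sub>m n" "Q * P = 1\<^sub>m n" "Q * E1 * P = jordan_matrix n_as" "sum_list (map fst n_as) = n"
    using jordan_form_complex[OF E1] by metis
  have 1: "Q * R * E * P = jordan_matrix n_as"
    using w R E by (simp add: E1_def assoc_mult_mat[of _ n n _ n _ n] flip: w(5))
  have "Q * R * A * P = Q * (R * A) * P" using w R A by (simp add: assoc_mult_mat[of _ n n _ n _ n])
  also have "\<dots> = (Q * 1\<^sub>m n - Q * (z \<cdot>\<^sub>m E1)) * P"
    unfolding RA using w E1 by (subst mult_minus_distrib_mat[of _ n n _ n]) auto
  also have "\<dots> = Q * P - z \<cdot>\<^sub>m (Q * E1 * P)"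
    using w E1 by (subst minus_mult_distrib_mat[of _ n n]) 
      (auto simp: mult_smult_distrib[of _ n n _ n] mult_smult_assoc_mat[of _ n n _ n])
  finally have 2: "Q * R * A * P = 1\<^sub>m n - z \<cdot>\<^sub>m jordan_matrix n_as" using w by simp
  have "Q * R * (?Z * P) = Q * (R * ?Z) * P" using w R Z by (simp add: assoc_mult_mat[of _ n n _ n _ n])
  then have 3: "Q * R * (?Z * P) = 1\<^sub>m n" using inv w by simp
  have "weierstrass n (Q * R * E * P) (Q * R * A * P)"
    unfolding 1 2 using weierstrass_jordan_matrix[of n_as z] w by simp
  then show ?thesis
    by (rule weierstrass_equiv[where S0' = "?Z * P" and T0' = Q]) (use w R Z E A 3 in auto)
qed

section \<open>Chains of regular pencils and their canonical form\<close>

definition enum_vec :: "(nat \<Rightarrow> 'm) \<Rightarrow> complex^'m \<Rightarrow> complex Matrix.vec" where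
  "enum_vec f x = Matrix.vec CARD('m) (\<lambda>i. x $ f i)"

context
  fixes f :: "nat \<Rightarrow> 'm::finite"
  assumes f: "bij_betw f {..<CARD('m)} UNIV"
begin

lemma enum_mat_carrier: "enum_mat f X \<in> carrier_mat CARD('m) CARD('m)"
  by (simp add: enum_mat_def)

lemma enum_vec_carrier: "enum_vec f x \<in> carrier_vec CARD('m)"
  by (simp add: enum_vec_def)

lemma sum_enum: "(\<Sum>i<CARD('m). h (f i)) = (\<Sum>j\<in>UNIV. h j)"
  using sum.reindex_bij_betw[OF f, of h] by simp

lemma enum_mat_mult: "enum_mat f (X ** Y) = enum_mat f X * enum_mat f Y"
  by (intro eq_matI) (auto simp: enum_mat_def scalar_prod_def matrix_matrix_mult_def atLeast0LessThan
      sum_enum[symmetric])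

lemma enum_mult_vec: "enum_vec f (X *v x) = enum_mat f X *\<^sub>v enum_vec f x"
  by (intro eq_vecI) (auto simp: enum_mat_def enum_vec_def scalar_prod_def matrix_vector_mult_def atLeast0LessThan
      sum_enum[symmetric])

lemma enum_inj: "i < CARD('m) \<Longrightarrow> j < CARD('m) \<Longrightarrow> f i = f j \<longleftrightarrow> i = j"
  using f by (auto simp: bij_betw_def inj_on_def)

lemma enum_surj: "\<exists>i<CARD('m). f i = k"
  using f by (metis UNIV_I bij_betw_def imageE lessThan_iff)

lemma enum_mat_one: "enum_mat f (mat 1) = 1\<^sub>m CARD('m)"
  by (intro eq_matI) (auto simp: enum_mat_def mat_def enum_inj)

lemma enum_mat_pencil: "enum_mat f (cscale z X + Y) = z \<cdot>\<^sub>m enum_mat f X + enum_mat f Y"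
  by (intro eq_matI) (auto simp: enum_mat_def map_matrix_def)

lemma enum_mat_inj: "enum_mat f X = enum_mat f Y \<longleftrightarrow> X = Y"
proof
  assume eq: "enum_mat f X = enum_mat f Y"
  have "X $ k $ l = Y $ k $ l" for k l
  proof -
    obtain i j where "i < CARD('m)" "f i = k" "j < CARD('m)" "f j = l" using enum_surj by metis
    then show ?thesis using arg_cong[OF eq, of "\<lambda>M. M $$ (i, j)"] by (simp add: enum_mat_def)
  qed
  then show "X = Y" by (simp add: vec_eq_iff)
qed simp

lemma enum_vec_inj: "enum_vec f x = enum_vec f y \<longleftrightarrow> x = y"
proof
  assume eq: "enum_vec f x = enum_vec f y"
  have "x $ k = y $ k" for k
  proof -
    obtain i where "i < CARD('m)" "f i = k" using enum_surj by metis
    then show ?thesis using arg_cong[OF eq, of "\<lambda>v. vec_index v i"] by (simp add: enum_vec_def)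
  qed
  then show "x = y" by (simp add: vec_eq_iff)
qed simp

lemma enum_mat_surj:
  assumes "N \<in> carrier_mat CARD('m) CARD('m)"
  obtains X where "enum_mat f X = N"
proof
  let ?g = "inv_into {..<CARD('m)} f"
  show "enum_mat f (\<chi> i j. N $$ (?g i, ?g j)) = N"
    using assms f by (intro eq_matI) (auto simp: enum_mat_def bij_betw_def)
qed

lemma enum_vec_surj:
  assumes "v \<in> carrier_vec CARD('m)"
  obtains x where "enum_vec f x = v"
proof
  let ?g = "inv_into {..<CARD('m)} f"
  show "enum_vec f (\<chi> i. vec_index v (?g i)) = v"
    using assms f by (intro eq_vecI) (auto simp: enum_vec_def bij_betw_def)
qed

lemma enum_vec_zero: "enum_vec f 0 = 0\<^sub>v CARD('m)"
  by (intro eq_vecI) (auto simp: enum_vec_def)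

lemma enum_vec_add: "enum_vec f (x + y) = enum_vec f x + enum_vec f y"
  by (intro eq_vecI) (auto simp: enum_vec_def)

lemma enum_vec_smult: "enum_vec f (c *s x) = c \<cdot>\<^sub>v enum_vec f x"
  by (intro eq_vecI) (auto simp: enum_vec_def)

end

lemma ex_enumeration: "\<exists>f. bij_betw f {..<CARD('m)} (UNIV :: 'm::finite set)"
  using ex_bij_betw_nat_finite[of "UNIV :: 'm set"] by (simp add: atLeast0LessThan)

lemma kronecker_form_exists:
  fixes E A :: "complex^'m^'m"
  assumes "pencil_regular E A"
  shows "\<exists>bl. kronecker_form E A bl"
proof -
  obtain f where f: "bij_betw f {..<CARD('m)} (UNIV :: 'm set)" using ex_enumeration by blast
  obtain z where "Determinants.det (cscale z E + A) \<noteq> 0"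
    using assms unfolding pencil_regular_def pencil_det_def by blast
  then obtain R where R: "R ** (cscale z E + A) = mat 1"
    using invertible_det_nz invertible_left_inverse by blast
  have "enum_mat f R * (z \<cdot>\<^sub>m enum_mat f E + enum_mat f A) = 1\<^sub>m CARD('m)"
    using arg_cong[OF R, of "enum_mat f"]
    by (simp add: enum_mat_mult[OF f] enum_mat_pencil[OF f] enum_mat_one[OF f])
  then have "weierstrass CARD('m) (enum_mat f E) (enum_mat f A)"
    by (intro weierstrass_regular) (simp_all add: enum_mat_carrier[OF f])
  then obtain bl S S' T T' where bl: "\<forall>b\<in>set bl. proper_kblock b"
    and c: "S \<in> carrier_mat CARD('m) CARD('m)" "S' \<in> carrier_mat CARD('m) CARD('m)"
      "T \<in> carrier_mat CARD('m) CARD('m)" "T' \<in> carrier_mat CARD('m) CARD('m)"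
    and inv: "S * S' = 1\<^sub>m CARD('m)" "T * T' = 1\<^sub>m CARD('m)"
    and eq: "S * enum_mat f E * T = lead_mat bl" "S * enum_mat f A * T = const_mat bl"
    unfolding weierstrass_def by auto
  obtain S0 where S0: "enum_mat f S0 = S" using enum_mat_surj[OF f c(1)] by blast
  obtain S1 where S1: "enum_mat f S1 = S'" using enum_mat_surj[OF f c(2)] by blast
  obtain T0 where T0: "enum_mat f T0 = T" using enum_mat_surj[OF f c(3)] by blast
  obtain T1 where T1: "enum_mat f T1 = T'" using enum_mat_surj[OF f c(4)] by blast
  have "enum_mat f (S0 ** S1) = enum_mat f (mat 1)" "enum_mat f (T0 ** T1) = enum_mat f (mat 1)"
    using inv by (simp_all add: enum_mat_mult[OF f] enum_mat_one[OF f] S0 S1 T0 T1)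
  then have "invertible S0" "invertible T0"
    unfolding enum_mat_inj[OF f] invertible_right_inverse by blast+
  moreover have "enum_mat f (S0 ** E ** T0) = lead_mat bl" "enum_mat f (S0 ** A ** T0) = const_mat bl"
    using eq by (simp_all add: enum_mat_mult[OF f] S0 T0)
  ultimately show ?thesis
    unfolding kronecker_form_def lead_mat_def const_mat_def using bl f by blast
qed

lemma kcf_form: "pencil_regular E A \<Longrightarrow> kronecker_form E A (kcf E A)"
  unfolding kcf_def using kronecker_form_exists by (rule someI_ex)

text \<open>
  The relations of \<open>pform\<close> for matrices indexed by a finite type.
\<close>

definition cform :: "complex^'m^'m \<Rightarrow> complex^'m^'m \<Rightarrow> complex \<times> complex \<times> complex \<times> complex
    \<Rightarrow> complex^'m \<Rightarrow> complex^'m \<Rightarrow> complex^'m" where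
  "cform E A e x y = (case e of (p, q, r, s) \<Rightarrow>
     p *s (E *v x) + q *s (A *v x) + (r *s (E *v y) + s *s (A *v y)))"

text \<open>
  The coordinate change of a Kronecker form as a bijection of vectors that respects all relations.
  The dimension equations are used to exclude left singular blocks.
\<close>

lemma kronecker_formE:
  fixes E A :: "complex^'m^'m"
  assumes "kronecker_form E A bl"
  obtains T :: "complex Matrix.vec \<Rightarrow> complex^'m" and T' where
    "(\<Sum>b\<leftarrow>bl. kblock_cols b) = CARD('m)" "(\<Sum>b\<leftarrow>bl. kblock_rows b) = CARD('m)"
    "\<And>x. x \<in> carrier_vec CARD('m) \<Longrightarrow> T' (T x) = x"
    "\<And>x. T (T' x) = x" "\<And>x. T' x \<in> carrier_vec CARD('m)" "T (0\<^sub>v CARD('m)) = 0"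
    "\<And>e x y. x \<in> carrier_vec CARD('m) \<Longrightarrow> y \<in> carrier_vec CARD('m) \<Longrightarrow>
       cform E A e (T x) (T y) = 0 \<longleftrightarrow> pform (lead_mat bl) (const_mat bl) e x y = 0\<^sub>v CARD('m)"
proof -
  from assms obtain S T f where inv: "invertible S" "invertible T"
    and f: "bij_betw f {..<CARD('m)} (UNIV :: 'm set)"
    and L: "enum_mat f (S ** E ** T) = lead_mat bl" and C: "enum_mat f (S ** A ** T) = const_mat bl"
    unfolding kronecker_form_def lead_mat_def const_mat_def by blast
  obtain T1 where T1: "T ** T1 = mat 1" "T1 ** T = mat 1" using inv unfolding invertible_def by blast
  obtain S1 where S1: "S1 ** S = mat 1" using inv unfolding invertible_def by blast
  have dim: "(\<Sum>b\<leftarrow>bl. kblock_cols b) = CARD('m)" "(\<Sum>b\<leftarrow>bl. kblock_rows b) = CARD('m)"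
    using carrier_matD[OF lead_mat_carrier[of bl]] carrier_matD[OF enum_mat_carrier[OF f, of "S ** E ** T"], unfolded L]
    by simp_all
  define g where "g v = (SOME x. enum_vec f x = v)" for v
  have g: "enum_vec f (g v) = v" if v: "v \<in> carrier_vec CARD('m)" for v
  proof -
    obtain x where "enum_vec f x = v" by (rule enum_vec_surj[OF f v])
    then show ?thesis unfolding g_def by (rule someI)
  qed
  have g': "g (enum_vec f x) = x" for x
    using g[OF enum_vec_carrier[OF f]] by (simp only: enum_vec_inj[OF f])
  define U where "U v = T *v g v" for v
  define U' where "U' x = enum_vec f (T1 *v x)" for x
  have Sz: "S *v w = 0 \<longleftrightarrow> w = 0" for w
  proof
    assume "S *v w = 0"
    then have "(S1 ** S) *v w = 0" by (simp flip: matrix_vector_mul_assoc)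
    then show "w = 0" by (simp add: S1)
  qed simp
  have key: "enum_vec f (S *v cform E A e (T *v x) (T *v y)) =
      pform (lead_mat bl) (const_mat bl) e (enum_vec f x) (enum_vec f y)" for e x y
  proof -
    obtain p q r s where e: "e = (p, q, r, s)" by (cases e)
    show ?thesis
      unfolding pform_def cform_def e L[symmetric] C[symmetric]
      by (simp add: enum_mult_vec[OF f, symmetric] matrix_vector_right_distrib vector_scalar_commute
        matrix_vector_mul_assoc matrix_mul_assoc enum_vec_add[OF f] enum_vec_smult[OF f])
  qed
  show thesis
  proof (rule that[OF dim, of U' U])
    show "U' (U x) = x" if "x \<in> carrier_vec CARD('m)" for x
      using g[OF that] by (simp add: U_def U'_def matrix_vector_mul_assoc T1)
    show "U (U' x) = x" for x
      by (simp add: U_def U'_def g' matrix_vector_mul_assoc T1)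
    show "U' x \<in> carrier_vec CARD('m)" for x by (simp add: U'_def enum_vec_carrier[OF f])
    show "U (0\<^sub>v CARD('m)) = 0" using g'[of 0] by (simp add: U_def enum_vec_zero[OF f])
    fix e and x y :: "complex Matrix.vec" assume xy: "x \<in> carrier_vec CARD('m)" "y \<in> carrier_vec CARD('m)"
    have "cform E A e (U x) (U y) = 0 \<longleftrightarrow> enum_vec f (S *v cform E A e (U x) (U y)) = enum_vec f 0"
      by (simp only: enum_vec_inj[OF f] Sz)
    then show "cform E A e (U x) (U y) = 0 \<longleftrightarrow> pform (lead_mat bl) (const_mat bl) e x y = 0\<^sub>v CARD('m)"
      by (simp add: U_def key g xy enum_vec_zero[OF f])
  qed
qed

lemma kronecker_block_embedding:
  fixes E A :: "complex^'m^'m"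
  assumes "kronecker_form E A bl" "b \<in> set bl"
  obtains \<iota> :: "complex Matrix.vec \<Rightarrow> complex^'m" where
    "\<And>x. x \<in> carrier_vec (kblock_cols b) \<Longrightarrow> x \<noteq> 0\<^sub>v (kblock_cols b) \<Longrightarrow> \<iota> x \<noteq> 0"
    "\<And>x y e. x \<in> carrier_vec (kblock_cols b) \<Longrightarrow> y \<in> carrier_vec (kblock_cols b) \<Longrightarrow>
       pform (kblock_lead b) (kblock_const b) e x y = 0\<^sub>v (kblock_rows b) \<Longrightarrow> cform E A e (\<iota> x) (\<iota> y) = 0"
proof -
  obtain T :: "complex Matrix.vec \<Rightarrow> complex^'m" and T' where
    T: "(\<Sum>b\<leftarrow>bl. kblock_cols b) = CARD('m)" "(\<Sum>b\<leftarrow>bl. kblock_rows b) = CARD('m)"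
    "\<And>x. x \<in> carrier_vec CARD('m) \<Longrightarrow> T' (T x) = x"
    "\<And>x. T (T' x) = x" "\<And>x. T' x \<in> carrier_vec CARD('m)" "T (0\<^sub>v CARD('m)) = 0"
    "\<And>e x y. x \<in> carrier_vec CARD('m) \<Longrightarrow> y \<in> carrier_vec CARD('m) \<Longrightarrow>
       cform E A e (T x) (T y) = 0 \<longleftrightarrow> pform (lead_mat bl) (const_mat bl) e x y = 0\<^sub>v CARD('m)"
    by (rule kronecker_formE[OF assms(1)]) blast
  obtain \<iota> where \<iota>: "\<forall>x\<in>carrier_vec (kblock_cols b).
       \<iota> x \<in> carrier_vec CARD('m) \<and> (\<iota> x = 0\<^sub>v CARD('m) \<longrightarrow> x = 0\<^sub>v (kblock_cols b)) \<and>
       (\<forall>y\<in>carrier_vec (kblock_cols b). \<forall>e.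
          pform (kblock_lead b) (kblock_const b) e x y = 0\<^sub>v (kblock_rows b) \<longrightarrow>
          pform (lead_mat bl) (const_mat bl) e (\<iota> x) (\<iota> y) = 0\<^sub>v CARD('m))"
    using block_embedding[OF assms(2)] unfolding T(1,2) by blast
  show thesis
  proof (rule that[of "\<lambda>x. T (\<iota> x)"])
    fix x :: "complex Matrix.vec" assume x: "x \<in> carrier_vec (kblock_cols b)" "x \<noteq> 0\<^sub>v (kblock_cols b)"
    have "T' 0 = 0\<^sub>v CARD('m)" using T(3)[of "0\<^sub>v CARD('m)"] T(6) by simp
    then show "T (\<iota> x) \<noteq> 0" using T(3)[of "\<iota> x"] \<iota> x by auto
  next
    fix e and x y :: "complex Matrix.vec" assume "x \<in> carrier_vec (kblock_cols b)" "y \<in> carrier_vec (kblock_cols b)"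
       "pform (kblock_lead b) (kblock_const b) e x y = 0\<^sub>v (kblock_rows b)"
    then have "\<iota> x \<in> carrier_vec CARD('m)" "\<iota> y \<in> carrier_vec CARD('m)"
      "pform (lead_mat bl) (const_mat bl) e (\<iota> x) (\<iota> y) = 0\<^sub>v CARD('m)"
      using \<iota> by blast+
    then show "cform E A e (T (\<iota> x)) (T (\<iota> y)) = 0" using T(7) by blast
  qed
qed

lemma kronecker_form_injective:
  fixes E A :: "complex^'m^'m"
  assumes "kronecker_form E A bl"
    and "\<And>b x y. b \<in> set bl \<Longrightarrow> x \<in> carrier_vec (kblock_cols b) \<Longrightarrow> y \<in> carrier_vec (kblock_cols b) \<Longrightarrow>
      pform (kblock_lead b) (kblock_const b) e x y = 0\<^sub>v (kblock_rows b) \<Longrightarrow>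
      pform (kblock_lead b) (kblock_const b) e' x y = 0\<^sub>v (kblock_rows b) \<Longrightarrow> x = 0\<^sub>v (kblock_cols b)"
    and "cform E A e x y = 0" "cform E A e' x y = 0"
  shows "x = 0"
proof -
  obtain T :: "complex Matrix.vec \<Rightarrow> complex^'m" and T' where
    T: "(\<Sum>b\<leftarrow>bl. kblock_cols b) = CARD('m)" "(\<Sum>b\<leftarrow>bl. kblock_rows b) = CARD('m)"
    "\<And>x. x \<in> carrier_vec CARD('m) \<Longrightarrow> T' (T x) = x"
    "\<And>x. T (T' x) = x" "\<And>x. T' x \<in> carrier_vec CARD('m)" "T (0\<^sub>v CARD('m)) = 0"
    "\<And>e x y. x \<in> carrier_vec CARD('m) \<Longrightarrow> y \<in> carrier_vec CARD('m) \<Longrightarrow>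
       cform E A e (T x) (T y) = 0 \<longleftrightarrow> pform (lead_mat bl) (const_mat bl) e x y = 0\<^sub>v CARD('m)"
    by (rule kronecker_formE[OF assms(1)]) blast
  have pf: "pform (lead_mat bl) (const_mat bl) e (T' x) (T' y) = 0\<^sub>v CARD('m)"
    "pform (lead_mat bl) (const_mat bl) e' (T' x) (T' y) = 0\<^sub>v CARD('m)"
    using assms(3,4) T(7)[OF T(5) T(5)] unfolding T(4) by blast+
  have "T' x = 0\<^sub>v CARD('m)"
    by (rule pform_diag_injective[of bl e e' "T' x" "T' y", unfolded T(1,2), OF assms(2) T(5) T(5) pf])
  then show ?thesis using T(4)[of x] T(6) by simp
qed

lemma cscale_mult_vec: "cscale z X *v x = z *s (X *v x)"
  by (simp add: vec_eq_iff matrix_vector_mult_def map_matrix_def sum_distrib_left mult.assoc)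

lemma det_eq_0_iff_kernel:
  fixes X :: "complex^'m^'m"
  shows "Determinants.det X = 0 \<longleftrightarrow> (\<exists>x. x \<noteq> 0 \<and> X *v x = 0)"
  using invertible_det_nz[of X] invertible_left_inverse[of X] matrix_left_invertible_ker[of X] by blast

lemma pencil_det_eq_0_iff:
  "pencil_det E A z = 0 \<longleftrightarrow> (\<exists>x. x \<noteq> 0 \<and> z *s (E *v x) + A *v x = 0)"
  unfolding pencil_det_def det_eq_0_iff_kernel
  by (simp add: matrix_vector_mult_add_rdistrib cscale_mult_vec)

lemma regular_no_RightBlock:
  fixes E A :: "complex^'m^'m"
  assumes reg: "pencil_regular E A" and kf: "kronecker_form E A bl"
  shows "RightBlock \<epsilon> \<notin> set bl"
proof
  assume b: "RightBlock \<epsilon> \<in> set bl"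
  have "pencil_det E A z = 0" for z
  proof -
    let ?x = "Matrix.vec (\<epsilon> + 1) (\<lambda>i. z ^ i)"
    obtain \<iota> :: "complex Matrix.vec \<Rightarrow> complex^'m" where
    \<iota>: "\<And>x. x \<in> carrier_vec (\<epsilon> + 1) \<Longrightarrow> x \<noteq> 0\<^sub>v (\<epsilon> + 1) \<Longrightarrow> \<iota> x \<noteq> 0"
    "\<And>x y e. x \<in> carrier_vec (\<epsilon> + 1) \<Longrightarrow> y \<in> carrier_vec (\<epsilon> + 1) \<Longrightarrow>
       pform (kblock_lead (RightBlock \<epsilon>)) (kblock_const (RightBlock \<epsilon>)) e x y = 0\<^sub>v \<epsilon> \<Longrightarrow> cform E A e (\<iota> x) (\<iota> y) = 0"
      using kronecker_block_embedding[OF kf b] unfolding kblock_rows.simps kblock_cols.simps by blast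
    have x: "?x \<in> carrier_vec (\<epsilon> + 1)" by simp
    have "?x \<noteq> 0\<^sub>v (\<epsilon> + 1)"
    proof
      assume "?x = 0\<^sub>v (\<epsilon> + 1)"
      from arg_cong[OF this, of "\<lambda>v. vec_index v 0"] show False by simp
    qed
    then have "\<iota> ?x \<noteq> 0" using \<iota>(1)[OF x] by blast
    moreover have "cform E A (z, 1, 0, 0) (\<iota> ?x) (\<iota> (0\<^sub>v (\<epsilon> + 1))) = 0"
      by (rule \<iota>(2)[OF x _ pform_RightBlock_kernel]) simp
    ultimately show ?thesis unfolding pencil_det_eq_0_iff by (auto simp: cform_def)
  qed
  with reg show False unfolding pencil_regular_def by blast
qed

text \<open>
  Each left block has one more row than columns. Without right blocks, nothing compensates for this in
  a square pencil.
\<close>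

lemma regular_no_LeftBlock:
  fixes E A :: "complex^'m^'m"
  assumes reg: "pencil_regular E A" and kf: "kronecker_form E A bl"
  shows "LeftBlock \<eta> \<notin> set bl"
proof
  assume b: "LeftBlock \<eta> \<in> set bl"
  have le: "kblock_cols b \<le> kblock_rows b" if "b \<in> set bl" for b
    using regular_no_RightBlock[OF reg kf] that by (cases b) auto
  have "(\<Sum>b\<leftarrow>bl. kblock_cols b) < (\<Sum>b\<leftarrow>bl. kblock_rows b)"
    using b le
  proof (induction bl)
    case (Cons c bl)
    have *: "(\<Sum>b\<leftarrow>bl. kblock_cols b) \<le> (\<Sum>b\<leftarrow>bl. kblock_rows b)"
      by (rule sum_list_mono) (use Cons.prems in auto)
    show ?case
    proof (cases "c = LeftBlock \<eta>")
      case True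
      then show ?thesis using * by simp
    next
      case False
      then have "LeftBlock \<eta> \<in> set bl" using Cons.prems by auto
      then have "(\<Sum>b\<leftarrow>bl. kblock_cols b) < (\<Sum>b\<leftarrow>bl. kblock_rows b)" using Cons by auto
      moreover have "kblock_cols c \<le> kblock_rows c" using Cons.prems by simp
      ultimately show ?thesis by simp
    qed
  qed simp
  then show False using kronecker_formE[OF kf] by (metis less_irrefl)
qed

lemma InfBlock_imp_chain:
  fixes E A :: "complex^'m^'m"
  assumes reg: "pencil_regular E A" and b: "InfBlock \<sigma> \<in> set (kcf E A)" and \<sigma>: "\<sigma> \<ge> 2"
  obtains x y w where "x \<noteq> 0" "E *v x = 0" "A *v x + E *v y = 0" "\<sigma> \<ge> 3 \<Longrightarrow> A *v y + E *v w = 0"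
proof -
  obtain \<iota> :: "complex Matrix.vec \<Rightarrow> complex^'m" where
    \<iota>: "\<And>x. x \<in> carrier_vec \<sigma> \<Longrightarrow> x \<noteq> 0\<^sub>v \<sigma> \<Longrightarrow> \<iota> x \<noteq> 0"
    "\<And>x y e. x \<in> carrier_vec \<sigma> \<Longrightarrow> y \<in> carrier_vec \<sigma> \<Longrightarrow>
       pform (kblock_lead (InfBlock \<sigma>)) (kblock_const (InfBlock \<sigma>)) e x y = 0\<^sub>v \<sigma> \<Longrightarrow> cform E A e (\<iota> x) (\<iota> y) = 0"
    using kronecker_block_embedding[OF kcf_form[OF reg] b] unfolding kblock_rows.simps kblock_cols.simps by blast
  let ?u = "\<lambda>k. \<iota> (unit_vec \<sigma> k)"
  have "?u 0 \<noteq> 0" using \<sigma> by (intro \<iota>(1)) auto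
  moreover have "cform E A (1, 0, 0, 0) (?u 0) (?u 0) = 0" "cform E A (0, 1, 1, 0) (?u 0) (?u (Suc 0)) = 0"
    using \<sigma> by (auto intro!: \<iota>(2) InfBlock_chain simp del: kblock_lead.simps kblock_const.simps)
  moreover have "cform E A (0, 1, 1, 0) (?u (Suc 0)) (?u (Suc (Suc 0))) = 0" if "\<sigma> \<ge> 3"
    using that by (auto intro!: \<iota>(2) InfBlock_chain simp del: kblock_lead.simps kblock_const.simps)
  ultimately show ?thesis
    by (intro that[of "?u 0" "?u (Suc 0)" "?u (Suc (Suc 0))"]) (auto simp: cform_def)
qed

lemma FinBlock_imp_chain:
  fixes E A :: "complex^'m^'m"
  assumes reg: "pencil_regular E A" and b: "FinBlock \<rho> z \<in> set (kcf E A)" and \<rho>: "\<rho> \<ge> 2"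
  obtains x y where "x \<noteq> 0" "z *s (E *v x) + A *v x = 0" "E *v x + (z *s (E *v y) + A *v y) = 0"
proof -
  obtain \<iota> :: "complex Matrix.vec \<Rightarrow> complex^'m" where
    \<iota>: "\<And>x. x \<in> carrier_vec \<rho> \<Longrightarrow> x \<noteq> 0\<^sub>v \<rho> \<Longrightarrow> \<iota> x \<noteq> 0"
    "\<And>x y e. x \<in> carrier_vec \<rho> \<Longrightarrow> y \<in> carrier_vec \<rho> \<Longrightarrow>
       pform (kblock_lead (FinBlock \<rho> z)) (kblock_const (FinBlock \<rho> z)) e x y = 0\<^sub>v \<rho> \<Longrightarrow> cform E A e (\<iota> x) (\<iota> y) = 0"
    using kronecker_block_embedding[OF kcf_form[OF reg] b] unfolding kblock_rows.simps kblock_cols.simps by blast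
  let ?u = "\<lambda>k. \<iota> (unit_vec \<rho> k)"
  have "?u 0 \<noteq> 0" using \<rho> by (intro \<iota>(1)) auto
  moreover have "cform E A (z, 1, 0, 0) (?u 0) (?u 0) = 0" "cform E A (1, 0, z, 1) (?u 0) (?u (Suc 0)) = 0"
    using \<rho> by (auto intro!: \<iota>(2) FinBlock_chain simp del: kblock_lead.simps kblock_const.simps)
  ultimately show ?thesis
    by (intro that[of "?u 0" "?u (Suc 0)"]) (auto simp: cform_def)
qed

text \<open>
  In a pencil whose blocks at infinity have size at most one, \<open>L x = 0\<close> confines \<open>x\<close> to these blocks;
  there \<open>L\<close> vanishes and \<open>C\<close> is invertible, so \<open>C x + L y = 0\<close> gives \<open>x = 0\<close>.
\<close>

lemma infinite_chain_imp_InfBlock: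
  fixes E A :: "complex^'m^'m"
  assumes reg: "pencil_regular E A" and x: "x \<noteq> 0" "E *v x = 0" "A *v x + E *v y = 0"
  shows "\<exists>\<sigma>\<ge>2. InfBlock \<sigma> \<in> set (kcf E A)"
proof (rule ccontr)
  assume *: "\<not> (\<exists>\<sigma>\<ge>2. InfBlock \<sigma> \<in> set (kcf E A))"
  note kf = kcf_form[OF reg]
  have "x = 0"
  proof (rule kronecker_form_injective[OF kf, of "(1, 0, 0, 0)" "(0, 1, 1, 0)" x y])
    fix b and x y :: "complex Matrix.vec"
    assume b: "b \<in> set (kcf E A)" and xy: "x \<in> carrier_vec (kblock_cols b)" "y \<in> carrier_vec (kblock_cols b)"
      and p: "pform (kblock_lead b) (kblock_const b) (1, 0, 0, 0) x y = 0\<^sub>v (kblock_rows b)"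
        "pform (kblock_lead b) (kblock_const b) (0, 1, 1, 0) x y = 0\<^sub>v (kblock_rows b)"
    show "x = 0\<^sub>v (kblock_cols b)"
    proof (cases b)
      case (FinBlock \<rho> a)
      with FinBlock_no_infinite_kernel[of x \<rho> y a] xy p show ?thesis by simp
    next
      case (InfBlock \<sigma>)
      with * b have "\<sigma> \<le> 1" by (metis not_less_eq_eq numeral_2_eq_2 One_nat_def)
      with InfBlock InfBlock_no_chain[of x \<sigma> y] xy p show ?thesis by simp
    qed (use b regular_no_LeftBlock[OF reg kf] regular_no_RightBlock[OF reg kf] in auto)
  qed (use x in \<open>auto simp: cform_def\<close>)
  with x show False by simp
qed

lemma finite_chain_imp_FinBlock:
  fixes E A :: "complex^'m^'m"
  assumes reg: "pencil_regular E A" and x: "x \<noteq> 0" "z *s (E *v x) + A *v x = 0"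
    "E *v x + (z *s (E *v y) + A *v y) = 0"
  shows "\<exists>\<rho>\<ge>2. FinBlock \<rho> z \<in> set (kcf E A)"
proof (rule ccontr)
  assume *: "\<not> (\<exists>\<rho>\<ge>2. FinBlock \<rho> z \<in> set (kcf E A))"
  note kf = kcf_form[OF reg]
  have "x = 0"
  proof (rule kronecker_form_injective[OF kf, of "(z, 1, 0, 0)" "(1, 0, z, 1)" x y])
    fix b and x y :: "complex Matrix.vec"
    assume b: "b \<in> set (kcf E A)" and xy: "x \<in> carrier_vec (kblock_cols b)" "y \<in> carrier_vec (kblock_cols b)"
      and p: "pform (kblock_lead b) (kblock_const b) (z, 1, 0, 0) x y = 0\<^sub>v (kblock_rows b)"
        "pform (kblock_lead b) (kblock_const b) (1, 0, z, 1) x y = 0\<^sub>v (kblock_rows b)"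
    show "x = 0\<^sub>v (kblock_cols b)"
    proof (cases b)
      case (FinBlock \<rho> a)
      with * b have "a = z \<Longrightarrow> \<rho> \<le> 1" by (metis not_less_eq_eq numeral_2_eq_2 One_nat_def)
      with FinBlock FinBlock_no_chain[of x \<rho> y a z] xy p show ?thesis by simp
    next
      case (InfBlock \<sigma>)
      with InfBlock_no_finite_kernel[of x \<sigma> y z] xy p show ?thesis by simp
    qed (use b regular_no_LeftBlock[OF reg kf] regular_no_RightBlock[OF reg kf] in auto)
  qed (use x in \<open>auto simp: cform_def\<close>)
  with x show False by simp
qed

section \<open>Quadratic forms on complex vectors\<close>

definition re_vec :: "complex^'n \<Rightarrow> real^'n" where "re_vec x = (\<chi> i. Re (x $ i))"
definition im_vec :: "complex^'n \<Rightarrow> real^'n" where "im_vec x = (\<chi> i. Im (x $ i))"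
definition cvec :: "real^'n \<Rightarrow> complex^'n" where "cvec x = (\<chi> i. complex_of_real (x $ i))"

definition cinner :: "complex^'n \<Rightarrow> complex^'n \<Rightarrow> complex" where
  "cinner x y = (\<Sum>i\<in>UNIV. cnj (x $ i) * y $ i)"

lemma re_vec_mult: "re_vec (cmatrix X *v x) = X *v re_vec x"
  by (simp add: re_vec_def matrix_vector_mult_def map_matrix_def vec_eq_iff)

lemma im_vec_mult: "im_vec (cmatrix X *v x) = X *v im_vec x"
  by (simp add: im_vec_def matrix_vector_mult_def map_matrix_def vec_eq_iff)

lemma cvec_eq_iff: "x = y \<longleftrightarrow> re_vec x = re_vec y \<and> im_vec x = im_vec y"
  by (auto simp: re_vec_def im_vec_def vec_eq_iff complex_eq_iff)

lemma cvec_mult: "cmatrix X *v cvec x = cvec (X *v x)"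
  by (simp add: cvec_def matrix_vector_mult_def map_matrix_def vec_eq_iff)

lemma cvec_eq_0_iff: "cvec x = 0 \<longleftrightarrow> x = 0"
  by (simp add: cvec_def vec_eq_iff)

lemma re_im_zero: "re_vec 0 = 0" "im_vec 0 = 0"
  by (simp_all add: re_vec_def im_vec_def vec_eq_iff)

lemma cinner_eq: "cinner x y = Complex (re_vec x \<bullet> re_vec y + im_vec x \<bullet> im_vec y)
    (re_vec x \<bullet> im_vec y - im_vec x \<bullet> re_vec y)"
  by (simp add: cinner_def complex_eq_iff re_vec_def im_vec_def inner_vec_def sum.distrib sum_subtractf)

lemma cinner_add_right: "cinner x (y + z) = cinner x y + cinner x z"
  by (simp add: cinner_def algebra_simps sum.distrib)

lemma cinner_diff_right: "cinner x (y - z) = cinner x y - cinner x z"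
  by (simp add: cinner_def algebra_simps sum_subtractf)

lemma cinner_smult_right: "cinner x (c *s y) = c * cinner x y"
  by (simp add: cinner_def sum_distrib_left algebra_simps)

lemma cinner_zero_right: "cinner x 0 = 0"
  by (simp add: cinner_def)

lemma cinner_commute: "cinner y x = cnj (cinner x y)"
  by (simp add: cinner_def mult.commute)

lemma cinner_cmatrix: "cinner x (cmatrix X *v y) = cinner (cmatrix (transpose X) *v x) y"
  unfolding cinner_eq re_vec_mult im_vec_mult by (simp add: inner_mult_transpose)

lemma psd_cinner:
  assumes "psd X"
  obtains a where "a \<ge> 0" "cinner x (cmatrix X *v x) = complex_of_real a" "a = 0 \<Longrightarrow> cmatrix X *v x = 0"
proof
  let ?p = "re_vec x" and ?q = "im_vec x"
  let ?a = "?p \<bullet> (X *v ?p) + ?q \<bullet> (X *v ?q)"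
  have nn: "?p \<bullet> (X *v ?p) \<ge> 0" "?q \<bullet> (X *v ?q) \<ge> 0" using assms by (simp_all add: psd_def)
  then show "?a \<ge> 0" by simp
  have "?p \<bullet> (X *v ?q) = ?q \<bullet> (X *v ?p)"
    using inner_mult_transpose[of ?p X ?q] assms by (simp add: psd_def inner_commute)
  then show "cinner x (cmatrix X *v x) = complex_of_real ?a"
    by (simp add: cinner_eq re_vec_mult im_vec_mult complex_eq_iff)
  assume "?a = 0"
  with nn have "?p \<bullet> (X *v ?p) = 0" "?q \<bullet> (X *v ?q) = 0" by auto
  then have "X *v ?p = 0" "X *v ?q = 0" using psd_quad_eq_0[OF assms] by auto
  then show "cmatrix X *v x = 0"
    by (simp add: cvec_eq_iff re_vec_mult im_vec_mult re_im_zero)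
qed

lemma skew_quad: "skew G \<Longrightarrow> u \<bullet> (G *v u) = 0"
  using inner_mult_transpose[of u G u]
  by (simp add: skew_def uminus_matrix_vector_mult inner_commute)

lemma skew_cinner:
  assumes "skew G"
  obtains g where "cinner x (cmatrix G *v x) = \<i> * complex_of_real g"
proof
  show "cinner x (cmatrix G *v x) = \<i> * complex_of_real (re_vec x \<bullet> (G *v im_vec x) - im_vec x \<bullet> (G *v re_vec x))"
    using assms by (simp add: cinner_eq re_vec_mult im_vec_mult complex_eq_iff skew_quad)
qed

lemma common_kernel_complex:
  assumes "x \<noteq> 0" "\<And>X. X \<in> set Xs \<Longrightarrow> cmatrix X *v x = 0"
  shows "common_kernel Xs \<noteq> {0}"
proof -
  have "X *v re_vec x = 0" "X *v im_vec x = 0" if "X \<in> set Xs" for X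
    using assms(2)[OF that] re_vec_mult[of X x] im_vec_mult[of X x] by (simp_all add: re_im_zero)
  moreover have "re_vec x \<noteq> 0 \<or> im_vec x \<noteq> 0"
    using assms(1) cvec_eq_iff[of x 0] by (simp add: re_im_zero)
  ultimately show ?thesis unfolding common_kernel_iff by blast
qed

lemma cmatrix_diff: "cmatrix (X - Y) *v x = cmatrix X *v x - cmatrix Y *v x"
  by (simp add: vec_eq_iff map_matrix_def matrix_vector_mult_def algebra_simps sum_subtractf)

section \<open>The companion pencil of a dissipative Hamiltonian polynomial\<close>

lemma qpoly_eval_mult_vec:
  "qpoly_eval (dh_poly M D K G) z *v x =
     z\<^sup>2 *s (cmatrix M *v x) + z *s (cmatrix D *v x - cmatrix G *v x) + cmatrix K *v x"
  by (simp add: dh_poly_def matrix_vector_mult_add_rdistrib cscale_mult_vec cmatrix_diff)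

definition vec_join :: "'a^'n \<Rightarrow> 'a^'n \<Rightarrow> 'a^('n + 'n)" where
  "vec_join x y = (\<chi> i. case i of Inl a \<Rightarrow> x $ a | Inr b \<Rightarrow> y $ b)"

lemma vec_join_eq_iff: "vec_join x y = vec_join x' y' \<longleftrightarrow> x = x' \<and> y = y'"
  by (auto simp: vec_join_def vec_eq_iff split: sum.splits)

lemma vec_join_cases:
  obtains x y where "v = vec_join x y"
proof
  show "v = vec_join (\<chi> i. v $ Inl i) (\<chi> i. v $ Inr i)"
    by (auto simp: vec_join_def vec_eq_iff split: sum.splits)
qed

lemma vec_join_zero: "vec_join 0 0 = 0"
  by (auto simp: vec_join_def vec_eq_iff split: sum.splits)

lemma vec_join_add: "vec_join x y + vec_join x' y' = vec_join (x + x') (y + y')"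
  by (auto simp: vec_join_def vec_eq_iff split: sum.splits)

lemma vec_join_smult: "c *s vec_join x y = vec_join (c *s x) (c *s y)"
  by (auto simp: vec_join_def vec_eq_iff split: sum.splits)

lemma sum_UNIV_sum: "(\<Sum>i\<in>UNIV. h (i :: 'n::finite + 'n)) = (\<Sum>a\<in>UNIV. h (Inl a)) + (\<Sum>b\<in>UNIV. h (Inr b))"
  using sum.Plus[of "UNIV :: 'n set" "UNIV :: 'n set" h] by simp

lemma sum_cmat_one: "(\<Sum>b\<in>UNIV. complex_of_real (mat 1 $ (i::'n::finite) $ b) * y $ b) = y $ i"
proof -
  have "complex_of_real (mat 1 $ i $ b) * y $ b = (if i = b then y $ b else 0)" for b
    by (simp add: mat_def)
  then show ?thesis by simp
qed

lemma companion_lead_mult: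
  fixes Y0 Y1 Y2 :: "real^'n::finite^'n"
  shows "companion_lead (Y0, Y1, Y2) *v vec_join x y = vec_join (cmatrix Y2 *v x) y"
  by (auto simp: vec_join_def vec_eq_iff matrix_vector_mult_def map_matrix_def block_matrix_def sum_UNIV_sum
      sum_cmat_one split: sum.splits)

lemma companion_const_mult:
  fixes Y0 Y1 Y2 :: "real^'n::finite^'n"
  shows "companion_const (Y0, Y1, Y2) *v vec_join x y = vec_join (cmatrix Y1 *v x + cmatrix Y0 *v y) (- x)"
  by (auto simp: vec_join_def vec_eq_iff matrix_vector_mult_def map_matrix_def block_matrix_def sum_UNIV_sum
      sum_cmat_one sum_negf split: sum.splits)

lemma dh_lead_mult: "companion_lead (dh_poly M D K G) *v vec_join x y = vec_join (cmatrix M *v x) y"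
  by (simp only: dh_poly_def companion_lead_mult)

lemma dh_const_mult: "companion_const (dh_poly M D K G) *v vec_join x y =
    vec_join (cmatrix D *v x - cmatrix G *v x + cmatrix K *v y) (- x)"
  by (simp only: dh_poly_def companion_const_mult) (simp add: cmatrix_diff)

lemma companion_finite_kernel:
  "z *s (companion_lead (dh_poly M D K G) *v vec_join x y) + companion_const (dh_poly M D K G) *v vec_join x y = 0 \<longleftrightarrow>
   x = z *s y \<and> qpoly_eval (dh_poly M D K G) z *v y = 0"
proof -
  have "z *s (companion_lead (dh_poly M D K G) *v vec_join x y) + companion_const (dh_poly M D K G) *v vec_join x y
      = vec_join (z *s (cmatrix M *v x) + (cmatrix D *v x - cmatrix G *v x + cmatrix K *v y)) (z *s y - x)"
    by (simp add: dh_lead_mult dh_const_mult vec_join_add vec_join_smult)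
  then show ?thesis
    by (auto simp: vec_join_zero[symmetric] vec_join_eq_iff qpoly_eval_mult_vec vector_scalar_commute
      power2_eq_square vector_smult_assoc vector_ssub_ldistrib algebra_simps)
qed

lemma companion_det:
  "pencil_det (companion_lead (dh_poly M D K G)) (companion_const (dh_poly M D K G)) z = 0 \<longleftrightarrow>
   (\<exists>x. x \<noteq> 0 \<and> qpoly_eval (dh_poly M D K G) z *v x = 0)"
proof
  assume "pencil_det (companion_lead (dh_poly M D K G)) (companion_const (dh_poly M D K G)) z = 0"
  then obtain v where v: "v \<noteq> 0" "z *s (companion_lead (dh_poly M D K G) *v v) + companion_const (dh_poly M D K G) *v v = 0"
    unfolding pencil_det_eq_0_iff by blast
  obtain x y where "v = vec_join x y" by (rule vec_join_cases)
  with v have "vec_join x y \<noteq> 0" "x = z *s y" "qpoly_eval (dh_poly M D K G) z *v y = 0"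
    by (auto simp: companion_finite_kernel)
  then show "\<exists>x. x \<noteq> 0 \<and> qpoly_eval (dh_poly M D K G) z *v x = 0"
    by (intro exI[of _ y]) (auto simp: vec_join_zero)
next
  assume "\<exists>x. x \<noteq> 0 \<and> qpoly_eval (dh_poly M D K G) z *v x = 0"
  then obtain y where y: "y \<noteq> 0" "qpoly_eval (dh_poly M D K G) z *v y = 0" by blast
  have "vec_join (z *s y) y \<noteq> 0" using y(1) by (simp add: vec_join_zero[symmetric] vec_join_eq_iff)
  moreover have "z *s (companion_lead (dh_poly M D K G) *v vec_join (z *s y) y) + companion_const (dh_poly M D K G) *v vec_join (z *s y) y = 0"
    using y by (simp add: companion_finite_kernel)
  ultimately show "pencil_det (companion_lead (dh_poly M D K G)) (companion_const (dh_poly M D K G)) z = 0"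
    unfolding pencil_det_eq_0_iff by blast
qed

lemma companion_regular:
  "pencil_regular (companion_lead (dh_poly M D K G)) (companion_const (dh_poly M D K G)) \<longleftrightarrow>
   \<not> singular (dh_poly M D K G)"
  unfolding pencil_regular_def companion_det singular_def det_eq_0_iff_kernel by blast

context
  fixes M D K G :: "real^'n::finite^'n"
  assumes G: "skew G" and M: "psd M" and D: "psd D" and K: "psd K"
begin

text \<open>
  Real part of \<open>x\<^sup>* P(z) x / z = 0\<close>: the contribution of \<open>G\<close> is imaginary and the others are
  nonnegative multiples of nonnegative forms.
\<close>

lemma right_half_plane_kernel:
  assumes z: "Re z > 0" and x: "qpoly_eval (dh_poly M D K G) z *v x = 0"
  shows "cmatrix M *v x = 0" "cmatrix D *v x = 0" "cmatrix K *v x = 0" "cmatrix G *v x = 0"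
proof -
  obtain m where m: "m \<ge> 0" "cinner x (cmatrix M *v x) = complex_of_real m" "m = 0 \<Longrightarrow> cmatrix M *v x = 0"
    using psd_cinner[OF M] by blast
  obtain d where d: "d \<ge> 0" "cinner x (cmatrix D *v x) = complex_of_real d" "d = 0 \<Longrightarrow> cmatrix D *v x = 0"
    using psd_cinner[OF D] by blast
  obtain k where k: "k \<ge> 0" "cinner x (cmatrix K *v x) = complex_of_real k" "k = 0 \<Longrightarrow> cmatrix K *v x = 0"
    using psd_cinner[OF K] by blast
  obtain g where g: "cinner x (cmatrix G *v x) = \<i> * complex_of_real g"
    using skew_cinner[OF G] by blast
  have z0: "z \<noteq> 0" using z by auto
  have "z\<^sup>2 * m + z * (d - \<i> * g) + k = 0"
    using arg_cong[OF x, of "cinner x"]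
    by (simp add: qpoly_eval_mult_vec cinner_add_right cinner_diff_right cinner_smult_right cinner_zero_right m d k g algebra_simps)
  then have "z * m + (d - \<i> * g) + k * inverse z = 0"
    using z0 by (simp add: field_simps power2_eq_square)
  then have "Re (z * m + (d - \<i> * g) + k * inverse z) = 0" by simp
  then have eq: "Re z * m + d + k * Re (inverse z) = 0" by simp
  have iz: "Re (inverse z) > 0"
    using z by (simp add: add_pos_nonneg)
  have "Re z * m \<ge> 0" "k * Re (inverse z) \<ge> 0" using z iz m k by simp_all
  with eq d(1) have "Re z * m = 0" "d = 0" "k * Re (inverse z) = 0" by linarith+
  with z iz have "m = 0" "d = 0" "k = 0" by auto
  then show *: "cmatrix M *v x = 0" "cmatrix D *v x = 0" "cmatrix K *v x = 0" using m d k by auto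
  show "cmatrix G *v x = 0" using x z0 by (simp add: qpoly_eval_mult_vec *)
qed

lemma singular_iff_common_kernel:
  "singular (dh_poly M D K G) \<longleftrightarrow> common_kernel [M, D, K, G] \<noteq> {0}"
proof
  assume "singular (dh_poly M D K G)"
  then obtain x where x: "x \<noteq> 0" "qpoly_eval (dh_poly M D K G) 1 *v x = 0"
    unfolding singular_def det_eq_0_iff_kernel by blast
  show "common_kernel [M, D, K, G] \<noteq> {0}"
    by (rule common_kernel_complex[OF x(1)]) (use right_half_plane_kernel[OF _ x(2)] in auto)
next
  assume "common_kernel [M, D, K, G] \<noteq> {0}"
  then obtain u where "u \<noteq> 0" "M *v u = 0" "D *v u = 0" "K *v u = 0" "G *v u = 0"
    unfolding common_kernel_iff by auto
  then have "cvec u \<noteq> 0 \<and> qpoly_eval (dh_poly M D K G) z *v cvec u = 0" for z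
    by (simp add: cvec_eq_0_iff qpoly_eval_mult_vec cvec_mult) (simp add: cvec_def vec_eq_iff)
  then show "singular (dh_poly M D K G)"
    unfolding singular_def det_eq_0_iff_kernel by blast
qed

lemma singular_imp_MD_kernel: "singular (dh_poly M D K G) \<Longrightarrow> common_kernel [M, D] \<noteq> {0}"
  unfolding singular_iff_common_kernel common_kernel_iff by auto

text \<open>
  The chain at infinity of the companion pencil is \<open>a = (x, 0)\<close>, \<open>b = (y, x)\<close> with \<open>M x = 0\<close> and
  \<open>M y + (D - G) x = 0\<close>. Pairing the last equation with \<open>x\<close> removes \<open>M y\<close> and leaves \<open>x\<^sup>* D x = 0\<close>
  in the real part.
\<close>

lemma infinite_chain_kernel:
  assumes E: "companion_lead (dh_poly M D K G) *v a = 0"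
    and A: "companion_const (dh_poly M D K G) *v a + companion_lead (dh_poly M D K G) *v b = 0" and a: "a \<noteq> 0"
  obtains x y where "x \<noteq> 0" "a = vec_join x 0" "b = vec_join y x" "cmatrix M *v x = 0" "cmatrix D *v x = 0"
    "cmatrix M *v y = cmatrix G *v x"
proof -
  obtain x x' where a': "a = vec_join x x'" by (rule vec_join_cases)
  obtain y y' where b': "b = vec_join y y'" by (rule vec_join_cases)
  have x': "x' = 0" and Mx: "cmatrix M *v x = 0"
    using E by (auto simp: a' dh_lead_mult vec_join_zero[symmetric] vec_join_eq_iff)
  have y': "y' = x" and eq: "cmatrix D *v x - cmatrix G *v x + cmatrix M *v y = 0"
    using A by (auto simp: a' b' x' dh_lead_mult dh_const_mult vec_join_add vec_join_zero[symmetric] vec_join_eq_iff)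
  have x0: "x \<noteq> 0" using a by (auto simp: a' x' vec_join_zero)
  obtain d where d: "d \<ge> 0" "cinner x (cmatrix D *v x) = complex_of_real d" "d = 0 \<Longrightarrow> cmatrix D *v x = 0"
    using psd_cinner[OF D] by blast
  obtain g where g: "cinner x (cmatrix G *v x) = \<i> * complex_of_real g"
    using skew_cinner[OF G] by blast
  have xy: "cinner x (cmatrix M *v y) = 0"
    unfolding cinner_cmatrix psd_sym[OF M] Mx by (simp add: cinner_def)
  have "d - \<i> * g = 0"
    using arg_cong[OF eq, of "cinner x"]
    by (simp add: cinner_add_right cinner_diff_right cinner_zero_right d g xy)
  then have "d = 0" by (simp add: complex_eq_iff)
  then have Dx: "cmatrix D *v x = 0" using d by simp
  have "cmatrix M *v y = cmatrix G *v x" using eq by (simp add: Dx algebra_simps)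
  with x0 show thesis using that[of x y] Mx Dx by (simp add: a' b' x' y')
qed

text \<open>
  A third chain vector would yield \<open>y\<^sup>* M y + x\<^sup>* K x = 0\<close> in the notation of the previous lemma, hence
  \<open>K x = 0\<close> and \<open>G x = M y = 0\<close>, so that \<open>x\<close> is in the kernel of all coefficients.
\<close>

lemma regular_InfBlock:
  assumes reg: "\<not> singular (dh_poly M D K G)"
    and b: "InfBlock \<sigma> \<in> set (kcf (companion_lead (dh_poly M D K G)) (companion_const (dh_poly M D K G)))"
    and \<sigma>: "\<sigma> \<ge> 2"
  shows "common_kernel [M, D] \<noteq> {0}" "\<sigma> = 2"
proof -
  let ?E = "companion_lead (dh_poly M D K G)" and ?A = "companion_const (dh_poly M D K G)"
  obtain a b c where abc: "a \<noteq> 0" "?E *v a = 0" "?A *v a + ?E *v b = 0" "\<sigma> \<ge> 3 \<Longrightarrow> ?A *v b + ?E *v c = 0"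
    using InfBlock_imp_chain[OF _ b \<sigma>] reg companion_regular by metis
  obtain x y where x: "x \<noteq> 0" "a = vec_join x 0" "b = vec_join y x" "cmatrix M *v x = 0" "cmatrix D *v x = 0"
    "cmatrix M *v y = cmatrix G *v x"
    by (rule infinite_chain_kernel[OF abc(2,3,1)])
  show "common_kernel [M, D] \<noteq> {0}"
    by (rule common_kernel_complex[OF x(1)]) (use x in auto)
  show "\<sigma> = 2"
  proof (rule ccontr)
    assume "\<sigma> \<noteq> 2"
    with \<sigma> have eq: "?A *v b + ?E *v c = 0" using abc(4) by simp
    obtain w w' where c: "c = vec_join w w'" by (rule vec_join_cases)
    from eq have eq: "cmatrix D *v y - cmatrix G *v y + cmatrix K *v x + cmatrix M *v w = 0"
      by (auto simp: c x(3) dh_lead_mult dh_const_mult vec_join_add vec_join_zero[symmetric] vec_join_eq_iff)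
    obtain k where k: "k \<ge> 0" "cinner x (cmatrix K *v x) = complex_of_real k" "k = 0 \<Longrightarrow> cmatrix K *v x = 0"
      using psd_cinner[OF K] by blast
    obtain m where m: "m \<ge> 0" "cinner y (cmatrix M *v y) = complex_of_real m" "m = 0 \<Longrightarrow> cmatrix M *v y = 0"
      using psd_cinner[OF M] by blast
    have z: "cinner x (cmatrix M *v w) = 0" "cinner x (cmatrix D *v y) = 0"
      unfolding cinner_cmatrix psd_sym[OF M] psd_sym[OF D] x by (simp_all add: cinner_def)
    have "cmatrix (transpose G) *v x = - (cmatrix G *v x)"
      using G cmatrix_diff[of 0 G x] by (simp add: skew_def map_matrix_def matrix_vector_mult_def vec_eq_iff)
    then have "cinner x (cmatrix G *v y) = cinner (- (cmatrix M *v y)) y"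
      by (simp add: cinner_cmatrix x)
    also have "\<dots> = - cnj (cinner y (cmatrix M *v y))"
      by (simp add: cinner_def sum_negf mult.commute)
    also have "\<dots> = - complex_of_real m" by (simp add: m)
    finally have "complex_of_real m + complex_of_real k = 0"
      using arg_cong[OF eq, of "cinner x"]
      by (simp add: cinner_add_right cinner_diff_right cinner_zero_right k z)
    then have "m + k = 0" by (metis of_real_add of_real_eq_0_iff)
    then have "m = 0" "k = 0" using m(1) k(1) by auto
    then have "cmatrix G *v x = 0" "cmatrix K *v x = 0" using m k x by auto
    then have "common_kernel [M, D, K, G] \<noteq> {0}"
      by (intro common_kernel_complex[OF x(1)]) (use x in auto)
    with reg show False by (simp add: singular_iff_common_kernel)
  qed
qed

lemma qpoly_index_ge_2:
  "qpoly_index (dh_poly M D K G) \<ge> 2 \<longleftrightarrow>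
   (\<exists>\<sigma>\<ge>2. InfBlock \<sigma> \<in> set (kcf (companion_lead (dh_poly M D K G)) (companion_const (dh_poly M D K G))))"
proof -
  let ?bl = "kcf (companion_lead (dh_poly M D K G)) (companion_const (dh_poly M D K G))"
  have "{\<sigma>. InfBlock \<sigma> \<in> set ?bl} = InfBlock -` set ?bl" by auto
  moreover have "finite (InfBlock -` set ?bl)" by (rule finite_vimageI) (auto simp: inj_def)
  ultimately have "finite (insert 0 {\<sigma>. InfBlock \<sigma> \<in> set ?bl})" by simp
  then show ?thesis
    unfolding qpoly_index_def pencil_index_def by (subst Max_ge_iff) auto
qed

lemma index_ge_2_imp_MD_kernel:
  assumes "qpoly_index (dh_poly M D K G) \<ge> 2"
  shows "common_kernel [M, D] \<noteq> {0}"
  using assms singular_imp_MD_kernel regular_InfBlock(1) unfolding qpoly_index_ge_2 by blast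

lemma index_eq_2:
  assumes reg: "\<not> singular (dh_poly M D K G)" and ge: "qpoly_index (dh_poly M D K G) \<ge> 2"
  shows "qpoly_index (dh_poly M D K G) = 2"
proof -
  let ?bl = "kcf (companion_lead (dh_poly M D K G)) (companion_const (dh_poly M D K G))"
  obtain \<sigma> where "\<sigma> \<ge> 2" "InfBlock \<sigma> \<in> set ?bl" using ge unfolding qpoly_index_ge_2 by blast
  then have in2: "InfBlock 2 \<in> set ?bl" using regular_InfBlock(2)[OF reg] by blast
  have "{\<sigma>. InfBlock \<sigma> \<in> set ?bl} \<subseteq> {0..2}" using regular_InfBlock(2)[OF reg] by fastforce
  then show ?thesis
    unfolding qpoly_index_def pencil_index_def using in2
    by (intro Max_eqI) (auto intro: finite_subset)
qed

text \<open>
  The four ways to be unstable are treated in turn: singularity, an eigenvalue in the open right half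
  plane, a block of size at least two at infinity, and such a block at an imaginary eigenvalue. In the
  last case let \<open>x\<close>, \<open>y\<close> be a chain at \<open>z = i w\<close>. For \<open>w = 0\<close> pairing the chain equation with \<open>x\<close> gives
  \<open>D x = 0\<close>. For \<open>w \<noteq> 0\<close> the equation \<open>x\<^sup>* P(z) x = 0\<close> gives \<open>D x = 0\<close>, whence \<open>x\<^sup>* P(z) = 0\<close>, and pairing
  with \<open>x\<close> gives \<open>x\<^sup>* P'(z) x = 0\<close>; the two scalar equations together force \<open>w\<^sup>2 x\<^sup>* M x + x\<^sup>* K x = 0\<close>.
\<close>

lemma unstable_imp_kernel:
  assumes "unstable (dh_poly M D K G)"
  shows "common_kernel [M, D] \<noteq> {0} \<or> common_kernel [D, K] \<noteq> {0}"
proof (cases "singular (dh_poly M D K G)")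
  case True
  then show ?thesis using singular_imp_MD_kernel by blast
next
  case reg: False
  let ?E = "companion_lead (dh_poly M D K G)" and ?A = "companion_const (dh_poly M D K G)"
  have reg': "pencil_regular ?E ?A" using reg companion_regular by blast
  from assms reg' consider (rhp) z where "pencil_det ?E ?A z = 0" "Re z > 0"
    | (fin) \<rho> z where "FinBlock \<rho> z \<in> set (kcf ?E ?A)" "Re z = 0" "\<rho> \<ge> 2"
    | (inf) \<sigma> where "InfBlock \<sigma> \<in> set (kcf ?E ?A)" "\<sigma> \<ge> 2"
    unfolding unstable_def pencil_stable_def by fastforce
  then show ?thesis
  proof cases
    case rhp
    then obtain x where x: "x \<noteq> 0" "qpoly_eval (dh_poly M D K G) z *v x = 0"
      unfolding companion_det by blast
    have "common_kernel [M, D] \<noteq> {0}"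
      by (rule common_kernel_complex[OF x(1)]) (use right_half_plane_kernel[OF rhp(2) x(2)] in auto)
    then show ?thesis ..
  next
    case inf
    then show ?thesis using regular_InfBlock(1)[OF reg] by blast
  next
    case fin
    obtain a b where ab: "a \<noteq> 0" "z *s (?E *v a) + ?A *v a = 0" "?E *v a + (z *s (?E *v b) + ?A *v b) = 0"
      using FinBlock_imp_chain[OF reg' fin(1,3)] by blast
    obtain x' x where a: "a = vec_join x' x" by (rule vec_join_cases)
    obtain y' y where b: "b = vec_join y' y" by (rule vec_join_cases)
    have x': "x' = z *s x" and Qx: "qpoly_eval (dh_poly M D K G) z *v x = 0"
      using ab(2) unfolding a companion_finite_kernel by auto
    have x0: "x \<noteq> 0" using ab(1) by (auto simp: a x' vec_join_zero)
    have y': "y' = z *s y + x"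
      and chain: "cmatrix M *v x' + (z *s (cmatrix M *v y') + (cmatrix D *v y' - cmatrix G *v y' + cmatrix K *v y)) = 0"
      using ab(3) by (auto simp: a b dh_lead_mult dh_const_mult vec_join_add vec_join_smult vec_join_zero[symmetric] vec_join_eq_iff algebra_simps)
    obtain m where m: "m \<ge> 0" "cinner x (cmatrix M *v x) = complex_of_real m" "m = 0 \<Longrightarrow> cmatrix M *v x = 0"
      using psd_cinner[OF M] by blast
    obtain d where d: "d \<ge> 0" "cinner x (cmatrix D *v x) = complex_of_real d" "d = 0 \<Longrightarrow> cmatrix D *v x = 0"
      using psd_cinner[OF D] by blast
    obtain k where k: "k \<ge> 0" "cinner x (cmatrix K *v x) = complex_of_real k" "k = 0 \<Longrightarrow> cmatrix K *v x = 0"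
      using psd_cinner[OF K] by blast
    obtain g where g: "cinner x (cmatrix G *v x) = \<i> * complex_of_real g"
      using skew_cinner[OF G] by blast
    obtain w where z: "z = \<i> * complex_of_real w" using fin(2) by (intro that[of "Im z"]) (simp add: complex_eq_iff)
    have q1: "z\<^sup>2 * m + z * (d - \<i> * g) + k = 0"
      using arg_cong[OF Qx, of "cinner x"]
      by (simp add: qpoly_eval_mult_vec cinner_add_right cinner_diff_right cinner_smult_right cinner_zero_right m d k g algebra_simps)
    show ?thesis
    proof (cases "w = 0")
      case True
      then have z0: "z = 0" by (simp add: z)
      have k0: "k = 0" using q1 z0 by simp
      then have Kx: "cmatrix K *v x = 0" using k by simp
      have xy: "cinner x (cmatrix K *v y) = 0"
        unfolding cinner_cmatrix psd_sym[OF K] Kx by (simp add: cinner_def)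
      have "d - \<i> * g = 0"
        using arg_cong[OF chain, of "cinner x"] d g xy
        by (simp add: x' y' z0 cinner_add_right cinner_diff_right cinner_smult_right cinner_zero_right)
      then have "d = 0" by (simp add: complex_eq_iff)
      then have "cmatrix D *v x = 0" using d by simp
      with Kx have "common_kernel [D, K] \<noteq> {0}"
        by (intro common_kernel_complex[OF x0]) auto
      then show ?thesis ..
    next
      case False
      have "Im (z\<^sup>2 * m + z * (d - \<i> * g) + k) = 0" "Re (z\<^sup>2 * m + z * (d - \<i> * g) + k) = 0" using q1 by simp_all
      then have d0: "d = 0" and q2: "- w\<^sup>2 * m + w * g + k = 0"
        using False by (simp_all add: z power2_eq_square)
      have Dx: "cmatrix D *v x = 0" using d d0 by simp
      have Gt: "cmatrix (transpose G) *v x = - (cmatrix G *v x)"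
        using G by (simp add: skew_def map_matrix_def matrix_vector_mult_def vec_eq_iff sum_negf)
      (* D x = 0, and without D the matrix P(z) is Hermitian for imaginary z *)
      have "cinner x (z\<^sup>2 *s (cmatrix M *v y) + z *s (cmatrix D *v y - cmatrix G *v y) + cmatrix K *v y)
        = cnj (cinner y (qpoly_eval (dh_poly M D K G) z *v x))"
      proof -
        have 1: "cinner x (cmatrix M *v y) = cnj (cinner y (cmatrix M *v x))"
          unfolding cinner_cmatrix[of x] psd_sym[OF M] by (rule cinner_commute)
        have 2: "cinner x (cmatrix K *v y) = cnj (cinner y (cmatrix K *v x))"
          unfolding cinner_cmatrix[of x] psd_sym[OF K] by (rule cinner_commute)
        have 3: "cinner x (cmatrix D *v y) = 0"
          unfolding cinner_cmatrix[of x] psd_sym[OF D] Dx by (simp add: cinner_def)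
        have 4: "cinner x (cmatrix G *v y) = - cnj (cinner y (cmatrix G *v x))"
          unfolding cinner_cmatrix[of x] Gt by (simp add: cinner_def sum_negf mult.commute)
        show ?thesis
          by (simp add: qpoly_eval_mult_vec cinner_add_right cinner_diff_right cinner_smult_right cinner_zero_right
            1 2 3 4 Dx z power2_eq_square)
      qed
      then have y0: "cinner x (z\<^sup>2 *s (cmatrix M *v y) + z *s (cmatrix D *v y - cmatrix G *v y) + cmatrix K *v y) = 0"
        by (simp add: Qx cinner_zero_right)
      have "cmatrix M *v x' + (z *s (cmatrix M *v y') + (cmatrix D *v y' - cmatrix G *v y' + cmatrix K *v y))
        = (z\<^sup>2 *s (cmatrix M *v y) + z *s (cmatrix D *v y - cmatrix G *v y) + cmatrix K *v y)
          + ((2 * z) *s (cmatrix M *v x) + (cmatrix D *v x - cmatrix G *v x))"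
        by (simp add: x' y' matrix_vector_right_distrib vector_scalar_commute vec_eq_iff power2_eq_square algebra_simps)
      with chain have "cinner x ((z\<^sup>2 *s (cmatrix M *v y) + z *s (cmatrix D *v y - cmatrix G *v y) + cmatrix K *v y)
          + ((2 * z) *s (cmatrix M *v x) + (cmatrix D *v x - cmatrix G *v x))) = 0"
        by (simp add: cinner_zero_right)
      then have "cinner x ((2 * z) *s (cmatrix M *v x) + (cmatrix D *v x - cmatrix G *v x)) = 0"
        using y0 by (simp only: cinner_add_right[of x "_ + cmatrix K *v y"]) simp
      then have "2 * z * m + (d - \<i> * g) = 0"
        by (simp add: cinner_add_right cinner_diff_right cinner_smult_right m d g)
      then have "Im (2 * z * m + (d - \<i> * g)) = 0" by simp
      then have "g = 2 * w * m" by (simp add: z)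
      with q2 have "w\<^sup>2 * m + k = 0" by (simp add: power2_eq_square algebra_simps)
      then have "w\<^sup>2 * m = 0" "k = 0" using m(1) k(1) by (smt (verit) mult_nonneg_nonneg zero_le_power2)+
      then have "cmatrix M *v x = 0" using False m by simp
      with Dx have "common_kernel [M, D] \<noteq> {0}"
        by (intro common_kernel_complex[OF x0]) auto
      then show ?thesis ..
    qed
  qed
qed

text \<open>
  The chain at infinity is \<open>(u, 0)\<close>, \<open>(b, u)\<close>.
\<close>

lemma index_ge_2I:
  assumes reg: "\<not> singular (dh_poly M D K G)" and u: "u \<noteq> 0" "M *v u = 0" "D *v u = 0" "M *v b = G *v u"
  shows "qpoly_index (dh_poly M D K G) \<ge> 2"
  unfolding qpoly_index_ge_2
proof (rule infinite_chain_imp_InfBlock[of _ _ "vec_join (cvec u) 0" "vec_join (cvec b) (cvec u)"])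
  have z: "cvec (0 :: real^'n) = 0" by (simp add: cvec_eq_0_iff)
  show "pencil_regular (companion_lead (dh_poly M D K G)) (companion_const (dh_poly M D K G))"
    using reg companion_regular by blast
  show "vec_join (cvec u) 0 \<noteq> 0" using u by (simp add: vec_join_zero[symmetric] vec_join_eq_iff cvec_eq_0_iff)
  show "companion_lead (dh_poly M D K G) *v vec_join (cvec u) 0 = 0"
    by (simp add: dh_lead_mult cvec_mult u z vec_join_zero)
  show "companion_const (dh_poly M D K G) *v vec_join (cvec u) 0 +
    companion_lead (dh_poly M D K G) *v vec_join (cvec b) (cvec u) = 0"
    by (simp add: dh_lead_mult dh_const_mult cvec_mult u z vec_join_add vec_join_zero)
qed

lemma index_ge_2_imp_unstable:
  assumes "qpoly_index (dh_poly M D K G) \<ge> 2"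
  shows "unstable (dh_poly M D K G)"
  using assms unfolding qpoly_index_ge_2 unstable_def pencil_stable_def by fastforce

text \<open>
  A singular polynomial is unstable by definition; otherwise \<open>(0, u)\<close>, \<open>(u, b)\<close> is a chain of length two
  at the eigenvalue \<open>0\<close>.
\<close>

lemma zero_chain_unstable:
  assumes u: "u \<noteq> 0" "D *v u = 0" "K *v u = 0" "K *v b = G *v u"
  shows "unstable (dh_poly M D K G)"
proof (cases "singular (dh_poly M D K G)")
  case True
  then show ?thesis unfolding unstable_def pencil_stable_def companion_regular by blast
next
  case False
  have z: "cvec (0 :: real^'n) = 0" by (simp add: cvec_eq_0_iff)
  have "\<exists>\<rho>\<ge>2. FinBlock \<rho> 0 \<in> set (kcf (companion_lead (dh_poly M D K G)) (companion_const (dh_poly M D K G)))"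
  proof (rule finite_chain_imp_FinBlock[of _ _ "vec_join 0 (cvec u)" _ "vec_join (cvec u) (cvec b)"])
    show "pencil_regular (companion_lead (dh_poly M D K G)) (companion_const (dh_poly M D K G))"
      using False companion_regular by blast
    show "vec_join 0 (cvec u) \<noteq> 0" using u by (simp add: vec_join_zero[symmetric] vec_join_eq_iff cvec_eq_0_iff)
    show "0 *s (companion_lead (dh_poly M D K G) *v vec_join 0 (cvec u)) +
      companion_const (dh_poly M D K G) *v vec_join 0 (cvec u) = 0"
      by (simp add: dh_lead_mult dh_const_mult cvec_mult u z vec_join_zero)
    show "companion_lead (dh_poly M D K G) *v vec_join 0 (cvec u) +
      (0 *s (companion_lead (dh_poly M D K G) *v vec_join (cvec u) (cvec b)) +
       companion_const (dh_poly M D K G) *v vec_join (cvec u) (cvec b)) = 0"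
      by (simp add: dh_lead_mult dh_const_mult cvec_mult u z vec_join_add vec_join_zero)
  qed
  then show ?thesis unfolding unstable_def pencil_stable_def by fastforce
qed

end

section \<open>Approximation by polynomials of index two and by unstable polynomials\<close>

lemma inner_transpose: "transpose X \<bullet> transpose Y = X \<bullet> (Y :: real^'n::finite^'n)"
  unfolding inner_vec_def transpose_def inner_real_def by (simp, subst sum.swap, simp)

lemma inner_sym_skew:
  assumes "transpose X = X" "skew Y"
  shows "X \<bullet> Y = 0"
  using inner_transpose[of X Y] assms by (simp add: skew_def)

text \<open>
  The coefficient of \<open>\<lambda>\<close> is stored as \<open>- (G - D)\<close>; its symmetric and skew-symmetric parts are orthogonal,
  so the norm does not mix \<open>D\<close> and \<open>G\<close>.
\<close>

lemma norm_dh_poly: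
  assumes "transpose D = D" "skew G"
  shows "(norm (dh_poly M D K G))\<^sup>2 = (norm M)\<^sup>2 + (norm D)\<^sup>2 + (norm K)\<^sup>2 + (norm G)\<^sup>2"
proof -
  have "(norm (G - D))\<^sup>2 = (norm D)\<^sup>2 + (norm G)\<^sup>2"
    using inner_sym_skew[OF assms]
    by (simp add: power2_norm_eq_inner inner_diff_left inner_diff_right inner_commute)
  then show ?thesis by (simp add: dh_poly_def norm_qpoly_eq del: minus_diff_eq)
qed

lemma dh_poly_add:
  "dh_poly M D K G + dh_poly M' D' K' G' = dh_poly (M + M') (D + D') (K + K') (G + G')"
  by (simp add: dh_poly_def)

lemma dh_poly_diff:
  "dh_poly M D K G - dh_poly M' D' K' G' = dh_poly (M - M') (D - D') (K - K') (G - G')"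
  by (simp add: dh_poly_def)

lemma dh_poly_scaleR:
  "c *\<^sub>R dh_poly M D K G = dh_poly (c *\<^sub>R M) (c *\<^sub>R D) (c *\<^sub>R K) (c *\<^sub>R G)"
  by (simp add: dh_poly_def scaleR_diff_right)

lemma skew_diff: "skew X \<Longrightarrow> skew Y \<Longrightarrow> skew (X - Y)"
  by (simp add: skew_def transpose_diff)

lemma skew_zero: "skew 0"
  by (simp add: skew_def transpose_zero)

lemma dh_class_iff: "Q \<in> dh_class \<longleftrightarrow> (\<exists>M D K G. Q = dh_poly M D K G \<and> skew G \<and> psd M \<and> psd D \<and> psd K)"
  by (auto simp: dh_class_def)

lemma psd_mat1: "psd (mat 1)"
  by (simp add: psd_def)

lemma complement_projection_mult:
  assumes "norm u = 1"
  shows "(mat 1 + Delta u (mat 1)) *v x = x - (u \<bullet> x) *\<^sub>R u"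
  using assms by (simp add: matrix_vector_mult_add_rdistrib Delta_mult_vec dot_square_norm)

text \<open>
  After adding \<open>t (I - u u\<^sup>T)\<close> the kernel is spanned by \<open>u\<close>, and a symmetric matrix maps onto the
  orthogonal complement of its kernel. The solution is obtained from the positive definite matrix
  \<open>S + u u\<^sup>T\<close>.
\<close>

lemma solve_orthogonal:
  fixes X :: "real^'n::finite^'n"
  assumes X: "psd X" and u: "norm u = 1" "X *v u = 0" and t: "t > 0" and w: "u \<bullet> w = 0"
  shows "\<exists>b. (X + t *\<^sub>R (mat 1 + Delta u (mat 1))) *v b = w"
proof -
  define S where "S = X + t *\<^sub>R (mat 1 + Delta u (mat 1))"
  have S: "psd S" unfolding S_def using t u
    by (intro psd_add X psd_scaleR psd_Delta psd_mat1) auto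
  have Su: "S *v u = 0" using u Delta_kernel[OF u(1), of "mat 1"]
    by (simp add: S_def matrix_vector_mult_add_rdistrib[of X] scaleR_matrix_vector_assoc[symmetric])
  have mult: "(S + outer u u) *v x = S *v x + (u \<bullet> x) *\<^sub>R u" for x
    by (simp add: matrix_vector_mult_add_rdistrib outer_mult_vec)
  have "x = 0" if "(S + outer u u) *v x = 0" for x
  proof -
    have "0 = x \<bullet> ((S + outer u u) *v x)" using that by simp
    also have "\<dots> = x \<bullet> (X *v x) + t * (x \<bullet> x - (u \<bullet> x)\<^sup>2) + (u \<bullet> x)\<^sup>2"
      unfolding mult unfolding S_def matrix_vector_mult_add_rdistrib[of X] scaleR_matrix_vector_assoc[symmetric]
        complement_projection_mult[OF u(1)]
      by (simp add: inner_add_right inner_diff_right power2_eq_square inner_commute[of x u])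
    finally have eq: "x \<bullet> (X *v x) + t * (x \<bullet> x - (u \<bullet> x)\<^sup>2) + (u \<bullet> x)\<^sup>2 = 0" by simp
    have "x \<bullet> (X *v x) \<ge> 0" using X by (simp add: psd_def)
    moreover have cs: "x \<bullet> x - (u \<bullet> x)\<^sup>2 \<ge> 0"
      using unit_inner_square_le[OF u(1), of x] by (simp add: dot_square_norm)
    then have "t * (x \<bullet> x - (u \<bullet> x)\<^sup>2) \<ge> 0" using t by simp
    moreover have "(u \<bullet> x)\<^sup>2 \<ge> 0" by simp
    ultimately have "t * (x \<bullet> x - (u \<bullet> x)\<^sup>2) = 0" "(u \<bullet> x)\<^sup>2 = 0" using eq by linarith+
    with t show "x = 0" by simp
  qed
  then have "\<exists>B. B ** (S + outer u u) = mat 1"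
    unfolding matrix_left_invertible_ker by blast
  then obtain B where "(S + outer u u) ** B = mat 1" unfolding matrix_left_right_inverse by blast
  then have b: "(S + outer u u) *v (B *v w) = w" by (simp add: matrix_vector_mul_assoc)
  have uu: "u \<bullet> u = 1" using u by (simp add: dot_square_norm)
  have "u \<bullet> (S *v (B *v w)) = 0"
    unfolding inner_mult_transpose[of u S] psd_sym[OF S] Su by simp
  then have "u \<bullet> (B *v w) = 0"
    using arg_cong[OF b, of "(\<bullet>) u"] w uu by (simp add: mult inner_add_right)
  with b have "S *v (B *v w) = w" by (simp add: mult)
  then show ?thesis unfolding S_def by blast
qed

lemma ray_in_closure:
  fixes P R :: "'a::real_normed_vector"
  assumes "\<And>t. t > 0 \<Longrightarrow> P + t *\<^sub>R R \<in> S"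
  shows "P \<in> closure S"
  unfolding closure_approachable
proof (intro allI impI)
  fix e :: real assume e: "e > 0"
  (* small enough for t * norm R < e, also if R = 0 *)
  define t where "t = e / (norm R + 1)"
  have n: "norm R + 1 > 0" by (simp add: add_nonneg_pos)
  then have t: "t > 0" using e by (simp add: t_def)
  have "t * norm R < t * (norm R + 1)" using t by simp
  also have "\<dots> = e" using n by (simp add: t_def)
  finally have "dist (P + t *\<^sub>R R) P < e" using t by (simp add: dist_norm)
  with assms[OF t] show "\<exists>y\<in>S. dist y P < e" by blast
qed

lemma psd_distance_le:
  assumes "psd X" "psd X'" "X' *v u = 0" "norm u = 1"
  shows "(norm (Delta u X))\<^sup>2 \<le> (norm (X' - X))\<^sup>2"
  using norm_Delta_psd_le[of u X "X' - X"] assms by simp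

lemma psd_cost2:
  assumes "norm u = 1" "psd X" "psd Y"
  shows "psd_cost [X, Y] u = (norm (Delta u X))\<^sup>2 + (norm (Delta u Y))\<^sup>2"
  using assms by (subst psd_cost_Delta) (auto simp: psd_sym)

lemma psd_cost3:
  assumes "norm u = 1" "psd X" "psd Y" "psd Z"
  shows "psd_cost [X, Y, Z] u = (norm (Delta u X))\<^sup>2 + (norm (Delta u Y))\<^sup>2 + (norm (Delta u Z))\<^sup>2"
  using assms by (subst psd_cost_Delta) (auto simp: psd_sym)

lemma common_kernel_distance:
  fixes X Y :: "real^'n::finite^'n"
  assumes X: "psd X" and Y: "psd Y" and s: "psd X'" "psd Y'" and ck: "common_kernel [X', Y'] \<noteq> {0}"
    and r: "(norm (X' - X))\<^sup>2 + (norm (Y' - Y))\<^sup>2 \<le> r\<^sup>2" "r \<ge> 0"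
  shows "\<exists>u. norm u = 1 \<and> sqrt (psd_cost [X, Y] u) \<le> r"
proof -
  from ck obtain u where u: "norm u = 1" and k: "X' *v u = 0" "Y' *v u = 0"
    unfolding common_kernel_unit by auto
  have "psd_cost [X, Y] u \<le> (norm (X' - X))\<^sup>2 + (norm (Y' - Y))\<^sup>2"
    unfolding psd_cost2[OF u X Y] by (intro add_mono psd_distance_le X Y s k u)
  also note r(1)
  finally have "sqrt (psd_cost [X, Y] u) \<le> r" using r(2) by (simp add: real_le_lsqrt)
  with u show ?thesis by blast
qed

context
  fixes M D K G :: "real^'n::finite^'n"
  assumes G: "skew G" and M: "psd M" and D: "psd D" and K: "psd K"
begin

text \<open>
  Approximation along \<open>M + t (I - u u\<^sup>T)\<close> and \<open>K + t I\<close>: the first makes \<open>M b = G u\<close> solvable, the second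
  makes \<open>K\<close> definite and thus the polynomial regular.
\<close>

lemma closure_regular_index_2:
  assumes u: "norm u = 1" "M *v u = 0" "D *v u = 0"
  shows "dh_poly M D K G \<in> closure {Q \<in> dh_class. \<not> singular Q \<and> qpoly_index Q > 1}"
proof (rule ray_in_closure)
  fix t :: real assume t: "t > 0"
  let ?W = "mat 1 + Delta u (mat 1) :: real^'n^'n"
  let ?M = "M + t *\<^sub>R ?W" and ?K = "K + t *\<^sub>R mat 1"
  have eq: "dh_poly M D K G + t *\<^sub>R dh_poly ?W 0 (mat 1) 0 = dh_poly ?M D ?K G"
    by (simp add: dh_poly_scaleR dh_poly_add)
  have M': "psd ?M" and K': "psd ?K" using t u by (auto intro!: psd_add M K psd_scaleR psd_Delta psd_mat1)
  have Mu: "?M *v u = 0" using u Delta_kernel[OF u(1), of "mat 1"]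
    by (simp add: matrix_vector_mult_add_rdistrib[of M] scaleR_matrix_vector_assoc[symmetric])
  obtain b where b: "?M *v b = G *v u"
    using solve_orthogonal[OF M u(1,2) t skew_quad[OF G]] by blast
  have "x = 0" if "?K *v x = 0" for x
  proof -
    have "0 = x \<bullet> (?K *v x)" using that by simp
    also have "\<dots> = x \<bullet> (K *v x) + t * (x \<bullet> x)"
      by (simp add: matrix_vector_mult_add_rdistrib scaleR_matrix_vector_assoc[symmetric] inner_add_right)
    finally have "x \<bullet> (K *v x) + t * (x \<bullet> x) = 0" by simp
    moreover have "x \<bullet> (K *v x) \<ge> 0" using K by (simp add: psd_def)
    moreover have "t * (x \<bullet> x) \<ge> 0" using t by simp
    ultimately have "t * (x \<bullet> x) = 0" by linarith
    then show ?thesis using t by simp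
  qed
  then have reg: "\<not> singular (dh_poly ?M D ?K G)"
    unfolding singular_iff_common_kernel[OF G M' D K'] common_kernel_iff by auto
  have "u \<noteq> 0" using u by auto
  then have "qpoly_index (dh_poly ?M D ?K G) \<ge> 2"
    using index_ge_2I[OF G M' D K' reg _ Mu u(3) b] by blast
  then show "dh_poly M D K G + t *\<^sub>R dh_poly ?W 0 (mat 1) 0 \<in> {Q \<in> dh_class. \<not> singular Q \<and> qpoly_index Q > 1}"
    unfolding eq using reg G M' D K' by (auto simp: dh_class_iff)
qed

lemma closure_unstable_MD:
  assumes "norm u = 1" "M *v u = 0" "D *v u = 0"
  shows "dh_poly M D K G \<in> closure {Q \<in> dh_class. unstable Q}"
proof -
  have "{Q \<in> dh_class. \<not> singular Q \<and> qpoly_index Q > 1} \<subseteq> {Q \<in> dh_class. unstable (Q :: 'n qpoly)}"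
    by (auto simp: dh_class_iff intro!: index_ge_2_imp_unstable)
  from closure_mono[OF this] closure_regular_index_2[OF assms] show ?thesis by blast
qed

lemma closure_unstable_DK:
  assumes u: "norm u = 1" "D *v u = 0" "K *v u = 0"
  shows "dh_poly M D K G \<in> closure {Q \<in> dh_class. unstable Q}"
proof (rule ray_in_closure)
  fix t :: real assume t: "t > 0"
  let ?W = "mat 1 + Delta u (mat 1) :: real^'n^'n"
  let ?K = "K + t *\<^sub>R ?W"
  have eq: "dh_poly M D K G + t *\<^sub>R dh_poly 0 0 ?W 0 = dh_poly M D ?K G"
    by (simp add: dh_poly_scaleR dh_poly_add)
  have K': "psd ?K" using t u by (auto intro!: psd_add K psd_scaleR psd_Delta psd_mat1)
  have Ku: "?K *v u = 0" using u Delta_kernel[OF u(1), of "mat 1"]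
    by (simp add: matrix_vector_mult_add_rdistrib[of K] scaleR_matrix_vector_assoc[symmetric])
  obtain b where b: "?K *v b = G *v u"
    using solve_orthogonal[OF K u(1,3) t skew_quad[OF G]] by blast
  have "u \<noteq> 0" using u by auto
  then have "unstable (dh_poly M D ?K G)"
    using zero_chain_unstable[OF G M D K' _ u(2) Ku b] by blast
  then show "dh_poly M D K G + t *\<^sub>R dh_poly 0 0 ?W 0 \<in> {Q \<in> dh_class. unstable Q}"
    unfolding eq using G M D K' by (auto simp: dh_class_iff)
qed

lemma perturbation_decompose:
  assumes "dh_poly M D K G + \<Delta> \<in> dh_class"
  obtains M' D' K' G' where "dh_poly M D K G + \<Delta> = dh_poly M' D' K' G'" "skew G'" "psd M'" "psd D'" "psd K'"
    "(norm \<Delta>)\<^sup>2 = (norm (M' - M))\<^sup>2 + (norm (D' - D))\<^sup>2 + (norm (K' - K))\<^sup>2 + (norm (G' - G))\<^sup>2"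
proof -
  obtain M' D' K' G' where eq: "dh_poly M D K G + \<Delta> = dh_poly M' D' K' G'" and s: "skew G'" "psd M'" "psd D'" "psd K'"
    using assms unfolding dh_class_iff by blast
  have "\<Delta> = dh_poly M' D' K' G' - dh_poly M D K G" using eq by (metis add_diff_cancel_left')
  also have "\<dots> = dh_poly (M' - M) (D' - D) (K' - K) (G' - G)" by (rule dh_poly_diff)
  finally have "\<Delta> = dh_poly (M' - M) (D' - D) (K' - K) (G' - G)" .
  then have "(norm \<Delta>)\<^sup>2 = (norm (M' - M))\<^sup>2 + (norm (D' - D))\<^sup>2 + (norm (K' - K))\<^sup>2 + (norm (G' - G))\<^sup>2"
    using s D G by (simp add: norm_dh_poly skew_diff transpose_diff psd_sym)
  with eq s show thesis by (rule that)
qed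

lemma singular_perturbation_cost_le:
  assumes "dh_poly M D K G + \<Delta> \<in> dh_class" "singular (dh_poly M D K G + \<Delta>)"
  shows "\<exists>u. norm u = 1 \<and> sqrt (2 * (norm (G *v u))\<^sup>2 + psd_cost [M, D, K] u) \<le> norm \<Delta>"
proof -
  obtain M' D' K' G' where eq: "dh_poly M D K G + \<Delta> = dh_poly M' D' K' G'"
    and s: "skew G'" "psd M'" "psd D'" "psd K'"
    and n: "(norm \<Delta>)\<^sup>2 = (norm (M' - M))\<^sup>2 + (norm (D' - D))\<^sup>2 + (norm (K' - K))\<^sup>2 + (norm (G' - G))\<^sup>2"
    by (rule perturbation_decompose[OF assms(1)])
  have "common_kernel [M', D', K', G'] \<noteq> {0}"
    using assms(2) singular_iff_common_kernel[OF s] by (simp add: eq)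
  then obtain u where u: "norm u = 1" and k: "M' *v u = 0" "D' *v u = 0" "K' *v u = 0" "G' *v u = 0"
    unfolding common_kernel_unit by auto
  have "2 * (norm (G *v u))\<^sup>2 \<le> (norm (G' - G))\<^sup>2"
    using norm_Delta_skew_le[OF u G, of "G' - G"] s k by simp
  moreover have "psd_cost [M, D, K] u \<le> (norm (M' - M))\<^sup>2 + (norm (D' - D))\<^sup>2 + (norm (K' - K))\<^sup>2"
    unfolding psd_cost3[OF u M D K] by (intro add_mono psd_distance_le M D K s k u)
  ultimately have "2 * (norm (G *v u))\<^sup>2 + psd_cost [M, D, K] u \<le> (norm \<Delta>)\<^sup>2" using n by simp
  then have "sqrt (2 * (norm (G *v u))\<^sup>2 + psd_cost [M, D, K] u) \<le> norm \<Delta>" by (simp add: real_le_lsqrt)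
  with u show ?thesis by blast
qed

lemma higher_index_perturbation_cost_le:
  assumes "dh_poly M D K G + \<Delta> \<in> dh_class" "qpoly_index (dh_poly M D K G + \<Delta>) \<ge> 2"
  shows "\<exists>u. norm u = 1 \<and> sqrt (psd_cost [M, D] u) \<le> norm \<Delta>"
proof -
  obtain M' D' K' G' where eq: "dh_poly M D K G + \<Delta> = dh_poly M' D' K' G'"
    and s: "skew G'" "psd M'" "psd D'" "psd K'"
    and n: "(norm \<Delta>)\<^sup>2 = (norm (M' - M))\<^sup>2 + (norm (D' - D))\<^sup>2 + (norm (K' - K))\<^sup>2 + (norm (G' - G))\<^sup>2"
    by (rule perturbation_decompose[OF assms(1)])
  have "common_kernel [M', D'] \<noteq> {0}"
    using index_ge_2_imp_MD_kernel[OF s] assms(2) by (simp add: eq)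
  from common_kernel_distance[OF M D s(2,3) this, of "norm \<Delta>"] show ?thesis by (simp add: n)
qed

lemma unstable_perturbation_cost_le:
  assumes "dh_poly M D K G + \<Delta> \<in> dh_class" "unstable (dh_poly M D K G + \<Delta>)"
  shows "\<exists>u. norm u = 1 \<and> min (sqrt (psd_cost [M, D] u)) (sqrt (psd_cost [D, K] u)) \<le> norm \<Delta>"
proof -
  obtain M' D' K' G' where eq: "dh_poly M D K G + \<Delta> = dh_poly M' D' K' G'"
    and s: "skew G'" "psd M'" "psd D'" "psd K'"
    and n: "(norm \<Delta>)\<^sup>2 = (norm (M' - M))\<^sup>2 + (norm (D' - D))\<^sup>2 + (norm (K' - K))\<^sup>2 + (norm (G' - G))\<^sup>2"
    by (rule perturbation_decompose[OF assms(1)])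
  from unstable_imp_kernel[OF s] assms(2)
  consider "common_kernel [M', D'] \<noteq> {0}" | "common_kernel [D', K'] \<noteq> {0}" by (auto simp: eq)
  then obtain u where "norm u = 1" "sqrt (psd_cost [M, D] u) \<le> norm \<Delta> \<or> sqrt (psd_cost [D, K] u) \<le> norm \<Delta>"
  proof cases
    case 1
    from common_kernel_distance[OF M D s(2,3) 1, of "norm \<Delta>"] show thesis using that by (auto simp: n)
  next
    case 2
    from common_kernel_distance[OF D K s(3,4) 2, of "norm \<Delta>"] show thesis using that by (auto simp: n)
  qed
  then show ?thesis by (auto simp: min_le_iff_disj)
qed

end

section \<open>The three distances\<close>

lemma Inf_upper_closure:
  fixes P \<Delta> :: "'n::finite qpoly"
  assumes "P + \<Delta> \<in> closure {Q \<in> dh_class. T Q}" "norm \<Delta> = c" "e > 0"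
  shows "\<exists>s\<in>{norm \<Delta> | \<Delta>. P + \<Delta> \<in> dh_class \<and> T (P + \<Delta>)}. s < c + e"
proof -
  obtain Q where Q: "Q \<in> dh_class" "T Q" "dist Q (P + \<Delta>) < e"
    using assms(1,3) unfolding closure_approachable by blast
  have "norm (Q - P) \<le> norm \<Delta> + norm (Q - (P + \<Delta>))"
    using norm_triangle_ineq[of \<Delta> "Q - (P + \<Delta>)"] by (simp add: algebra_simps)
  then have "norm (Q - P) < c + e" using Q(3) assms(2) by (simp add: dist_norm)
  moreover have "norm (Q - P) \<in> {norm \<Delta> | \<Delta>. P + \<Delta> \<in> dh_class \<and> T (P + \<Delta>)}"
    by (intro CollectI exI[of _ "Q - P"]) (use Q in simp)
  ultimately show ?thesis by blast
qed

text \<open>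
  If every member of \<open>S\<close> has distance from \<open>P\<close> at least \<open>f u\<close> for some unit \<open>u\<close>, then \<open>f\<close> cannot be
  bounded below by a positive constant when \<open>P\<close> is in the closure. This replaces a closedness argument
  for the set of polynomials with a common kernel.
\<close>

lemma closure_sphere_zero:
  fixes P :: "'a::real_normed_vector" and f :: "real^'n \<Rightarrow> real"
  assumes cont: "continuous_on (sphere 0 1) f"
    and lower: "\<And>Q. Q \<in> S \<Longrightarrow> \<exists>u. norm u = 1 \<and> f u \<le> norm (Q - P)"
    and P: "P \<in> closure S"
  shows "\<exists>u. norm u = 1 \<and> f u \<le> 0"
proof -
  obtain m where m: "is_sphere_min f m" using sphere_min_exists[OF cont] by blast
  have "m \<le> 0"
  proof (rule field_le_epsilon)
    fix e :: real assume "e > 0"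
    then obtain Q where Q: "Q \<in> S" "dist Q P < e" using P unfolding closure_approachable by blast
    obtain u where "norm u = 1" "f u \<le> norm (Q - P)" using lower[OF Q(1)] by blast
    then show "m \<le> 0 + e" using m Q(2) by (force simp: is_sphere_min_def dist_norm)
  qed
  then show ?thesis using m unfolding is_sphere_min_def by auto
qed

lemma psd_cost_zero:
  assumes "norm u = 1" "sqrt (psd_cost Xs u) \<le> 0"
  shows "common_kernel Xs \<noteq> {0}"
proof -
  have "(\<Sum>X\<leftarrow>Xs. (norm (X *v u))\<^sup>2) \<le> 0"
    using psd_cost_bounds(1)[OF assms(1), of Xs] assms(2) by simp
  then have "\<forall>X\<in>set Xs. X *v u = 0"
  proof (induction Xs)
    case (Cons X Xs)
    have "(\<Sum>X\<leftarrow>Xs. (norm (X *v u))\<^sup>2) \<ge> 0" by (rule sum_list_nonneg) auto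
    moreover have "(norm (X *v u))\<^sup>2 + (\<Sum>X\<leftarrow>Xs. (norm (X *v u))\<^sup>2) \<le> 0" using Cons.prems by simp
    moreover have "(norm (X *v u))\<^sup>2 \<ge> 0" by simp
    ultimately have "(norm (X *v u))\<^sup>2 = 0" "(\<Sum>X\<leftarrow>Xs. (norm (X *v u))\<^sup>2) \<le> 0" by linarith+
    with Cons.IH show ?case by simp
  qed simp
  then show ?thesis using assms(1) unfolding common_kernel_unit by blast
qed

theorem theorem29:
  fixes M D K G :: "real^'n::finite^'n" and P :: "'n qpoly"
  assumes "skew G" and "psd M" and "psd D" and "psd K"
    and P_eq: "P = dh_poly M D K G"
  shows
    "((singular P \<longleftrightarrow> common_kernel [M, D, K, G] \<noteq> {0}) \<and>
     (\<exists>u \<Delta>. norm u = 1 \<and> \<Delta> = dh_poly (Delta u M) (Delta u D) (Delta u K) (Delta u G) \<and>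
        P + \<Delta> \<in> dh_class \<and> singular (P + \<Delta>) \<and> norm \<Delta> = d_sing P) \<and>
     d_sing P = d_ck G [M, D, K] \<and>
     is_sphere_min (\<lambda>u. sqrt (2 * (norm (G *v u))\<^sup>2 + psd_cost [M, D, K] u)) (d_sing P) \<and>
     sqrt (lambda_min (M ** M + D ** D + K ** K - G ** G)) \<le> d_sing P \<and>
     d_sing P \<le> sqrt (2 * lambda_min (M ** M + D ** D + K ** K - G ** G)))
     \<and>
     ((P \<in> closure {Q \<in> dh_class. \<not> singular Q \<and> qpoly_index Q > 1} \<longleftrightarrow>
        common_kernel [M, D] \<noteq> {0}) \<and>
     (\<forall>Q \<in> (dh_class :: 'n qpoly set). \<not> singular Q \<and> qpoly_index Q > 1 \<longrightarrow> qpoly_index Q = 2) \<and>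
     (\<exists>u \<Delta>. norm u = 1 \<and> \<Delta> = dh_poly (Delta u M) (Delta u D) 0 0 \<and>
        P + \<Delta> \<in> dh_class \<and>
        P + \<Delta> \<in> closure {Q \<in> dh_class. \<not> singular Q \<and> qpoly_index Q > 1} \<and>
        norm \<Delta> = d_hi P) \<and>
     d_hi P = d_ck 0 [M, D] \<and>
     is_sphere_min (\<lambda>u. sqrt (psd_cost [M, D] u)) (d_hi P) \<and>
     sqrt (lambda_min (M ** M + D ** D)) \<le> d_hi P \<and>
     d_hi P \<le> sqrt (2 * lambda_min (M ** M + D ** D)))
     \<and>
     ((P \<in> closure {Q \<in> dh_class. unstable Q} \<longleftrightarrow>
        common_kernel [M, D] \<noteq> {0} \<or> common_kernel [D, K] \<noteq> {0}) \<and>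
     (\<exists>u \<Delta>. norm u = 1 \<and>
        (\<Delta> = dh_poly (Delta u M) (Delta u D) 0 0 \<or> \<Delta> = dh_poly 0 (Delta u D) (Delta u K) 0) \<and>
        P + \<Delta> \<in> dh_class \<and>
        P + \<Delta> \<in> closure {Q \<in> dh_class. unstable Q} \<and>
        norm \<Delta> = d_inst P) \<and>
     d_inst P = min (d_ck 0 [M, D]) (d_ck 0 [D, K]) \<and>
     (\<forall>X0 X1 :: real^'n^'n. psd X0 \<and> psd X1 \<longrightarrow>
        is_sphere_min (\<lambda>u. sqrt (psd_cost [X0, X1] u)) (d_ck 0 [X0, X1])) \<and>
     (let \<alpha> = min (lambda_min (M ** M + D ** D)) (lambda_min (D ** D + K ** K)) in
        sqrt \<alpha> \<le> d_inst P \<and> d_inst P \<le> sqrt (2 * \<alpha>)))"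
proof -
  note G = assms(1) and M = assms(2) and D = assms(3) and K = assms(4)
  let ?fs = "\<lambda>u. sqrt (2 * (norm (G *v u))\<^sup>2 + psd_cost [M, D, K] u)"
  let ?f1 = "\<lambda>u. sqrt (psd_cost [M, D] u)" and ?f2 = "\<lambda>u. sqrt (psd_cost [D, K] u)"
  let ?H = "{Q \<in> dh_class. \<not> singular Q \<and> qpoly_index (Q :: 'n qpoly) > 1}"
  let ?U = "{Q \<in> dh_class. unstable (Q :: 'n qpoly)}"
  have cont1: "continuous_on (sphere 0 1) ?f1" and cont2: "continuous_on (sphere 0 1) ?f2"
    and cont3: "continuous_on (sphere 0 1) (\<lambda>u. min (?f1 u) (?f2 u))"
    and cont0: "continuous_on (sphere 0 1) ?fs"
    by (intro continuous_intros continuous_on_psd_cost)+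
  have ck0: "is_sphere_min (\<lambda>u. sqrt (psd_cost Xs u)) (d_ck 0 Xs)" if "\<And>X. X \<in> set Xs \<Longrightarrow> psd X"
    for Xs :: "(real^'n^'n) list"
    using d_ck_sphere_min[OF skew_zero, of Xs] that by simp
  have symS: "transpose (M ** M + D ** D) = M ** M + D ** D" "transpose (D ** D + K ** K) = D ** D + K ** K"
    "transpose (M ** M + D ** D + K ** K - G ** G) = M ** M + D ** D + K ** K - G ** G"
    using M D K G by (simp_all add: transpose_add transpose_diff transpose_square_sym transpose_square_skew psd_sym)
  have quad: "u \<bullet> ((X ** X + Y ** Y) *v u) = (norm (X *v u))\<^sup>2 + (norm (Y *v u))\<^sup>2"
    if "psd X" "psd Y" for X Y :: "real^'n^'n" and u
    using that by (simp add: matrix_vector_mult_add_rdistrib inner_add_right inner_square_sym psd_sym)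

  have P1: "singular P \<longleftrightarrow> common_kernel [M, D, K, G] \<noteq> {0}"
    unfolding P_eq by (rule singular_iff_common_kernel[OF G M D K])
  let ?D0 = "\<lambda>u. dh_poly (Delta u M) (Delta u D) (Delta u K) (Delta u G)"
  have D0: "P + ?D0 u \<in> dh_class" "singular (P + ?D0 u)" "norm (?D0 u) = ?fs u" if u: "norm u = 1" for u
  proof -
    have s: "skew (G + Delta u G)" "psd (M + Delta u M)" "psd (D + Delta u D)" "psd (K + Delta u K)"
      using G M D K u by (auto intro: skew_Delta psd_Delta)
    then show "P + ?D0 u \<in> dh_class" unfolding P_eq dh_poly_add dh_class_iff by blast
    show "singular (P + ?D0 u)"
      unfolding P_eq dh_poly_add singular_iff_common_kernel[OF s] common_kernel_unit
      using u Delta_kernel[OF u] by (intro exI[of _ u]) auto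
    have "(norm (?D0 u))\<^sup>2 = 2 * (norm (G *v u))\<^sup>2 + psd_cost [M, D, K] u"
    proof -
      have "skew (Delta u G)" using skew_diff[OF s(1) G] by simp
      then show ?thesis using G M D K u
        by (simp add: norm_dh_poly transpose_Delta psd_sym psd_cost3 norm_Delta_skew)
    qed
    then show "norm (?D0 u) = ?fs u" by (metis norm_ge_zero real_sqrt_unique)
  qed
  have S: "is_sphere_min ?fs (d_sing P)"
    unfolding d_sing_def
  proof (rule is_sphere_min_Inf[OF cont0])
    fix s assume "s \<in> {norm \<Delta> | \<Delta>. P + \<Delta> \<in> dh_class \<and> singular (P + \<Delta>)}"
    then show "\<exists>u. norm u = 1 \<and> ?fs u \<le> s" using singular_perturbation_cost_le[OF G M D K] unfolding P_eq by blast
  next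
    fix u :: "real^'n" and e :: real assume u: "norm u = 1" and e: "e > 0"
    show "\<exists>s\<in>{norm \<Delta> | \<Delta>. P + \<Delta> \<in> dh_class \<and> singular (P + \<Delta>)}. s < ?fs u + e"
    proof (rule bexI)
      show "norm (?D0 u) < ?fs u + e" using D0(3)[OF u] e by simp
      show "norm (?D0 u) \<in> {norm \<Delta> | \<Delta>. P + \<Delta> \<in> dh_class \<and> singular (P + \<Delta>)}"
        using D0(1,2)[OF u] by blast
    qed
  qed
  have S2: "\<exists>u \<Delta>. norm u = 1 \<and> \<Delta> = ?D0 u \<and> P + \<Delta> \<in> dh_class \<and> singular (P + \<Delta>) \<and> norm \<Delta> = d_sing P"
    using S D0 unfolding is_sphere_min_def by metis
  have S3: "d_sing P = d_ck G [M, D, K]"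
    by (rule is_sphere_min_unique[OF S d_ck_sphere_min[OF G]]) (use M D K in auto)
  have quad3: "u \<bullet> ((M ** M + D ** D + K ** K - G ** G) *v u) =
    (norm (M *v u))\<^sup>2 + (norm (D *v u))\<^sup>2 + (norm (K *v u))\<^sup>2 + (norm (G *v u))\<^sup>2" for u
    using M D K G by (simp add: matrix_vector_mult_add_rdistrib matrix_vector_mult_diff_rdistrib inner_add_right
      inner_diff_right inner_square_sym inner_square_skew psd_sym)
  have bounds3: "u \<bullet> ((M ** M + D ** D + K ** K - G ** G) *v u) \<le> 2 * (norm (G *v u))\<^sup>2 + psd_cost [M, D, K] u"
    "2 * (norm (G *v u))\<^sup>2 + psd_cost [M, D, K] u \<le> 2 * (u \<bullet> ((M ** M + D ** D + K ** K - G ** G) *v u))"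
    if "norm u = 1" for u
    using psd_cost_bounds[OF that, of "[M, D, K]"] unfolding quad3 by (simp_all add: add_increasing)
  note S4 = sphere_min_sandwich[OF S lambda_min_sphere_min[OF symS(3)] bounds3]

  let ?D1 = "\<lambda>u. dh_poly (Delta u M) (Delta u D) 0 0" and ?D2 = "\<lambda>u. dh_poly 0 (Delta u D) (Delta u K) 0"
  have D1: "P + ?D1 u \<in> dh_class" "P + ?D1 u \<in> closure ?H" "P + ?D1 u \<in> closure ?U" "norm (?D1 u) = ?f1 u"
    if u: "norm u = 1" for u
  proof -
    have s: "psd (M + Delta u M)" "psd (D + Delta u D)"
      using M D u by (auto intro: psd_Delta)
    have eq: "P + ?D1 u = dh_poly (M + Delta u M) (D + Delta u D) K G" by (simp add: P_eq dh_poly_add)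
    show "P + ?D1 u \<in> dh_class" unfolding eq dh_class_iff using s K G by blast
    show "P + ?D1 u \<in> closure ?H" "P + ?D1 u \<in> closure ?U"
      unfolding eq using closure_regular_index_2[OF G s K u] closure_unstable_MD[OF G s K u] Delta_kernel[OF u] by auto
    have "(norm (?D1 u))\<^sup>2 = psd_cost [M, D] u"
      using M D u by (simp add: norm_dh_poly skew_zero transpose_Delta psd_sym psd_cost2)
    then show "norm (?D1 u) = ?f1 u" by (metis norm_ge_zero real_sqrt_unique)
  qed
  have D2: "P + ?D2 u \<in> dh_class" "P + ?D2 u \<in> closure ?U" "norm (?D2 u) = ?f2 u"
    if u: "norm u = 1" for u
  proof -
    have s: "psd (D + Delta u D)" "psd (K + Delta u K)"
      using K D u by (auto intro: psd_Delta)
    have eq: "P + ?D2 u = dh_poly M (D + Delta u D) (K + Delta u K) G" by (simp add: P_eq dh_poly_add)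
    show "P + ?D2 u \<in> dh_class" unfolding eq dh_class_iff using s M G by blast
    show "P + ?D2 u \<in> closure ?U"
      unfolding eq using closure_unstable_DK[OF G M s u] Delta_kernel[OF u] by auto
    have "(norm (?D2 u))\<^sup>2 = psd_cost [D, K] u"
      using D K u by (simp add: norm_dh_poly skew_zero transpose_Delta psd_sym psd_cost2)
    then show "norm (?D2 u) = ?f2 u" by (metis norm_ge_zero real_sqrt_unique)
  qed

  have H: "is_sphere_min ?f1 (d_hi P)"
    unfolding d_hi_def
  proof (rule is_sphere_min_Inf[OF cont1])
    fix s assume "s \<in> {norm \<Delta> | \<Delta>. P + \<Delta> \<in> dh_class \<and> qpoly_index (P + \<Delta>) \<ge> 2}"
    then show "\<exists>u. norm u = 1 \<and> ?f1 u \<le> s" using higher_index_perturbation_cost_le[OF G M D K] unfolding P_eq by blast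
  next
    fix u :: "real^'n" and e :: real assume u: "norm u = 1" and e: "e > 0"
    have "?H \<subseteq> {Q \<in> dh_class. qpoly_index Q \<ge> 2}" by auto
    then have "P + ?D1 u \<in> closure {Q \<in> dh_class. qpoly_index Q \<ge> 2}"
      using D1(2)[OF u] closure_mono by blast
    from Inf_upper_closure[OF this D1(4)[OF u] e]
    show "\<exists>s\<in>{norm \<Delta> | \<Delta>. P + \<Delta> \<in> dh_class \<and> qpoly_index (P + \<Delta>) \<ge> 2}. s < ?f1 u + e" .
  qed
  have H1: "P \<in> closure ?H \<longleftrightarrow> common_kernel [M, D] \<noteq> {0}"
  proof
    assume P: "P \<in> closure ?H"
    have "\<exists>u. norm u = 1 \<and> ?f1 u \<le> norm (Q - P)" if "Q \<in> ?H" for Q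
      using higher_index_perturbation_cost_le[OF G M D K, of "Q - P"] that by (simp add: P_eq)
    from closure_sphere_zero[OF cont1 this P]
    show "common_kernel [M, D] \<noteq> {0}" using psd_cost_zero by blast
  next
    assume "common_kernel [M, D] \<noteq> {0}"
    then obtain u where "norm u = 1" "M *v u = 0" "D *v u = 0" unfolding common_kernel_unit by auto
    then show "P \<in> closure ?H" unfolding P_eq by (rule closure_regular_index_2[OF G M D K])
  qed
  have H2: "\<forall>Q \<in> (dh_class :: 'n qpoly set). \<not> singular Q \<and> qpoly_index Q > 1 \<longrightarrow> qpoly_index Q = 2"
    by (auto simp: dh_class_iff intro!: index_eq_2)
  have H3: "\<exists>u \<Delta>. norm u = 1 \<and> \<Delta> = ?D1 u \<and> P + \<Delta> \<in> dh_class \<and> P + \<Delta> \<in> closure ?H \<and> norm \<Delta> = d_hi P"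
  proof -
    obtain u where u: "norm u = 1" "?f1 u = d_hi P" using H unfolding is_sphere_min_def by blast
    show ?thesis using u D1[OF u(1)] by (intro exI[of _ u] exI[of _ "?D1 u"]) simp
  qed
  have H4: "d_hi P = d_ck 0 [M, D]"
    by (rule is_sphere_min_unique[OF H ck0]) (use M D in auto)
  have sandwich: "sqrt (lambda_min (X ** X + Y ** Y)) \<le> d_ck 0 [X, Y]"
    "d_ck 0 [X, Y] \<le> sqrt (2 * lambda_min (X ** X + Y ** Y))"
    if "psd X" "psd Y" for X Y :: "real^'n^'n"
  proof -
    have "transpose (X ** X + Y ** Y) = X ** X + Y ** Y"
      using that by (simp add: transpose_add transpose_square_sym psd_sym)
    note * = lambda_min_sphere_min[OF this]
    have "is_sphere_min (\<lambda>u. sqrt (psd_cost [X, Y] u)) (d_ck 0 [X, Y])"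
      by (rule ck0) (use that in auto)
    note ** = sphere_min_sandwich[OF this *]
    show "sqrt (lambda_min (X ** X + Y ** Y)) \<le> d_ck 0 [X, Y]"
      "d_ck 0 [X, Y] \<le> sqrt (2 * lambda_min (X ** X + Y ** Y))"
      by (rule **; use psd_cost_bounds[of _ "[X, Y]"] in \<open>simp add: quad[OF that]\<close>)+
  qed

  have I: "is_sphere_min (\<lambda>u. min (?f1 u) (?f2 u)) (d_inst P)"
    unfolding d_inst_def
  proof (rule is_sphere_min_Inf[OF cont3])
    fix s assume "s \<in> {norm \<Delta> | \<Delta>. P + \<Delta> \<in> dh_class \<and> unstable (P + \<Delta>)}"
    then show "\<exists>u. norm u = 1 \<and> min (?f1 u) (?f2 u) \<le> s" using unstable_perturbation_cost_le[OF G M D K] unfolding P_eq by blast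
  next
    fix u :: "real^'n" and e :: real assume u: "norm u = 1" and e: "e > 0"
    show "\<exists>s\<in>{norm \<Delta> | \<Delta>. P + \<Delta> \<in> dh_class \<and> unstable (P + \<Delta>)}. s < min (?f1 u) (?f2 u) + e"
      using Inf_upper_closure[OF D1(3)[OF u] D1(4)[OF u] e] Inf_upper_closure[OF D2(2)[OF u] D2(3)[OF u] e]
      by (cases "?f1 u \<le> ?f2 u") (simp_all add: min_def)
  qed
  have I1: "P \<in> closure ?U \<longleftrightarrow> common_kernel [M, D] \<noteq> {0} \<or> common_kernel [D, K] \<noteq> {0}"
  proof
    assume P: "P \<in> closure ?U"
    have "\<exists>u. norm u = 1 \<and> min (?f1 u) (?f2 u) \<le> norm (Q - P)" if "Q \<in> ?U" for Q
      using unstable_perturbation_cost_le[OF G M D K, of "Q - P"] that by (simp add: P_eq)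
    from closure_sphere_zero[OF cont3 this P]
    obtain u where "norm u = 1" "?f1 u \<le> 0 \<or> ?f2 u \<le> 0" by (auto simp: min_le_iff_disj)
    then show "common_kernel [M, D] \<noteq> {0} \<or> common_kernel [D, K] \<noteq> {0}" using psd_cost_zero by blast
  next
    assume "common_kernel [M, D] \<noteq> {0} \<or> common_kernel [D, K] \<noteq> {0}"
    then obtain u where u: "norm u = 1" "D *v u = 0" "M *v u = 0 \<or> K *v u = 0"
      unfolding common_kernel_unit by auto
    then show "P \<in> closure ?U" unfolding P_eq
      using closure_unstable_MD[OF G M D K u(1)] closure_unstable_DK[OF G M D K u(1,2)] by blast
  qed
  have I2: "\<exists>u \<Delta>. norm u = 1 \<and> (\<Delta> = ?D1 u \<or> \<Delta> = ?D2 u) \<and> P + \<Delta> \<in> dh_class \<and> P + \<Delta> \<in> closure ?U \<and> norm \<Delta> = d_inst P"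
  proof -
    obtain u where u: "norm u = 1" "min (?f1 u) (?f2 u) = d_inst P" using I unfolding is_sphere_min_def by blast
    show ?thesis
    proof (cases "?f1 u \<le> ?f2 u")
      case True
      then show ?thesis using u D1[OF u(1)] by (intro exI[of _ u] exI[of _ "?D1 u"]) (simp add: min_def)
    next
      case False
      then show ?thesis using u D2[OF u(1)] by (intro exI[of _ u] exI[of _ "?D2 u"]) (simp add: min_def)
    qed
  qed
  have I3: "d_inst P = min (d_ck 0 [M, D]) (d_ck 0 [D, K])"
    by (rule is_sphere_min_unique[OF I is_sphere_min_min[OF ck0 ck0]]) (use M D K in auto)
  have I4: "\<forall>X0 X1 :: real^'n^'n. psd X0 \<and> psd X1 \<longrightarrow> is_sphere_min (\<lambda>u. sqrt (psd_cost [X0, X1] u)) (d_ck 0 [X0, X1])"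
    by (auto intro!: ck0)
  have I5: "let \<alpha> = min (lambda_min (M ** M + D ** D)) (lambda_min (D ** D + K ** K)) in
        sqrt \<alpha> \<le> d_inst P \<and> d_inst P \<le> sqrt (2 * \<alpha>)"
  proof -
    have min_sqrt: "sqrt (c * min a b) = min (sqrt (c * a)) (sqrt (c * b))" if "c > 0" for a b c :: real
      using that by (simp add: min_def)
    have "sqrt (min a b) = min (sqrt a) (sqrt b)" for a b using min_sqrt[of 1 a b] by simp
    then show ?thesis unfolding I3 Let_def
      by (simp only: min_sqrt[of 2] zero_less_numeral) (intro conjI min.mono sandwich M D K)
  qed
  note H5 = sandwich[OF M D, folded H4]
  show ?thesis
    by (intro conjI P1 S2 S3 S S4 H1 H2 H3 H4 H H5 I1 I2 I3 I4 I5)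
qed

end
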